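(* Let $G$ be a Lie group with Lie algebra $\mathfrak{g}$, let $a>0$, let $L:T^{(2)}G\to\mathbb{R}$ be a left-invariant Lagrangian with reduced Lagrangian $\ell:2\mathfrak{g}=\mathfrak{g}\times\mathfrak{g}\to\mathbb{R}$, and let $g\in\mathcal{C}(G)$. The following are equivalent: 1. (Hamilton's principle) The curve $g(t)$ satisfies $\delta S(g)=0$ for $S:\mathcal{C}(G)\to\mathbb{R}$, $S=\int_0^a L(g,\dot g,\ddot g)\,dt$, with respect to arbitrary variations $\delta g\in T_g\mathcal{C}(G)$ which fix $g(0),g(a),\dot g(0),\dot g(a)$. 2. (Reduced Hamilton's principle) The curve $v(t):=g^{-1}(t)\dot g(t)$ satisfies $\delta \mathrm{s}(v)=0$ for $\mathrm{s}:\mathcal{C}(\mathfrak{g})\to\mathbb{R}$, $\mathrm{s}=\int_0^a\ell(v,\dot v)\,dt$, with respect to variations of the form $\delta v=\dot\eta+\operatorname{ad}_v\eta$, where $\eta\in\mathcal{C}(\mathfrak{g})$ with $\eta(0)=\eta(a)=\dot\eta(0)=\dot\eta(a)=0$. 3. (Reduced higher-order Hamilton--Pontryagin (HOHP) principle) There exists a curve $\gamma=(g,\xi,u,\mu,\nu)$ in $P^{(2)}G$ with projection $\Pi\circ\gamma=g$ that satisfies $\delta s_{hp}(\gamma)=0$ for $s_{hp}:\mathcal{C}(P^{(2)}G)\to\mathbb{R}$, $$s_{hp}=\int_0^a \ell(\xi,u)+\langle\mu,g^{-1}\dot g-\xi\rangle+\langle\nu,\dot\xi-u\rangle\,dt,$$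 with respect to variations $\delta\gamma\in T_\gamma\mathcal{C}(P^{(2)}G)$ with $\delta g(0)=\delta g(a)=0$ and $\delta\xi(0)=\delta\xi(a)=0$.
   Context: For a manifold $M$, $\mathcal{C}(M)$ is the set of smooth curves $[0,a]\to M$; $\delta S(g)=0$ means that the derivative of $S$ along every admissible variation vanishes, where a variation $\delta g\in T_g\mathcal{C}(G)$ is a vector field along $g$. $T^{(2)}G$ is the second-order tangent bundle: equivalence classes $[\gamma]^{(2)}_{g(0)}=(g(0),\dot g(0),\ddot g(0))$ of curves in $G$ whose value and first two derivatives at $t=0$ agree in local charts. With $\xi(t)=g(t)^{-1}\dot g(t)$ (where $g^{-1}v_g:=TL_{g^{-1}}v_g$ and $L_g$ is left multiplication), the left trivialisation $T^{(2)}G\cong G\times 2\mathfrak{g}$ is $[\gamma]^{(2)}_{g(0)}\mapsto(g(0),\xi(0),\dot\xi(0))$; here $k\mathfrak{g}$ and $k\mathfrak{g}^*$ denote $k$-fold products. $L$ (smooth) is left-invariant if its left trivialisation $l:G\times2\mathfrak{g}\to\mathbb{R}$ does not depend on the first entry, and then $\ell:2\mathfrak{g}\to\mathbb{R}$ is the induced function, so that $L(g,\dot g,\ddot g)=\ell(\xi,\dot\xi)$. The second-order Pontryagin bundle is $P^{(2)}G=T^{(2)}G\times_{TG}T^*(TG)$, left-trivialised as $P^{(2)}G\cong G\times2\mathfrak{g}\times2\mathfrak{g}^*$ with elements written $(g,\xi,u,\mu,\nu)$, and $\Pi:P^{(2)}G\to G$ is the projection onto the first factor. $\langle\cdot,\cdot\rangle$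 is the pairing of $\mathfrak{g}^*$ with $\mathfrak{g}$. *)

theory Defs
  imports "HOL-Analysis.Analysis" "HOL-Algebra.Group"
begin

text \<open>
  \<open>C\<^sup>k\<close> functions by recursion on directional derivatives. Used only on open sets of
  finite-dimensional spaces, where this is the usual notion.
\<close>

primrec ck_on :: "nat \<Rightarrow> 'a::real_normed_vector set \<Rightarrow> ('a \<Rightarrow> 'b::real_normed_vector) \<Rightarrow> bool" where
  "ck_on 0 D f = continuous_on D f"
| "ck_on (Suc k) D f =
     ((\<forall>x\<in>D. f differentiable (at x)) \<and> (\<forall>v. ck_on k D (\<lambda>x. frechet_derivative f (at x) v)))"

definition smooth_on :: "'a::real_normed_vector set \<Rightarrow> ('a \<Rightarrow> 'b::real_normed_vector) \<Rightarrow> bool" where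
  "smooth_on D f \<longleftrightarrow> (\<forall>k. ck_on k D f)"

text \<open>
  A chart is a pair of its domain and its coordinate function. The model space \<open>'e\<close> is a
  finite-dimensional inner product space rather than a type of class \<open>euclidean_space\<close>, because that
  class excludes dimension 0.
\<close>

type_synonym ('m, 'e) chart = "'m set \<times> ('m \<Rightarrow> 'e)"

locale smooth_manifold =
  fixes T :: "'m topology" and A :: "('m, 'e::real_inner) chart set"
  assumes hausdorff: "Hausdorff_space T"
    and second_countable: "second_countable T"
    and finite_dimensional: "\<exists>B::'e set. finite B \<and> span B = UNIV"
    and openin_domain: "(U, \<phi>) \<in> A \<Longrightarrow> openin T U"
    and open_range: "(U, \<phi>) \<in> A \<Longrightarrow> open (\<phi> ` U)"
    and homeomorphic_chart:
      "(U, \<phi>) \<in> A \<Longrightarrow> homeomorphic_map (subtopology T U) (top_of_set (\<phi> ` U)) \<phi>"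
    and covering: "(\<Union>(U, \<phi>)\<in>A. U) = topspace T"
    and smooth_transition:
      "(U, \<phi>) \<in> A \<Longrightarrow> (V, \<psi>) \<in> A \<Longrightarrow> smooth_on (\<phi> ` (U \<inter> V)) (\<psi> \<circ> inv_into U \<phi>)"

text \<open>
  Smooth maps from an open subset \<open>D\<close> of a normed space to the manifold with atlas \<open>A\<close>; openness of
  the preimages of chart domains is continuity.
\<close>

definition smooth_into ::
    "('m, 'e::real_normed_vector) chart set \<Rightarrow> 'p::real_normed_vector set \<Rightarrow> ('p \<Rightarrow> 'm) \<Rightarrow> bool" where
  "smooth_into A D f \<longleftrightarrow> open D \<and> f ` D \<subseteq> (\<Union>(U, \<phi>)\<in>A. U) \<and>
     (\<forall>(U, \<phi>)\<in>A. open {x\<in>D. f x \<in> U} \<and> smooth_on {x\<in>D. f x \<in> U} (\<phi> \<circ> f))"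

text \<open>
  On a set \<open>S\<close> that is not open (below: \<open>[0,a]\<close> and \<open>(-\<epsilon>,\<epsilon>) \<times> [0,a]\<close>), smoothness means existence of a
  smooth extension to an open neighbourhood.
\<close>

definition smooth_map_on ::
    "('m, 'e::real_normed_vector) chart set \<Rightarrow> 'p::real_normed_vector set \<Rightarrow> ('p \<Rightarrow> 'm) \<Rightarrow> bool" where
  "smooth_map_on A S f \<longleftrightarrow> (\<exists>D h. S \<subseteq> D \<and> smooth_into A D h \<and> (\<forall>x\<in>S. f x = h x))"

definition smooth_fun_on ::
    "'p::real_normed_vector set \<Rightarrow> ('p \<Rightarrow> 'b::real_normed_vector) \<Rightarrow> bool" where
  "smooth_fun_on S f \<longleftrightarrow> (\<exists>D h. open D \<and> S \<subseteq> D \<and> smooth_on D h \<and> (\<forall>x\<in>S. f x = h x))"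

record ('g, 'e) lie_data = "'g monoid" +
  topo :: "'g topology"
  charts :: "('g, 'e) chart set"

locale lie_group = group G + smooth_manifold "topo G" "charts G"
  for G :: "('g, 'e::real_inner) lie_data" (structure) +
  assumes carrier_topspace: "carrier G = topspace (topo G)"
    and smooth_mult: "(U, \<phi>) \<in> charts G \<Longrightarrow> (V, \<psi>) \<in> charts G \<Longrightarrow>
      smooth_into (charts G) (\<phi> ` U \<times> \<psi> ` V) (\<lambda>(x, y). inv_into U \<phi> x \<otimes> inv_into V \<psi> y)"
    and smooth_inv: "(U, \<phi>) \<in> charts G \<Longrightarrow>
      smooth_into (charts G) (\<phi> ` U) (\<lambda>x. inv (inv_into U \<phi> x))"

text \<open>
  The Lie algebra is the tangent space at the identity, identified with the model space \<open>'e\<close> by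
  \<open>[c] \<mapsto> (\<phi> \<circ> c)'(0)\<close> for a fixed chart \<open>\<phi>\<close> around the identity. Its dual is \<open>'e \<Rightarrow>\<^sub>L real\<close>.
\<close>

definition id_chart :: "('g, 'e) lie_data \<Rightarrow> ('g, 'e) chart" where
  "id_chart G = (SOME (U, \<phi>). (U, \<phi>) \<in> charts G \<and> \<one>\<^bsub>G\<^esub> \<in> U)"

definition id_coord :: "('g, 'e) lie_data \<Rightarrow> 'g \<Rightarrow> 'e" where
  "id_coord G = snd (id_chart G)"

definition id_param :: "('g, 'e) lie_data \<Rightarrow> 'e \<Rightarrow> 'g" where
  "id_param G = inv_into (fst (id_chart G)) (snd (id_chart G))"

text \<open>
  \<open>Ad\<^sub>h\<close> is the derivative at the identity of conjugation by \<open>h\<close>, and \<open>ad\<close> is the derivative of \<open>Ad\<close>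
  at the identity.
\<close>

definition Ad :: "('g, 'e::real_normed_vector) lie_data \<Rightarrow> 'g \<Rightarrow> 'e \<Rightarrow> 'e" where
  "Ad G h = frechet_derivative
     (\<lambda>x. id_coord G (h \<otimes>\<^bsub>G\<^esub> id_param G x \<otimes>\<^bsub>G\<^esub> inv\<^bsub>G\<^esub> h)) (at (id_coord G \<one>\<^bsub>G\<^esub>))"

definition ad :: "('g, 'e::real_normed_vector) lie_data \<Rightarrow> 'e \<Rightarrow> 'e \<Rightarrow> 'e" where
  "ad G \<xi> \<eta> = frechet_derivative (\<lambda>x. Ad G (id_param G x) \<eta>) (at (id_coord G \<one>\<^bsub>G\<^esub>)) \<xi>"

text \<open>
  \<open>g(t)\<^sup>-\<^sup>1 g'(t) = TL\<^bsub>g(t)\<^sup>-\<^sup>1\<^esub> g'(t)\<close> is the velocity at \<open>\<tau> = t\<close> of the curve \<open>\<tau> \<mapsto> g(t)\<^sup>-\<^sup>1 g(\<tau>)\<close>, which passes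
  through the identity at that time. \<open>I\<close> is the domain of the curve \<open>g\<close>: it is \<open>[0,a]\<close> or,
  for germs, \<open>UNIV\<close>.
\<close>

definition left_velocity ::
    "('g, 'e::real_normed_vector) lie_data \<Rightarrow> real set \<Rightarrow> (real \<Rightarrow> 'g) \<Rightarrow> real \<Rightarrow> 'e" where
  "left_velocity G I g t =
     vector_derivative (\<lambda>\<tau>. id_coord G (inv\<^bsub>G\<^esub> (g t) \<otimes>\<^bsub>G\<^esub> g \<tau>)) (at t within I)"

definition germ :: "('g, 'e::real_normed_vector) lie_data \<Rightarrow> (real \<Rightarrow> 'g) \<Rightarrow> bool" where
  "germ G c \<longleftrightarrow> (\<exists>e>0. smooth_into (charts G) {-e<..<e} c)"

definition jet_coords ::
    "('g \<Rightarrow> 'e::real_normed_vector) \<Rightarrow> real set \<Rightarrow> (real \<Rightarrow> 'g) \<Rightarrow> real \<Rightarrow> 'e \<times> 'e \<times> 'e" where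
  "jet_coords \<phi> I g t =
     (\<phi> (g t),
      vector_derivative (\<phi> \<circ> g) (at t within I),
      vector_derivative (\<lambda>\<tau>. vector_derivative (\<phi> \<circ> g) (at \<tau> within I)) (at t within I))"

text \<open>
  An element of \<open>T\<^sup>(\<^sup>2\<^sup>)G\<close> is an equivalence class of curves defined near 0. \<open>jet2 G I g t\<close> is the
  element \<open>(g(t), g'(t), g''(t))\<close> determined at time \<open>t\<close> by a curve \<open>g\<close> with domain \<open>I\<close>.
\<close>

definition jet2 ::
    "('g, 'e::real_normed_vector) lie_data \<Rightarrow> real set \<Rightarrow> (real \<Rightarrow> 'g) \<Rightarrow> real \<Rightarrow> (real \<Rightarrow> 'g) set" where
  "jet2 G I g t = {c. germ G c \<and> c 0 = g t \<and>
     (\<forall>(U, \<phi>)\<in>charts G. g t \<in> U \<longrightarrow> jet_coords \<phi> UNIV c 0 = jet_coords \<phi> I g t)}"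

definition T2 :: "('g, 'e::real_normed_vector) lie_data \<Rightarrow> (real \<Rightarrow> 'g) set set" where
  "T2 G = {jet2 G UNIV c 0 | c. germ G c}"

text \<open>
  Smoothness on \<open>T\<^sup>(\<^sup>2\<^sup>)G\<close> in the charts \<open>[c] \<mapsto> ((\<phi> \<circ> c)(0), (\<phi> \<circ> c)'(0), (\<phi> \<circ> c)''(0))\<close>; the inverse of
  such a chart sends \<open>(x, v, w)\<close> to the class of \<open>t \<mapsto> \<phi>\<^sup>-\<^sup>1(x + t v + t\<^sup>2 w/2)\<close>.
\<close>

definition smooth_lagrangian ::
    "('g, 'e::real_normed_vector) lie_data \<Rightarrow> ((real \<Rightarrow> 'g) set \<Rightarrow> real) \<Rightarrow> bool" where
  "smooth_lagrangian G L \<longleftrightarrow> (\<forall>(U, \<phi>)\<in>charts G. smooth_on (\<phi> ` U \<times> UNIV \<times> UNIV)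
     (\<lambda>(x, v, w). L (jet2 G UNIV (\<lambda>t. inv_into U \<phi> (x + t *\<^sub>R v + (t\<^sup>2 / 2) *\<^sub>R w)) 0)))"

definition left_triv ::
    "('g, 'e::real_normed_vector) lie_data \<Rightarrow> (real \<Rightarrow> 'g) set \<Rightarrow> 'g \<times> 'e \<times> 'e" where
  "left_triv G j = (let c = SOME c. c \<in> j in
     (c 0, left_velocity G UNIV c 0, vector_derivative (left_velocity G UNIV c) (at 0)))"

definition trivialised_lagrangian ::
    "('g, 'e::real_normed_vector) lie_data \<Rightarrow> ((real \<Rightarrow> 'g) set \<Rightarrow> real) \<Rightarrow> 'g \<times> 'e \<times> 'e \<Rightarrow> real" where
  "trivialised_lagrangian G L = L \<circ> inv_into (T2 G) (left_triv G)"

definition left_invariant ::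
    "('g, 'e::real_normed_vector) lie_data \<Rightarrow> ((real \<Rightarrow> 'g) set \<Rightarrow> real) \<Rightarrow> bool" where
  "left_invariant G L \<longleftrightarrow> (\<forall>h\<in>carrier G. \<forall>h'\<in>carrier G. \<forall>\<xi> u.
     trivialised_lagrangian G L (h, \<xi>, u) = trivialised_lagrangian G L (h', \<xi>, u))"

definition reduced_lagrangian ::
    "('g, 'e::real_normed_vector) lie_data \<Rightarrow> ((real \<Rightarrow> 'g) set \<Rightarrow> real) \<Rightarrow> 'e \<times> 'e \<Rightarrow> real" where
  "reduced_lagrangian G L = (\<lambda>(\<xi>, u). trivialised_lagrangian G L (\<one>\<^bsub>G\<^esub>, \<xi>, u))"

text \<open>
  A variation \<open>\<delta>c\<close> of a curve \<open>c\<close> is the field \<open>\<partial>\<^sub>s \<Gamma>(s,t)\<close> at \<open>s = 0\<close> of a smooth family \<open>\<Gamma>\<close> of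
  curves with \<open>\<Gamma>(0,\<cdot>) = c\<close>, and the derivative of \<open>S\<close> along \<open>\<delta>c\<close> is that of \<open>s \<mapsto> S(\<Gamma>(s,\<cdot>))\<close> at 0.
  Admissibility of \<open>\<delta>c\<close> is a condition on that field, hence first-order in \<open>s\<close>.
\<close>

definition critical :: "((real \<Rightarrow> 'x) \<Rightarrow> real) \<Rightarrow> (real \<Rightarrow> real \<Rightarrow> 'x) set \<Rightarrow> bool" where
  "critical S V \<longleftrightarrow> (\<forall>\<Gamma>\<in>V. ((\<lambda>s. S (\<Gamma> s)) has_real_derivative 0) (at 0))"

definition group_families ::
    "('g, 'e::real_normed_vector) lie_data \<Rightarrow> real \<Rightarrow> (real \<Rightarrow> 'g) \<Rightarrow> (real \<Rightarrow> real \<Rightarrow> 'g) set" where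
  "group_families G a g = {\<Gamma>. (\<forall>t\<in>{0..a}. \<Gamma> 0 t = g t) \<and>
     (\<exists>e>0. smooth_map_on (charts G) ({-e<..<e} \<times> {0..a}) (\<lambda>(s, t). \<Gamma> s t))}"

definition vector_families ::
    "real \<Rightarrow> (real \<Rightarrow> 'b::real_normed_vector) \<Rightarrow> (real \<Rightarrow> real \<Rightarrow> 'b) set" where
  "vector_families a c = {\<Gamma>. (\<forall>t\<in>{0..a}. \<Gamma> 0 t = c t) \<and>
     (\<exists>e>0. smooth_fun_on ({-e<..<e} \<times> {0..a}) (\<lambda>(s, t). \<Gamma> s t))}"

definition fixes_value ::
    "('g, 'e::real_normed_vector) lie_data \<Rightarrow> (real \<Rightarrow> real \<Rightarrow> 'g) \<Rightarrow> real \<Rightarrow> bool" where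
  "fixes_value G \<Gamma> t \<longleftrightarrow> (\<forall>(U, \<phi>)\<in>charts G. \<Gamma> 0 t \<in> U \<longrightarrow>
     ((\<lambda>s. \<phi> (\<Gamma> s t)) has_vector_derivative 0) (at 0))"

definition fixes_velocity ::
    "('g, 'e::real_normed_vector) lie_data \<Rightarrow> real \<Rightarrow> (real \<Rightarrow> real \<Rightarrow> 'g) \<Rightarrow> real \<Rightarrow> bool" where
  "fixes_velocity G a \<Gamma> t \<longleftrightarrow> (\<forall>(U, \<phi>)\<in>charts G. \<Gamma> 0 t \<in> U \<longrightarrow>
     ((\<lambda>s. vector_derivative (\<phi> \<circ> \<Gamma> s) (at t within {0..a})) has_vector_derivative 0) (at 0))"

definition action ::
    "('g, 'e::real_normed_vector) lie_data \<Rightarrow> ((real \<Rightarrow> 'g) set \<Rightarrow> real) \<Rightarrow> real \<Rightarrow> (real \<Rightarrow> 'g) \<Rightarrow> real" where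
  "action G L a g = integral {0..a} (\<lambda>t. L (jet2 G {0..a} g t))"

definition hamilton_variations ::
    "('g, 'e::real_normed_vector) lie_data \<Rightarrow> real \<Rightarrow> (real \<Rightarrow> 'g) \<Rightarrow> (real \<Rightarrow> real \<Rightarrow> 'g) set" where
  "hamilton_variations G a g = {\<Gamma>\<in>group_families G a g.
     fixes_value G \<Gamma> 0 \<and> fixes_value G \<Gamma> a \<and> fixes_velocity G a \<Gamma> 0 \<and> fixes_velocity G a \<Gamma> a}"

definition reduced_action :: "('e::real_normed_vector \<times> 'e \<Rightarrow> real) \<Rightarrow> real \<Rightarrow> (real \<Rightarrow> 'e) \<Rightarrow> real" where
  "reduced_action l a v =
     integral {0..a} (\<lambda>t. l (v t, vector_derivative v (at t within {0..a})))"

definition reduced_variations ::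
    "('g, 'e::real_normed_vector) lie_data \<Rightarrow> real \<Rightarrow> (real \<Rightarrow> 'e) \<Rightarrow> (real \<Rightarrow> real \<Rightarrow> 'e) set" where
  "reduced_variations G a v = {\<Gamma>\<in>vector_families a v. \<exists>\<eta> \<eta>'.
     smooth_fun_on {0..a} \<eta> \<and>
     (\<forall>t\<in>{0..a}. (\<eta> has_vector_derivative \<eta>' t) (at t within {0..a})) \<and>
     \<eta> 0 = 0 \<and> \<eta> a = 0 \<and> \<eta>' 0 = 0 \<and> \<eta>' a = 0 \<and>
     (\<forall>t\<in>{0..a}. ((\<lambda>s. \<Gamma> s t) has_vector_derivative (\<eta>' t + ad G (v t) (\<eta> t))) (at 0))}"

text \<open>Points \<open>(g, \<xi>, u, \<mu>, \<nu>)\<close> of the left-trivialised bundle \<open>P\<^sup>(\<^sup>2\<^sup>)G\<close>; the projection to \<open>G\<close> is \<open>fst\<close>.\<close>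

type_synonym ('g, 'e) pontryagin2 = "'g \<times> 'e \<times> 'e \<times> ('e \<Rightarrow>\<^sub>L real) \<times> ('e \<Rightarrow>\<^sub>L real)"

definition pontryagin_curve ::
    "('g, 'e::real_normed_vector) lie_data \<Rightarrow> real \<Rightarrow> (real \<Rightarrow> ('g, 'e) pontryagin2) \<Rightarrow> bool" where
  "pontryagin_curve G a \<gamma> \<longleftrightarrow>
     smooth_map_on (charts G) {0..a} (fst \<circ> \<gamma>) \<and> smooth_fun_on {0..a} (snd \<circ> \<gamma>)"

definition hp_action ::
    "('g, 'e::real_normed_vector) lie_data \<Rightarrow> ('e \<times> 'e \<Rightarrow> real) \<Rightarrow> real \<Rightarrow>
      (real \<Rightarrow> ('g, 'e) pontryagin2) \<Rightarrow> real" where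
  "hp_action G l a \<gamma> = integral {0..a} (\<lambda>t. case \<gamma> t of (_, \<xi>, u, \<mu>, \<nu>) \<Rightarrow>
     l (\<xi>, u)
     + blinfun_apply \<mu> (left_velocity G {0..a} (fst \<circ> \<gamma>) t - \<xi>)
     + blinfun_apply \<nu> (vector_derivative (\<lambda>\<tau>. fst (snd (\<gamma> \<tau>))) (at t within {0..a}) - u))"

definition hp_variations ::
    "('g, 'e::real_normed_vector) lie_data \<Rightarrow> real \<Rightarrow> (real \<Rightarrow> ('g, 'e) pontryagin2) \<Rightarrow>
      (real \<Rightarrow> real \<Rightarrow> ('g, 'e) pontryagin2) set" where
  "hp_variations G a \<gamma> = {\<Gamma>.
     (\<lambda>s. fst \<circ> \<Gamma> s) \<in> group_families G a (fst \<circ> \<gamma>) \<and>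
     (\<lambda>s. snd \<circ> \<Gamma> s) \<in> vector_families a (snd \<circ> \<gamma>) \<and>
     (\<forall>t\<in>{0, a}. fixes_value G (\<lambda>s. fst \<circ> \<Gamma> s) t \<and>
        ((\<lambda>s. fst (snd (\<Gamma> s t))) has_vector_derivative 0) (at 0))}"

definition hamilton_principle ::
    "('g, 'e::real_normed_vector) lie_data \<Rightarrow> ((real \<Rightarrow> 'g) set \<Rightarrow> real) \<Rightarrow> real \<Rightarrow> (real \<Rightarrow> 'g) \<Rightarrow> bool" where
  "hamilton_principle G L a g \<longleftrightarrow> critical (action G L a) (hamilton_variations G a g)"

definition reduced_hamilton_principle ::
    "('g, 'e::real_normed_vector) lie_data \<Rightarrow> ('e \<times> 'e \<Rightarrow> real) \<Rightarrow> real \<Rightarrow> (real \<Rightarrow> 'e) \<Rightarrow> bool" where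
  "reduced_hamilton_principle G l a v \<longleftrightarrow> critical (reduced_action l a) (reduced_variations G a v)"

definition reduced_hohp_principle ::
    "('g, 'e::real_normed_vector) lie_data \<Rightarrow> ('e \<times> 'e \<Rightarrow> real) \<Rightarrow> real \<Rightarrow> (real \<Rightarrow> 'g) \<Rightarrow> bool" where
  "reduced_hohp_principle G l a g \<longleftrightarrow> (\<exists>\<gamma>. pontryagin_curve G a \<gamma> \<and>
     (\<forall>t\<in>{0..a}. fst (\<gamma> t) = g t) \<and> critical (hp_action G l a) (hp_variations G a \<gamma>))"

end

theory Submission
  imports Defs
begin

text \<open>
  All three principles are compared with one condition on \<open>v = g\<^sup>-\<^sup>1 g'\<close>: the first variation of
  \<open>\<integral> l(v, v')\<close> vanishes along \<open>\<eta>' + ad\<^sub>v \<eta>\<close> whenever \<open>\<eta>\<close> and \<open>\<eta>'\<close> vanish at both ends.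
  For a family \<open>\<Gamma>(s,t)\<close> of curves in the group with \<open>\<eta> = g\<^sup>-\<^sup>1 \<partial>\<^sub>s \<Gamma>\<close>, the Maurer--Cartan identity
  says that the left velocity of \<open>\<Gamma>\<close> varies by exactly \<open>\<eta>' + ad\<^sub>v \<eta>\<close>, and
  \<open>\<Gamma>(s,t) = g(t) \<phi>\<^sup>-\<^sup>1(\<phi>(1) + s \<eta>(t))\<close> realises every \<open>\<eta>\<close>. In the Hamilton--Pontryagin principle the
  variations of \<open>\<mu>, \<nu>, u, \<xi>\<close> force \<open>\<xi> = v\<close>, \<open>u = v'\<close>, \<open>\<nu> = \<partial>l/\<partial>u\<close> and \<open>\<mu> = \<partial>l/\<partial>\<xi> - \<nu>'\<close>, after which
  integration by parts turns the first variation of \<open>\<integral> l\<close> into \<open>\<integral> \<langle>\<mu>, \<eta>' + ad\<^sub>v \<eta>\<rangle>\<close>; the condition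
  on \<open>\<eta>'\<close> at the ends is immaterial for this last expression, since it is equivalent to a pointwise
  equation for \<open>\<mu>\<close>.
\<close>

text \<open>Three obstacles shape the development. The model space is only a finite-dimensional
  inner product space, so smooth calculus is rebuilt from directional derivatives; the chain rule
  expands linear maps over a finite reconstructing set. Curves and families live on [0,a] and on
  strips, which are not open; derivatives there are read off a smooth extension to an open set and
  identified with the intrinsic ones by uniqueness of one-sided derivatives. Finally,
  \<open>L\<close> takes equivalence classes of curves and the boundary conditions are phrased in
  arbitrary charts, whereas the reduced principles speak only of the Lie algebra. The bridge is the
  pair \<open>chart_log\<close>, \<open>chart_exp\<close>: in a chart they exchange coordinate
  velocity and left velocity, and their derivatives do the same one order higher. This makes a 2-jet
  equivalent to a base point, a left velocity and its time derivative, turns fixed end values and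
  end velocities into \<open>\<eta> = 0\<close> and \<open>\<eta>' = 0\<close>, and gives smoothness
  of the reduced Lagrangian.\<close>

abbreviation fderiv ::
    "('a::real_normed_vector \<Rightarrow> 'b::real_normed_vector) \<Rightarrow> 'a \<Rightarrow> 'a \<Rightarrow> 'b" where
  "fderiv f x \<equiv> frechet_derivative f (at x)"

section \<open>Calculus of \<open>ck_on\<close> on open sets\<close>

lemma ck_on_subset: "ck_on k D f \<Longrightarrow> E \<subseteq> D \<Longrightarrow> ck_on k E f"
proof (induction k arbitrary: f)
  case 0
  then show ?case by (auto intro: continuous_on_subset)
qed auto

lemma frechet_derivative_cong_open:
  assumes "open D" "x \<in> D" "\<And>y. y \<in> D \<Longrightarrow> f y = g y"
  shows "fderiv f x = fderiv g x"
proof -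
  have "(f has_derivative f') (at x) = (g has_derivative f') (at x)" for f'
    using assms by (metis has_derivative_transform_within_open)
  then show ?thesis
    by (simp add: frechet_derivative_def)
qed

lemma differentiable_cong_open:
  assumes "open D" "x \<in> D" "\<And>y. y \<in> D \<Longrightarrow> f y = g y" "f differentiable (at x)"
  shows "g differentiable (at x)"
  using assms unfolding differentiable_def by (metis has_derivative_transform_within_open)

lemma ck_on_cong:
  assumes "open D" "\<And>x. x \<in> D \<Longrightarrow> f x = g x" "ck_on k D f"
  shows "ck_on k D g"
  using assms(2,3)
proof (induction k arbitrary: f g)
  case 0
  then show ?case by (simp cong: continuous_on_cong)
next
  case (Suc k)
  have "ck_on k D (\<lambda>x. fderiv g x v)" for v
    by (rule Suc.IH[of "\<lambda>x. fderiv f x v"])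
      (use Suc.prems assms(1) in \<open>auto simp: frechet_derivative_cong_open[of D _ f g]\<close>)
  then show ?case
    using Suc.prems assms(1) by (auto intro: differentiable_cong_open[of D _ f g])
qed

lemma ck_on_Suc_mono: "ck_on (Suc k) D f \<Longrightarrow> ck_on k D f"
proof (induction k arbitrary: f)
  case 0
  then show ?case
    by (auto intro!: continuous_at_imp_continuous_on differentiable_imp_continuous_within)
next
  case (Suc k)
  have "ck_on k D (\<lambda>x. fderiv f x v)" for v
    using Suc.prems by (intro Suc.IH) simp
  with Suc.prems show ?case by simp
qed

lemma ck_on_locally:
  assumes "\<And>x. x \<in> D \<Longrightarrow> \<exists>N. open N \<and> x \<in> N \<and> ck_on k N f"
  shows "ck_on k D f"
  using assms
proof (induction k arbitrary: f)
  case 0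
  then show ?case
    by (force intro!: continuous_at_imp_continuous_on simp: continuous_on_eq_continuous_at)
next
  case (Suc k)
  have "ck_on k D (\<lambda>x. fderiv f x v)" for v
    by (rule Suc.IH) (use Suc.prems in force)
  with Suc.prems show ?case by force
qed

lemma ck_on_const: "ck_on k D (\<lambda>x. c)"
proof (induction k arbitrary: c)
  case (Suc k)
  have "fderiv (\<lambda>x. c) x = (\<lambda>v. 0)" for x :: 'a
    by (rule frechet_derivative_at[symmetric]) simp
  with Suc show ?case by simp
qed simp

lemma ck_on_linear: assumes "bounded_linear f" shows "ck_on k D f"
proof (cases k)
  case 0
  then show ?thesis by (simp add: assms linear_continuous_on)
next
  case (Suc k)
  have "fderiv f x = f" for x
    by (rule frechet_derivative_at[symmetric]) (simp add: assms bounded_linear_imp_has_derivative)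
  with Suc show ?thesis
    using assms by (auto simp: ck_on_const bounded_linear_imp_differentiable)
qed

lemma ck_on_add:
  assumes "open D" "ck_on k D f" "ck_on k D g"
  shows "ck_on k D (\<lambda>x. f x + g x)"
  using assms(2,3)
proof (induction k arbitrary: f g)
  case (Suc k)
  have *: "((\<lambda>x. f x + g x) has_derivative
      (\<lambda>v. fderiv f x v + fderiv g x v)) (at x)"
    if "x \<in> D" for x
    using that Suc.prems
    by (intro has_derivative_add) (simp_all add: frechet_derivative_works[symmetric])
  have "ck_on k D (\<lambda>x. fderiv (\<lambda>x. f x + g x) x v)" for v
    by (rule ck_on_cong[OF assms(1), of "\<lambda>x. fderiv f x v + fderiv g x v"])
      (use Suc.prems Suc.IH in \<open>auto dest!: * simp: frechet_derivative_at[symmetric]\<close>)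
  with * show ?case by (auto simp: differentiable_def)
qed (auto intro: continuous_intros)

lemma ck_on_linear_compose:
  assumes "bounded_linear h" "open D" "ck_on k D f"
  shows "ck_on k D (\<lambda>x. h (f x))"
  using assms(3)
proof (induction k arbitrary: f)
  case 0
  then show ?case by (simp add: assms(1) bounded_linear.continuous_on)
next
  case (Suc k)
  have *: "((\<lambda>x. h (f x)) has_derivative (\<lambda>v. h (fderiv f x v))) (at x)" if "x \<in> D" for x
    using that Suc.prems
    by (intro bounded_linear.has_derivative[OF assms(1)]) (simp add: frechet_derivative_works[symmetric])
  have "ck_on k D (\<lambda>x. fderiv (\<lambda>x. h (f x)) x v)" for v
    by (rule ck_on_cong[OF assms(2) _ Suc.IH[of "\<lambda>x. fderiv f x v"]])
      (use Suc.prems in \<open>auto dest!: * simp: frechet_derivative_at[symmetric]\<close>)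
  with * show ?case by (auto simp: differentiable_def)
qed

lemma ck_on_sum:
  assumes "open D" "\<And>i. i \<in> I \<Longrightarrow> ck_on k D (f i)"
  shows "ck_on k D (\<lambda>x. \<Sum>i\<in>I. f i x)"
  using assms(2)
proof (induction I rule: infinite_finite_induct)
  case (insert i I)
  then show ?case by (simp add: ck_on_add assms(1))
qed (auto simp: ck_on_const)

lemma ck_on_bilinear:
  assumes "bounded_bilinear h" "open D" "ck_on k D f" "ck_on k D g"
  shows "ck_on k D (\<lambda>x. h (f x) (g x))"
  using assms(3,4)
proof (induction k arbitrary: f g)
  case 0
  then show ?case by (simp add: assms(1) bounded_bilinear.continuous_on)
next
  case (Suc k)
  have *: "((\<lambda>x. h (f x) (g x)) has_derivative
      (\<lambda>v. h (f x) (fderiv g x v) + h (fderiv f x v) (g x))) (at x)"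
    if "x \<in> D" for x
    using that Suc.prems
    by (intro bounded_bilinear.FDERIV[OF assms(1)]) (simp_all add: frechet_derivative_works[symmetric])
  \<comment> \<open>The Leibniz rule leaves one factor undifferentiated in each term, so that factor
    enters with its regularity lowered from \<open>Suc k\<close> to \<open>k\<close>.\<close>
  have **: "ck_on k D f" "ck_on k D g"
    using Suc.prems ck_on_Suc_mono by blast+
  have "ck_on k D (\<lambda>x. fderiv (\<lambda>x. h (f x) (g x)) x v)" for v
    by (rule ck_on_cong[OF assms(2), of "\<lambda>x. h (f x) (fderiv g x v) +
          h (fderiv f x v) (g x)"])
      (use Suc.prems Suc.IH ** in \<open>auto intro!: ck_on_add assms(2) dest!: * simp: frechet_derivative_at[symmetric]\<close>)
  with * show ?case by (auto simp: differentiable_def)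
qed

lemma ck_on_Pair:
  assumes "open D" "ck_on k D f" "ck_on k D g"
  shows "ck_on k D (\<lambda>x. (f x, g x))"
  using assms(2,3)
proof (induction k arbitrary: f g)
  case 0
  then show ?case by (simp add: continuous_on_Pair)
next
  case (Suc k)
  have *: "((\<lambda>x. (f x, g x)) has_derivative
      (\<lambda>v. (fderiv f x v, fderiv g x v))) (at x)"
    if "x \<in> D" for x
    using that Suc.prems
    by (intro has_derivative_Pair) (simp_all add: frechet_derivative_works[symmetric])
  have "ck_on k D (\<lambda>x. fderiv (\<lambda>x. (f x, g x)) x v)" for v
    by (rule ck_on_cong[OF assms(1), of "\<lambda>x. (fderiv f x v, fderiv g x v)"])
      (use Suc.prems Suc.IH in \<open>auto dest!: * simp: frechet_derivative_at[symmetric]\<close>)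
  with * show ?case by (auto simp: differentiable_def)
qed

text \<open>Finite dimension in the form in which it is used: a finite set that reconstructs every
  vector from its inner products with the set. This already lets a linear map be written as a finite
  sum with explicit coefficients, and it passes to products.\<close>

definition finite_dim :: "'a::real_inner itself \<Rightarrow> bool" where
  "finite_dim T \<longleftrightarrow> (\<exists>B::'a set. finite B \<and> (\<forall>x. x = (\<Sum>b\<in>B. (x \<bullet> b) *\<^sub>R b)))"

text \<open>\<open>ck_on\<close> controls derivatives in fixed directions only, whereas the chain
  rule differentiates \<open>f\<close> in the moving direction \<open>fderiv g x v\<close>.
  Expanding that direction over \<open>B\<close> leaves derivatives of \<open>f\<close> in the fixed
  directions \<open>b\<close>, to which the induction hypothesis applies, with scalar coefficients
  as smooth as the derivative of \<open>g\<close>.\<close>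

lemma ck_on_compose:
  fixes f :: "'b::real_inner \<Rightarrow> 'c::real_normed_vector" and g :: "'a::real_normed_vector \<Rightarrow> 'b"
  assumes fin: "finite_dim TYPE('b)" and "open D" "open E" "g ` D \<subseteq> E"
    and "ck_on k E f" "ck_on k D g"
  shows "ck_on k D (\<lambda>x. f (g x))"
  using assms(5,6)
proof (induction k arbitrary: f)
  case 0
  then show ?case using assms(4) by (auto intro: continuous_on_compose2)
next
  case (Suc k)
  from fin obtain B :: "'b set" where B: "finite B" "\<And>x. x = (\<Sum>b\<in>B. (x \<bullet> b) *\<^sub>R b)"
    unfolding finite_dim_def by blast
  let ?h = "\<lambda>x v. \<Sum>b\<in>B. (fderiv g x v \<bullet> b) *\<^sub>R fderiv f (g x) b"
  have *: "((\<lambda>x. f (g x)) has_derivative ?h x) (at x)" if "x \<in> D" for x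
  proof -
    have f: "(f has_derivative fderiv f (g x)) (at (g x))"
      and g: "(g has_derivative fderiv g x) (at x)"
      using that assms(4) Suc.prems by (auto intro!: frechet_derivative_works[THEN iffD1])
    interpret linear "fderiv f (g x)"
      using f has_derivative_linear by blast
    have "((\<lambda>x. f (g x)) has_derivative (\<lambda>v. fderiv f (g x) (fderiv g x v))) (at x)"
      using has_derivative_compose[OF g f] .
    also have "(\<lambda>v. fderiv f (g x) (fderiv g x v)) = ?h x"
      by (rule ext, subst (1) B(2)) (simp add: sum scale)
    finally show ?thesis .
  qed
  have g: "ck_on k D g" using Suc.prems ck_on_Suc_mono by blast
  have f: "ck_on k D (\<lambda>x. fderiv f (g x) b)" for b
    using Suc g by auto
  have "ck_on k D (\<lambda>x. fderiv (\<lambda>x. f (g x)) x v)" for v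
  proof (rule ck_on_cong[OF assms(2)])
    show "?h x v = fderiv (\<lambda>x. f (g x)) x v" if "x \<in> D" for x
      using *[OF that] by (simp add: frechet_derivative_at[symmetric])
    show "ck_on k D (\<lambda>x. ?h x v)"
      using Suc.prems(2)
      by (intro ck_on_sum assms(2) ck_on_bilinear[OF bounded_bilinear_scaleR] f
          ck_on_linear_compose[OF bounded_linear_inner_left]) auto
  qed
  with * show ?case by (auto simp: differentiable_def)
qed

subsection \<open>Smooth maps between normed spaces\<close>

lemma smooth_on_subset: "smooth_on D f \<Longrightarrow> E \<subseteq> D \<Longrightarrow> smooth_on E f"
  by (auto simp: smooth_on_def intro: ck_on_subset)

lemma smooth_on_cong: "open D \<Longrightarrow> smooth_on D f \<Longrightarrow> (\<And>x. x \<in> D \<Longrightarrow> f x = g x) \<Longrightarrow> smooth_on D g"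
  unfolding smooth_on_def by (blast intro: ck_on_cong)

lemma smooth_on_locally:
  "(\<And>x. x \<in> D \<Longrightarrow> \<exists>N. open N \<and> x \<in> N \<and> smooth_on N f) \<Longrightarrow> smooth_on D f"
  unfolding smooth_on_def by (meson ck_on_locally)

lemma smooth_on_deriv: "smooth_on D f \<Longrightarrow> smooth_on D (\<lambda>x. fderiv f x v)"
  unfolding smooth_on_def using ck_on.simps(2) by blast

lemma smooth_on_has_derivative:
  "smooth_on D f \<Longrightarrow> x \<in> D \<Longrightarrow> (f has_derivative fderiv f x) (at x)"
  unfolding smooth_on_def using ck_on.simps(2) by (blast intro: frechet_derivative_works[THEN iffD1])

lemma smooth_on_continuous: "smooth_on D f \<Longrightarrow> continuous_on D f"
  unfolding smooth_on_def using ck_on.simps(1) by blast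

lemma smooth_on_linear_deriv: "smooth_on D f \<Longrightarrow> x \<in> D \<Longrightarrow> linear (fderiv f x)"
  by (meson has_derivative_linear smooth_on_has_derivative)

named_theorems smooth_intros

lemma smooth_on_const [smooth_intros]: "smooth_on D (\<lambda>x. c)"
  and smooth_on_linear: "bounded_linear f \<Longrightarrow> smooth_on D f"
  and smooth_on_linear_compose: "bounded_linear h \<Longrightarrow> open D \<Longrightarrow> smooth_on D f' \<Longrightarrow> smooth_on D (\<lambda>x. h (f' x))"
  and smooth_on_bilinear:
    "bounded_bilinear p \<Longrightarrow> open D \<Longrightarrow> smooth_on D f1 \<Longrightarrow> smooth_on D f2 \<Longrightarrow> smooth_on D (\<lambda>x. p (f1 x) (f2 x))"
  and smooth_on_add [smooth_intros]:
    "open D \<Longrightarrow> smooth_on D g1 \<Longrightarrow> smooth_on D g2 \<Longrightarrow> smooth_on D (\<lambda>x. g1 x + g2 x)"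
  and smooth_on_Pair [smooth_intros]:
    "open D \<Longrightarrow> smooth_on D h1 \<Longrightarrow> smooth_on D h2 \<Longrightarrow> smooth_on D (\<lambda>x. (h1 x, h2 x))"
  and smooth_on_sum [smooth_intros]:
    "open D \<Longrightarrow> (\<And>i. i \<in> I \<Longrightarrow> smooth_on D (F i)) \<Longrightarrow> smooth_on D (\<lambda>x. \<Sum>i\<in>I. F i x)"
  unfolding smooth_on_def
  by (auto intro: ck_on_const ck_on_linear ck_on_linear_compose ck_on_bilinear ck_on_add ck_on_Pair ck_on_sum)

lemma smooth_on_compose:
  fixes f :: "'b::real_inner \<Rightarrow> 'c::real_normed_vector"
  assumes "finite_dim TYPE('b)" "open D" "open E" "\<And>x. x \<in> D \<Longrightarrow> g x \<in> E" "smooth_on E f" "smooth_on D g"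
  shows "smooth_on D (\<lambda>x. f (g x))"
  using assms unfolding smooth_on_def by (blast intro: ck_on_compose[of D E g])

lemmas smooth_on_ident [smooth_intros] = smooth_on_linear[OF bounded_linear_ident]
lemmas smooth_on_fst [smooth_intros] = smooth_on_linear_compose[OF bounded_linear_fst]
lemmas smooth_on_snd [smooth_intros] = smooth_on_linear_compose[OF bounded_linear_snd]
lemmas smooth_on_scaleR [smooth_intros] = smooth_on_bilinear[OF bounded_bilinear_scaleR]
lemmas smooth_on_mult [smooth_intros] = smooth_on_bilinear[OF bounded_bilinear_mult]
lemmas smooth_on_inner [smooth_intros] = smooth_on_bilinear[OF bounded_bilinear_inner]
lemma smooth_on_power [smooth_intros]:
  fixes f :: "'a::real_normed_vector \<Rightarrow> real"
  shows "open D \<Longrightarrow> smooth_on D f \<Longrightarrow> smooth_on D (\<lambda>x. f x ^ n)"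
  by (induction n) (auto intro: smooth_intros)

section \<open>Finite-dimensional inner product spaces\<close>

lemma finite_dim_euclidean: "finite_dim TYPE('a::euclidean_space)"
  unfolding finite_dim_def by (intro exI[of _ Basis]) (simp add: euclidean_representation)

text \<open>The zero vector is discarded so that the embedded copies of two such sets in a product
  are disjoint, as \<open>finite_dim_prod\<close> requires for splitting its sum.\<close>

lemma finite_dimE:
  assumes "finite_dim TYPE('a::real_inner)"
  obtains B :: "'a::real_inner set" where "finite B" "0 \<notin> B" "\<And>x. (\<Sum>b\<in>B. (x \<bullet> b) *\<^sub>R b) = x"
proof -
  obtain B :: "'a set" where B: "finite B" "\<forall>x. x = (\<Sum>b\<in>B. (x \<bullet> b) *\<^sub>R b)"
    using assms unfolding finite_dim_def by blast
  show thesis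
  proof (rule that[of "B - {0}"])
    show "(\<Sum>b\<in>B - {0}. (x \<bullet> b) *\<^sub>R b) = x" for x
      using B by (subst (2) B(2)[rule_format, of x]) (intro sum.mono_neutral_left, auto)
  qed (use B in auto)
qed

lemma finite_dim_prod:
  assumes "finite_dim TYPE('a::real_inner)" "finite_dim TYPE('b::real_inner)"
  shows "finite_dim TYPE('a \<times> 'b)"
proof -
  obtain A :: "'a set" where A: "finite A" "0 \<notin> A" "\<And>x. (\<Sum>b\<in>A. (x \<bullet> b) *\<^sub>R b) = x"
    using finite_dimE[OF assms(1)] by blast
  obtain B :: "'b set" where B: "finite B" "0 \<notin> B" "\<And>x. (\<Sum>b\<in>B. (x \<bullet> b) *\<^sub>R b) = x"
    using finite_dimE[OF assms(2)] by blast
  let ?C = "(\<lambda>a. (a, 0)) ` A \<union> (\<lambda>b. (0, b)) ` B"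
  have "p = (\<Sum>c\<in>?C. (p \<bullet> c) *\<^sub>R c)" for p
  proof -
    have "(\<Sum>c\<in>?C. (p \<bullet> c) *\<^sub>R c) = (\<Sum>a\<in>A. (p \<bullet> (a, 0)) *\<^sub>R (a, 0::'b)) + (\<Sum>b\<in>B. (p \<bullet> (0, b)) *\<^sub>R (0::'a, b))"
      using A B by (subst sum.union_disjoint) (auto simp: sum.reindex inj_on_def)
    also have "\<dots> = (\<Sum>a\<in>A. (fst p \<bullet> a) *\<^sub>R a, \<Sum>b\<in>B. (snd p \<bullet> b) *\<^sub>R b)"
      by (simp add: prod_eq_iff fst_sum snd_sum inner_prod_def)
    finally show ?thesis using A B by simp
  qed
  then show ?thesis
    unfolding finite_dim_def using A B by (intro exI[of _ ?C]) blast
qed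

lemma finite_dim_real: "finite_dim TYPE(real)" by (rule finite_dim_euclidean)

lemmas finite_dim_intros = finite_dim_prod finite_dim_real

text \<open>Gram--Schmidt, outside the class \<open>euclidean_space\<close>.\<close>

lemma orthonormal_spanning_set:
  fixes S :: "'a::real_inner set"
  assumes "finite S"
  shows "\<exists>B. finite B \<and> S \<subseteq> span B \<and> (\<forall>b\<in>B. \<forall>c\<in>B. b \<bullet> c = (if b = c then 1 else 0))"
  using assms
proof induction
  case empty
  show ?case by (rule exI[of _ "{}"]) simp
next
  case (insert x S)
  then obtain B where B: "finite B" "S \<subseteq> span B"
    and orth: "\<And>b c. b \<in> B \<Longrightarrow> c \<in> B \<Longrightarrow> b \<bullet> c = (if b = c then 1 else 0)" by blast
  define y where "y = x - (\<Sum>b\<in>B. (x \<bullet> b) *\<^sub>R b)"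
  have s: "(\<Sum>b\<in>B. (x \<bullet> b) *\<^sub>R b) \<in> span B"
    by (intro span_sum span_scale span_base)
  have y: "y \<bullet> c = 0" if "c \<in> B" for c
  proof -
    have "(\<Sum>b\<in>B. (x \<bullet> b) *\<^sub>R b) \<bullet> c = (\<Sum>b\<in>B. if b = c then x \<bullet> b else 0)"
      unfolding inner_sum_left by (intro sum.cong refl) (use orth that in auto)
    then show ?thesis using B that by (simp add: y_def inner_diff_left)
  qed
  show ?case
  proof (cases "y = 0")
    case True
    with s have "x \<in> span B" by (simp add: y_def)
    with B orth show ?thesis by (intro exI[of _ B]) auto
  next
    case False
    let ?b = "y /\<^sub>R norm y"
    have "x = norm y *\<^sub>R ?b + (\<Sum>b\<in>B. (x \<bullet> b) *\<^sub>R b)"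
      using False by (simp add: y_def)
    moreover have "norm y *\<^sub>R ?b + (\<Sum>b\<in>B. (x \<bullet> b) *\<^sub>R b) \<in> span (insert ?b B)"
      using span_add[OF span_scale[OF span_base[of ?b]] subsetD[OF span_mono s]] by blast
    moreover have "S \<subseteq> span (insert ?b B)" using B span_mono[of B "insert ?b B"] by auto
    moreover have "?b \<bullet> ?b = 1"
      using False by (simp add: dot_square_norm power2_eq_square field_simps)
    moreover have "?b \<bullet> c = 0" "c \<bullet> ?b = 0" if "c \<in> B" for c
      using y[OF that] by (simp_all add: inner_commute)
    moreover have "?b \<notin> B" using calculation(4,5) by force
    ultimately show ?thesis
      using B orth by (intro exI[of _ "insert ?b B"]) auto
  qed
qed

text \<open>In an orthonormal set the coefficients of any linear combination are its inner products
  with the set, so every expansion is the reconstruction formula.\<close>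

lemma finite_dim_span:
  fixes S :: "'a::real_inner set"
  assumes "finite S" "span S = UNIV"
  shows "finite_dim TYPE('a)"
proof -
  obtain B where B: "finite B" "S \<subseteq> span B"
    and orth: "\<And>b c. b \<in> B \<Longrightarrow> c \<in> B \<Longrightarrow> b \<bullet> c = (if b = c then 1 else 0)"
    using orthonormal_spanning_set[OF assms(1)] by blast
  have "x = (\<Sum>b\<in>B. (x \<bullet> b) *\<^sub>R b)" for x
  proof -
    have "span S \<subseteq> span B" using B by (simp add: span_minimal)
    then have "x \<in> span B" using assms(2) by auto
    then obtain u where u: "x = (\<Sum>b\<in>B. u b *\<^sub>R b)"
      using B by (auto simp: span_finite)
    have "x \<bullet> c = u c" if "c \<in> B" for c
    proof -
      have "x \<bullet> c = (\<Sum>b\<in>B. if b = c then u b else 0)"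
        unfolding u inner_sum_left by (intro sum.cong refl) (use orth that in auto)
      then show ?thesis using B that by simp
    qed
    then show ?thesis using u by simp
  qed
  then show ?thesis unfolding finite_dim_def using B by blast
qed

text \<open>Smoothness is wanted jointly in the base point and the direction, while
  \<open>smooth_on_deriv\<close> fixes the direction. By linearity the map is a finite sum of
  directional derivatives weighted by coordinates of the direction.\<close>

lemma smooth_on_tangent_map:
  fixes f :: "'a::real_inner \<Rightarrow> 'b::real_normed_vector"
  assumes "finite_dim TYPE('a)" "open D" "smooth_on D f"
  shows "smooth_on (D \<times> UNIV) (\<lambda>p. fderiv f (fst p) (snd p))"
proof -
  obtain B :: "'a set" where B: "\<And>x. (\<Sum>b\<in>B. (x \<bullet> b) *\<^sub>R b) = x"
    using finite_dimE[OF assms(1)] by blast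
  have o: "open (D \<times> (UNIV::'a set))" by (simp add: assms(2) open_Times)
  have "smooth_on (D \<times> UNIV) (\<lambda>p. \<Sum>b\<in>B. (snd p \<bullet> b) *\<^sub>R fderiv f (fst p) b)"
    using o by (intro smooth_intros smooth_on_compose[OF assms(1) _ assms(2) _ smooth_on_deriv[OF assms(3)]]) auto
  then show ?thesis
  proof (rule smooth_on_cong[OF o])
    fix p :: "'a \<times> 'a" assume "p \<in> D \<times> UNIV"
    then interpret linear "fderiv f (fst p)"
      using smooth_on_linear_deriv[OF assms(3)] by auto
    show "(\<Sum>b\<in>B. (snd p \<bullet> b) *\<^sub>R fderiv f (fst p) b) = fderiv f (fst p) (snd p)"
      by (subst (2) B[symmetric]) (simp add: sum scale)
  qed
qed

section \<open>Chain rule along curves and symmetry of second derivatives\<close>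

lemma smooth_on_chain_vector:
  assumes "smooth_on D f" "c t \<in> D" "(c has_vector_derivative c') (at t within S)"
  shows "((\<lambda>t. f (c t)) has_vector_derivative fderiv f (c t) c') (at t within S)"
proof -
  interpret linear "fderiv f (c t)"
    using smooth_on_linear_deriv[OF assms(1,2)] .
  have "((\<lambda>t. f (c t)) has_derivative (\<lambda>h. fderiv f (c t) (h *\<^sub>R c'))) (at t within S)"
    using has_derivative_compose[OF assms(3)[unfolded has_vector_derivative_def] smooth_on_has_derivative[OF assms(1,2)]] .
  then show ?thesis by (simp add: has_vector_derivative_def scale)
qed

text \<open>On the plane through \<open>x\<close> spanned by \<open>w\<close> (parameter
  \<open>s\<close>) and \<open>v\<close> (parameter \<open>t\<close>), the increment of
  \<open>f\<close> in \<open>t\<close> is the integral of its \<open>v\<close>-derivative.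
  Differentiating in \<open>s\<close> under the integral sign and then in the upper limit produces
  the two orders of differentiation.\<close>

lemma mixed_partials_real:
  fixes f :: "'a::real_normed_vector \<Rightarrow> real"
  assumes "open D" "smooth_on D f" "x \<in> D"
  shows "fderiv (\<lambda>y. fderiv f y v) x w =
         fderiv (\<lambda>y. fderiv f y w) x v"
proof -
  let ?p = "\<lambda>s t. x + s *\<^sub>R w + t *\<^sub>R v"
  define W where "W = {z :: real \<times> real. ?p (fst z) (snd z) \<in> D}"
  have "open W"
    unfolding W_def using open_vimage[OF assms(1), of "\<lambda>z. ?p (fst z) (snd z)"]
    by (simp add: vimage_def continuous_intros)
  moreover have "(0, 0) \<in> W" using assms(3) by (simp add: W_def)
  ultimately obtain A B where AB: "open A" "open B" "(0, 0) \<in> A \<times> B" "A \<times> B \<subseteq> W"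
    by (rule open_prod_elim)
  obtain d where d: "d > 0" "cball 0 d \<subseteq> A \<inter> B"
    using AB open_contains_cball_eq[of "A \<inter> B"] by auto
  have p: "?p s t \<in> D" if "\<bar>s\<bar> \<le> d" "\<bar>t\<bar> \<le> d" for s t
    using that d AB(4) by (force simp: W_def subset_iff dist_norm)
  have chain_s: "((\<lambda>s. h (?p s t)) has_vector_derivative fderiv h (?p s t) w) (at s within X)"
    if "\<bar>s\<bar> \<le> d" "\<bar>t\<bar> \<le> d" "smooth_on D h" for h :: "'a \<Rightarrow> real" and s t X
    by (rule smooth_on_chain_vector[OF that(3)])
      (use that p in \<open>auto intro!: derivative_eq_intros\<close>)
  have chain_t: "((\<lambda>t. h (?p s t)) has_vector_derivative fderiv h (?p s t) v) (at t within X)"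
    if "\<bar>s\<bar> \<le> d" "\<bar>t\<bar> \<le> d" "smooth_on D h" for h :: "'a \<Rightarrow> real" and s t X
    by (rule smooth_on_chain_vector[OF that(3)])
      (use that p in \<open>auto intro!: derivative_eq_intros\<close>)
  note sm = smooth_on_deriv[OF assms(2)]
  let ?fv = "\<lambda>y. fderiv f y v" and ?fw = "\<lambda>y. fderiv f y w"
  let ?fvw = "\<lambda>y. fderiv ?fv y w"
  have cont: "continuous_on ({-d<..<d} \<times> {-d..t}) (\<lambda>z. ?fvw (?p (fst z) (snd z)))" if "t \<le> d" for t
    using that
    by (intro continuous_on_compose2[OF smooth_on_continuous[OF smooth_on_deriv[OF sm]]] continuous_intros)
      (auto intro!: p)
  have cont_fv: "continuous_on {-d..t} (\<lambda>\<tau>. ?fv (?p s \<tau>))" if "\<bar>s\<bar> \<le> d" "t \<le> d" for s t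
    using that
    by (intro continuous_on_compose2[OF smooth_on_continuous[OF sm]] continuous_intros) (auto intro!: p)
  have int: "((\<lambda>\<tau>. ?fv (?p s \<tau>)) has_integral f (?p s t) - f (?p s (-d))) {-d..t}"
    if "\<bar>s\<bar> \<le> d" "\<bar>t\<bar> \<le> d" for s t
    using that by (intro fundamental_theorem_of_calculus chain_t assms(2)) auto
  \<comment> \<open>The increment \<open>f (?p s t) - f (?p s (-d))\<close> is differentiated at
    \<open>s = 0\<close> in two ways: under the integral sign, and directly.\<close>
  have eq: "integral {-d..t} (\<lambda>\<tau>. ?fvw (?p 0 \<tau>)) = ?fw (?p 0 t) - ?fw (?p 0 (-d))" if t: "\<bar>t\<bar> \<le> d" for t
  proof -
    have "((\<lambda>s. integral (cbox (-d) t) (\<lambda>\<tau>. ?fv (?p s \<tau>))) has_vector_derivative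
        integral (cbox (-d) t) (\<lambda>\<tau>. ?fvw (?p 0 \<tau>))) (at 0 within {-d<..<d})"
    proof (rule leibniz_rule_vector_derivative[where f = "\<lambda>s \<tau>. ?fv (?p s \<tau>)" and fx = "\<lambda>s \<tau>. ?fvw (?p s \<tau>)"])
      show "((\<lambda>s. ?fv (?p s \<tau>)) has_vector_derivative ?fvw (?p s \<tau>)) (at s within {-d<..<d})"
        if "s \<in> {-d<..<d}" "\<tau> \<in> cbox (-d) t" for s \<tau>
        using that t by (intro chain_s sm) auto
      show "(\<lambda>\<tau>. ?fv (?p s \<tau>)) integrable_on cbox (-d) t" if "s \<in> {-d<..<d}" for s
        using that t cont_fv[of s t] by (intro integrable_continuous) auto
      show "continuous_on ({-d<..<d} \<times> cbox (-d) t) (\<lambda>(s, \<tau>). ?fvw (?p s \<tau>))"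
        using cont[of t] t by (simp add: case_prod_beta)
    qed (use d in auto)
    then have "((\<lambda>s. integral {-d..t} (\<lambda>\<tau>. ?fv (?p s \<tau>))) has_vector_derivative
        integral {-d..t} (\<lambda>\<tau>. ?fvw (?p 0 \<tau>))) (at 0)"
      using d by (simp add: at_within_open[of 0 "{-d<..<d}"])
    then have "((\<lambda>s. f (?p s t) - f (?p s (-d))) has_vector_derivative
        integral {-d..t} (\<lambda>\<tau>. ?fvw (?p 0 \<tau>))) (at 0)"
      by (rule has_vector_derivative_transform_within[where d = d])
        (use d t int[of _ t] in \<open>auto simp: dist_real_def intro!: integral_unique\<close>)
    moreover have "((\<lambda>s. f (?p s t) - f (?p s (-d))) has_vector_derivative ?fw (?p 0 t) - ?fw (?p 0 (-d))) (at 0)"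
      using t d by (intro derivative_intros chain_s assms(2)) auto
    ultimately show ?thesis
      using vector_derivative_unique_at by blast
  qed
  \<comment> \<open>The integration starts at \<open>-d\<close>, so 0 is interior to the interval
    and the one-sided derivative in the upper limit is a full derivative.\<close>
  have "((\<lambda>t. integral {-d..t} (\<lambda>\<tau>. ?fvw (?p 0 \<tau>))) has_vector_derivative ?fvw (?p 0 0)) (at 0 within {-d..d})"
  proof (rule integral_has_vector_derivative)
    show "continuous_on {-d..d} (\<lambda>\<tau>. ?fvw (?p 0 \<tau>))"
      by (intro continuous_on_compose2[OF smooth_on_continuous[OF smooth_on_deriv[OF sm]]] continuous_intros)
        (use p[of 0] d in auto)
  qed (use d in auto)
  then have "((\<lambda>t. ?fw (?p 0 t) - ?fw (?p 0 (-d))) has_vector_derivative ?fvw (?p 0 0)) (at 0 within {-d..d})"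
    by (rule has_vector_derivative_transform[rotated 2]) (use d eq in \<open>auto simp: abs_le_iff\<close>)
  then have "((\<lambda>t. ?fw (?p 0 t) - ?fw (?p 0 (-d))) has_vector_derivative ?fvw (?p 0 0)) (at 0)"
    using d by (simp add: at_within_interior[of 0 "{-d..d}"])
  moreover have "((\<lambda>t. ?fw (?p 0 t) - ?fw (?p 0 (-d))) has_vector_derivative
      fderiv ?fw (?p 0 0) v - 0) (at 0)"
    using d by (intro derivative_intros chain_t sm) auto
  ultimately show ?thesis
    using vector_derivative_unique_at by fastforce
qed

text \<open>A vector is determined by its inner products, so the real case is applied to
  \<open>\<lambda>y. f y \<bullet> c\<close> for every \<open>c\<close>.\<close>

lemma mixed_partials:
  fixes f :: "'a::real_normed_vector \<Rightarrow> 'b::real_inner"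
  assumes "open D" "smooth_on D f" "x \<in> D"
  shows "fderiv (\<lambda>y. fderiv f y v) x w =
         fderiv (\<lambda>y. fderiv f y w) x v"
proof -
  have d: "fderiv (\<lambda>y. h y \<bullet> c) y v = fderiv h y v \<bullet> c"
    if "smooth_on D h" "y \<in> D" for h :: "'a \<Rightarrow> 'b" and y c v
    using bounded_linear.has_derivative[OF bounded_linear_inner_left smooth_on_has_derivative[OF that], of c]
    by (simp add: frechet_derivative_at[symmetric])
  have "fderiv (\<lambda>y. fderiv (\<lambda>y. f y \<bullet> c) y v) x w =
      fderiv (\<lambda>y. fderiv f y v) x w \<bullet> c" for c v w
  proof -
    have "fderiv (\<lambda>y. fderiv (\<lambda>y. f y \<bullet> c) y v) x =
        fderiv (\<lambda>y. fderiv f y v \<bullet> c) x"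
      by (rule frechet_derivative_cong_open[OF assms(1,3)]) (rule d[OF assms(2)])
    then show ?thesis by (simp add: d[OF smooth_on_deriv[OF assms(2)] assms(3)])
  qed
  note this[where v = v and w = w] this[where v = w and w = v]
  moreover have "smooth_on D (\<lambda>y. f y \<bullet> c)" for c
    using assms by (intro smooth_intros)
  ultimately have "fderiv (\<lambda>y. fderiv f y v) x w \<bullet> c =
      fderiv (\<lambda>y. fderiv f y w) x v \<bullet> c" for c
    using mixed_partials_real[OF assms(1) _ assms(3), of "\<lambda>y. f y \<bullet> c" v w] by simp
  then show ?thesis
    using vector_eq_ldot[of "fderiv (\<lambda>y. fderiv f y v) x w"]
    by (metis inner_commute)
qed

subsection \<open>Smooth maps into a manifold\<close>

lemma smooth_intoD:
  assumes "smooth_into A D f"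
  shows "open D" "x \<in> D \<Longrightarrow> \<exists>(U, \<phi>)\<in>A. f x \<in> U"
    "(U, \<phi>) \<in> A \<Longrightarrow> open {x\<in>D. f x \<in> U}" "(U, \<phi>) \<in> A \<Longrightarrow> smooth_on {x\<in>D. f x \<in> U} (\<lambda>x. \<phi> (f x))"
  using assms by (fastforce simp: smooth_into_def comp_def)+

lemma smooth_intoI:
  assumes "open D" "\<And>x. x \<in> D \<Longrightarrow> \<exists>(U, \<phi>)\<in>A. f x \<in> U"
    "\<And>U \<phi>. (U, \<phi>) \<in> A \<Longrightarrow> open {x\<in>D. f x \<in> U}"
    "\<And>U \<phi>. (U, \<phi>) \<in> A \<Longrightarrow> smooth_on {x\<in>D. f x \<in> U} (\<lambda>x. \<phi> (f x))"
  shows "smooth_into A D f"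
  using assms by (force simp: smooth_into_def comp_def image_subset_iff)

lemma smooth_into_compose:
  fixes f :: "'q::real_inner \<Rightarrow> 'm" and c :: "'p::real_normed_vector \<Rightarrow> 'q"
  assumes "finite_dim TYPE('q)" "smooth_into A E f" "open D" "smooth_on D c" "\<And>x. x \<in> D \<Longrightarrow> c x \<in> E"
  shows "smooth_into A D (\<lambda>x. f (c x))"
proof (rule smooth_intoI[OF assms(3)])
  show "\<exists>(U, \<phi>)\<in>A. f (c x) \<in> U" if "x \<in> D" for x
    using smooth_intoD(2)[OF assms(2) assms(5)[OF that]] .
  fix U \<phi> assume c: "(U, \<phi>) \<in> A"
  have "open (D \<inter> c -` {y\<in>E. f y \<in> U})"
    using continuous_open_preimage[OF smooth_on_continuous[OF assms(4)] assms(3) smooth_intoD(3)[OF assms(2) c]] .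
  also have "D \<inter> c -` {y\<in>E. f y \<in> U} = {x\<in>D. f (c x) \<in> U}"
    using assms(5) by auto
  finally show o: "open {x\<in>D. f (c x) \<in> U}" .
  show "smooth_on {x\<in>D. f (c x) \<in> U} (\<lambda>x. \<phi> (f (c x)))"
    by (rule smooth_on_compose[OF assms(1) o smooth_intoD(3)[OF assms(2) c] _ smooth_intoD(4)[OF assms(2) c]])
      (use assms in \<open>auto intro: smooth_on_subset\<close>)
qed

lemma smooth_into_locally:
  assumes "\<And>x. x \<in> D \<Longrightarrow> \<exists>N. x \<in> N \<and> N \<subseteq> D \<and> smooth_into A N f"
  shows "smooth_into A D f"
proof -
  from assms obtain N where N: "\<And>x. x \<in> D \<Longrightarrow> x \<in> N x \<and> N x \<subseteq> D \<and> smooth_into A (N x) f"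
    by metis
  show ?thesis
  proof (rule smooth_intoI)
    have "D = \<Union> (N ` D)" using N by blast
    then show "open D" using N by (metis (no_types, lifting) imageE open_Union smooth_intoD(1))
    show "\<exists>(U, \<phi>)\<in>A. f x \<in> U" if "x \<in> D" for x
      using smooth_intoD(2) N that by blast
    fix U \<phi> assume c: "(U, \<phi>) \<in> A"
    have "{x\<in>D. f x \<in> U} = (\<Union>x\<in>D. {y\<in>N x. f y \<in> U})" using N by blast
    moreover have "open (\<Union>x\<in>D. {y\<in>N x. f y \<in> U})"
    proof (rule open_UN, rule ballI)
      show "open {y\<in>N x. f y \<in> U}" if "x \<in> D" for x
        using smooth_intoD(3)[of A "N x" f U \<phi>] N[OF that] c by blast
    qed
    ultimately show "open {x\<in>D. f x \<in> U}" by simp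
    show "smooth_on {x\<in>D. f x \<in> U} (\<lambda>x. \<phi> (f x))"
    proof (rule smooth_on_locally)
      fix x assume x: "x \<in> {x\<in>D. f x \<in> U}"
      then show "\<exists>N. open N \<and> x \<in> N \<and> smooth_on N (\<lambda>x. \<phi> (f x))"
        using N[of x] smooth_intoD(3,4)[OF _ c] by blast
    qed
  qed
qed

lemma smooth_into_cong:
  assumes "smooth_into A D f" "\<And>x. x \<in> D \<Longrightarrow> f x = g x"
  shows "smooth_into A D g"
proof (rule smooth_intoI)
  show "open D" using assms(1) smooth_intoD(1) by blast
  show "\<exists>(U, \<phi>)\<in>A. g x \<in> U" if "x \<in> D" for x
    using smooth_intoD(2)[OF assms(1) that] assms(2)[OF that] by simp
  fix U \<phi> assume c: "(U, \<phi>) \<in> A"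
  have e: "{x\<in>D. g x \<in> U} = {x\<in>D. f x \<in> U}" using assms(2) by auto
  then show "open {x\<in>D. g x \<in> U}" using smooth_intoD(3)[OF assms(1) c] by simp
  show "smooth_on {x\<in>D. g x \<in> U} (\<lambda>x. \<phi> (g x))"
    unfolding e
    by (rule smooth_on_cong[OF smooth_intoD(3)[OF assms(1) c] smooth_intoD(4)[OF assms(1) c]])
      (use assms(2) in auto)
qed

lemma smooth_into_subset:
  assumes "smooth_into A D f" "open E" "E \<subseteq> D"
  shows "smooth_into A E f"
proof (rule smooth_intoI[OF assms(2)])
  show "\<exists>(U, \<phi>)\<in>A. f x \<in> U" if "x \<in> E" for x
    using smooth_intoD(2)[OF assms(1)] assms(3) that by blast
  fix U \<phi> assume c: "(U, \<phi>) \<in> A"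
  have e: "{x\<in>E. f x \<in> U} = E \<inter> {x\<in>D. f x \<in> U}" using assms(3) by auto
  then show "open {x\<in>E. f x \<in> U}" using smooth_intoD(3)[OF assms(1) c] assms(2) by auto
  show "smooth_on {x\<in>E. f x \<in> U} (\<lambda>x. \<phi> (f x))"
    unfolding e by (rule smooth_on_subset[OF smooth_intoD(4)[OF assms(1) c]]) auto
qed

lemma smooth_into_const:
  assumes "open D" "\<exists>(U, \<phi>)\<in>A. c \<in> U"
  shows "smooth_into A D (\<lambda>x. c)"
proof (rule smooth_intoI[OF assms])
  show "open {x\<in>D. c \<in> U}" for U
    using assms(1) by (cases "c \<in> U") auto
qed (rule smooth_on_const)

context smooth_manifold
begin

lemma finite_dim_model: "finite_dim TYPE('e)"
  using finite_dimensional finite_dim_span by blast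

lemmas fd = finite_dim_model finite_dim_prod[OF finite_dim_model finite_dim_model]
  finite_dim_prod[OF finite_dim_model finite_dim_prod[OF finite_dim_model finite_dim_model]]

lemma chart_subset_topspace: "(U, \<phi>) \<in> A \<Longrightarrow> U \<subseteq> topspace T"
  using openin_domain openin_subset by blast

lemma chart_inj: "(U, \<phi>) \<in> A \<Longrightarrow> inj_on \<phi> U"
  using homeomorphic_chart[of U \<phi>] chart_subset_topspace[of U \<phi>]
  by (auto simp: homeomorphic_map_def inf.absorb2)

lemma chart_inverse:
  "(U, \<phi>) \<in> A \<Longrightarrow> x \<in> U \<Longrightarrow> inv_into U \<phi> (\<phi> x) = x"
  "y \<in> \<phi> ` U \<Longrightarrow> inv_into U \<phi> y \<in> U"
  "y \<in> \<phi> ` U \<Longrightarrow> \<phi> (inv_into U \<phi> y) = y"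
  by (auto simp: chart_inj inv_into_into f_inv_into_f)

text \<open>Continuity comes from the chart being a homeomorphism onto its range, smoothness from
  the transition maps of the atlas.\<close>

lemma smooth_into_inv_chart:
  assumes c: "(U, \<phi>) \<in> A"
  shows "smooth_into A (\<phi> ` U) (inv_into U \<phi>)"
proof (rule smooth_intoI[OF open_range[OF c]])
  show "\<exists>(V, \<psi>)\<in>A. inv_into U \<phi> x \<in> V" if "x \<in> \<phi> ` U" for x
    using chart_inverse(2)[OF that] c by blast
  fix V \<psi> assume c': "(V, \<psi>) \<in> A"
  have e: "{x \<in> \<phi> ` U. inv_into U \<phi> x \<in> V} = \<phi> ` (U \<inter> V)"
    using c by (auto simp: chart_inverse image_iff)
  have "openin (subtopology T U) (U \<inter> V)"
    using openin_domain[OF c'] by (auto simp: openin_subtopology)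
  then have "openin (top_of_set (\<phi> ` U)) (\<phi> ` (U \<inter> V))"
    using homeomorphic_imp_open_map[OF homeomorphic_chart[OF c]] by (simp add: open_map_def)
  then show "open {x \<in> \<phi> ` U. inv_into U \<phi> x \<in> V}"
    unfolding e using open_range[OF c] openin_open_trans by blast
  show "smooth_on {x \<in> \<phi> ` U. inv_into U \<phi> x \<in> V} (\<lambda>x. \<psi> (inv_into U \<phi> x))"
    unfolding e using smooth_transition[OF c c'] by (simp add: comp_def)
qed

end

section \<open>Smooth maps into the Lie group and the chart at the identity\<close>

context lie_group
begin

lemma carrier_charts: "x \<in> carrier G \<longleftrightarrow> (\<exists>(U, \<phi>)\<in>charts G. x \<in> U)"
  using covering carrier_topspace by blast

lemma chart_carrier: "(U, \<phi>) \<in> charts G \<Longrightarrow> x \<in> U \<Longrightarrow> x \<in> carrier G"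
  using carrier_charts by blast

lemma smooth_into_carrier: "smooth_into (charts G) D f \<Longrightarrow> x \<in> D \<Longrightarrow> f x \<in> carrier G"
  using smooth_intoD(2) carrier_charts by metis

lemma smooth_into_mult:
  assumes f: "smooth_into (charts G) D f" and h: "smooth_into (charts G) D h"
  shows "smooth_into (charts G) D (\<lambda>x. f x \<otimes> h x)"
proof (rule smooth_into_locally)
  fix x assume x: "x \<in> D"
  obtain U \<phi> where c: "(U, \<phi>) \<in> charts G" "f x \<in> U" using smooth_intoD(2)[OF f x] by blast
  obtain V \<psi> where d: "(V, \<psi>) \<in> charts G" "h x \<in> V" using smooth_intoD(2)[OF h x] by blast
  let ?N = "{x\<in>D. f x \<in> U} \<inter> {x\<in>D. h x \<in> V}"
  have o: "open ?N" using smooth_intoD(3)[OF f c(1)] smooth_intoD(3)[OF h d(1)] by blast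
  have "smooth_on ?N (\<lambda>x. (\<phi> (f x), \<psi> (h x)))"
    by (rule smooth_on_Pair[OF o smooth_on_subset[OF smooth_intoD(4)[OF f c(1)]]
          smooth_on_subset[OF smooth_intoD(4)[OF h d(1)]]]) auto
  then have "smooth_into (charts G) ?N
     (\<lambda>x. (\<lambda>(x, y). inv_into U \<phi> x \<otimes> inv_into V \<psi> y) (\<phi> (f x), \<psi> (h x)))"
    by (rule smooth_into_compose[OF fd(2) smooth_mult[OF c(1) d(1)] o]) auto
  then have "smooth_into (charts G) ?N (\<lambda>x. f x \<otimes> h x)"
    by (rule smooth_into_cong) (simp add: chart_inverse(1)[OF c(1)] chart_inverse(1)[OF d(1)])
  with x c d show "\<exists>N. x \<in> N \<and> N \<subseteq> D \<and> smooth_into (charts G) N (\<lambda>x. f x \<otimes> h x)"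
    by (intro exI[of _ ?N] conjI subsetI) simp_all
qed

lemma smooth_into_inv:
  assumes f: "smooth_into (charts G) D f"
  shows "smooth_into (charts G) D (\<lambda>x. inv (f x))"
proof (rule smooth_into_locally)
  fix x assume x: "x \<in> D"
  obtain U \<phi> where c: "(U, \<phi>) \<in> charts G" "f x \<in> U" using smooth_intoD(2)[OF f x] by blast
  let ?N = "{x\<in>D. f x \<in> U}"
  have o: "open ?N" using smooth_intoD(3)[OF f c(1)] by blast
  have "smooth_into (charts G) ?N (\<lambda>x. (\<lambda>x. inv (inv_into U \<phi> x)) (\<phi> (f x)))"
    by (rule smooth_into_compose[OF fd(1) smooth_inv[OF c(1)] o smooth_intoD(4)[OF f c(1)]]) auto
  then have "smooth_into (charts G) ?N (\<lambda>x. inv (f x))"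
    by (rule smooth_into_cong) (simp add: chart_inverse(1)[OF c(1)])
  with x c show "\<exists>N. x \<in> N \<and> N \<subseteq> D \<and> smooth_into (charts G) N (\<lambda>x. inv (f x))"
    by (intro exI[of _ ?N] conjI subsetI) simp_all
qed

lemma smooth_into_const_carrier: "open D \<Longrightarrow> c \<in> carrier G \<Longrightarrow> smooth_into (charts G) D (\<lambda>x. c)"
  using smooth_into_const[of D "charts G" c] unfolding carrier_charts by simp

lemmas smooth_into_intros = smooth_into_mult smooth_into_inv smooth_into_const_carrier

lemma id_chart: "(fst (id_chart G), id_coord G) \<in> charts G" "\<one> \<in> fst (id_chart G)"
proof -
  have "\<exists>c. case c of (U, \<phi>) \<Rightarrow> (U, \<phi>) \<in> charts G \<and> \<one> \<in> U"
    using iffD1[OF carrier_charts one_closed] by blast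
  then have "case id_chart G of (U, \<phi>) \<Rightarrow> (U, \<phi>) \<in> charts G \<and> \<one> \<in> U"
    unfolding id_chart_def by (rule someI_ex)
  then show "(fst (id_chart G), id_coord G) \<in> charts G" "\<one> \<in> fst (id_chart G)"
    by (auto simp: id_coord_def split: prod.splits)
qed

abbreviation "U0 \<equiv> fst (id_chart G)"
abbreviation "e0 \<equiv> id_coord G \<one>"
abbreviation "id_range \<equiv> id_coord G ` U0"

lemma id_param_eq: "id_param G = inv_into U0 (id_coord G)"
  by (simp add: id_param_def id_coord_def)

lemma id_param_e0 [simp]: "id_param G e0 = \<one>"
  by (simp add: id_param_eq chart_inverse(1)[OF id_chart(1)] id_chart(2))

lemma e0_range: "e0 \<in> id_range"
  using id_chart(2) by blast

lemma id_param_carrier: "y \<in> id_range \<Longrightarrow> id_param G y \<in> carrier G"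
  using chart_carrier[OF id_chart(1)] chart_inverse(2) id_param_eq by metis

lemma id_coord_param: "y \<in> id_range \<Longrightarrow> id_coord G (id_param G y) = y"
  by (simp add: chart_inverse(3) id_param_eq)

lemma id_param_coord: "x \<in> U0 \<Longrightarrow> id_param G (id_coord G x) = x"
  by (simp add: chart_inverse(1)[OF id_chart(1)] id_param_eq)

lemma smooth_id_param: "smooth_into (charts G) id_range (id_param G)"
  using smooth_into_inv_chart[OF id_chart(1)] by (simp add: id_param_eq)

lemma inv_mult_cancel: "x \<in> carrier G \<Longrightarrow> y \<in> carrier G \<Longrightarrow> x \<otimes> (inv x \<otimes> y) = y"
  "x \<in> carrier G \<Longrightarrow> y \<in> carrier G \<Longrightarrow> inv x \<otimes> (x \<otimes> y) = y"
  by (simp_all add: m_assoc[symmetric])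

end

subsection \<open>Logarithmic derivatives\<close>

lemma frechet_derivative_partial:
  assumes "smooth_on W q" "(x, z) \<in> W"
  shows "((\<lambda>z. q (x, z)) has_derivative (\<lambda>w. fderiv q (x, z) (0, w))) (at z)"
  by (rule has_derivative_compose[where f = "\<lambda>z. (x, z)" and f' = "\<lambda>w. (0, w)"])
    (auto intro!: derivative_eq_intros smooth_on_has_derivative[OF assms])

text \<open>The partial derivative in the second variable, taken along a graph, is the tangent map
  of \<open>q\<close> composed with a smooth map. With the diagonal as graph this yields smoothness
  of \<open>chart_log\<close>, with the constant \<open>e0\<close> that of \<open>chart_exp\<close>
  and \<open>Ad\<close>.\<close>

lemma smooth_on_partial_derivative:
  fixes q :: "'a::real_inner \<times> 'b::real_inner \<Rightarrow> 'c::real_normed_vector"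
  assumes fin: "finite_dim TYPE('a)" "finite_dim TYPE('b)"
    and "open W" "smooth_on W q" "open D" "smooth_on D c" "\<And>x. x \<in> D \<Longrightarrow> (x, c x) \<in> W"
  shows "smooth_on (D \<times> UNIV) (\<lambda>p. fderiv (\<lambda>z. q (fst p, z)) (c (fst p)) (snd p))"
proof -
  have o: "open (D \<times> (UNIV :: 'b set))" "open (W \<times> (UNIV :: ('a \<times> 'b) set))"
    using assms by (auto simp: open_Times)
  have "smooth_on (D \<times> (UNIV :: 'b set))
      (\<lambda>p. (\<lambda>r. fderiv q (fst r) (snd r)) ((fst p, c (fst p)), (0, snd p)))"
    by (rule smooth_on_compose[OF _ o _ smooth_on_tangent_map])
      (use assms in \<open>auto intro!: finite_dim_intros smooth_intros smooth_on_compose[OF fin(1) _ assms(5) _ assms(6)] o(1)\<close>)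
  then show ?thesis
    by (rule smooth_on_cong[OF o(1)])
      (use assms(7) in \<open>auto simp: frechet_derivative_at[OF frechet_derivative_partial[OF assms(4)], symmetric]\<close>)
qed

text \<open>The left trivialisation of the tangent bundle in the chart \<open>\<phi>\<close>, and its inverse.\<close>

definition (in lie_group) chart_log :: "'g set \<Rightarrow> ('g \<Rightarrow> 'e) \<Rightarrow> 'e \<Rightarrow> 'e \<Rightarrow> 'e" where
  "chart_log U \<phi> x = fderiv (\<lambda>z. id_coord G (inv (inv_into U \<phi> x) \<otimes> inv_into U \<phi> z)) x"

definition (in lie_group) chart_exp :: "'g set \<Rightarrow> ('g \<Rightarrow> 'e) \<Rightarrow> 'e \<Rightarrow> 'e \<Rightarrow> 'e" where
  "chart_exp U \<phi> x = fderiv (\<lambda>y. \<phi> (inv_into U \<phi> x \<otimes> id_param G y)) e0"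

text \<open>The pull-back along \<open>h\<close> of the left Maurer--Cartan form, for parameters in
  any normed space: the base point \<open>h p\<close> is frozen before differentiating in
  \<open>q\<close>.\<close>

definition (in lie_group) log_deriv :: "('p::real_normed_vector \<Rightarrow> 'g) \<Rightarrow> 'p \<Rightarrow> 'p \<Rightarrow> 'e" where
  "log_deriv h p = fderiv (\<lambda>q. id_coord G (inv (h p) \<otimes> h q)) p"

context lie_group
begin

context
  fixes U \<phi> assumes chart: "(U, \<phi>) \<in> charts G"
begin

lemma smooth_into_left_difference:
  "smooth_into (charts G) (\<phi> ` U \<times> \<phi> ` U) (\<lambda>p. inv (inv_into U \<phi> (fst p)) \<otimes> inv_into U \<phi> (snd p))"
  by (intro smooth_into_intros smooth_into_compose[OF fd(1) smooth_into_inv_chart[OF chart]] smooth_intros)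
    (auto intro!: open_Times open_range[OF chart])

lemma smooth_into_right_increment:
  "smooth_into (charts G) (\<phi> ` U \<times> id_range) (\<lambda>p. inv_into U \<phi> (fst p) \<otimes> id_param G (snd p))"
  by (intro smooth_into_intros smooth_into_compose[OF fd(1) smooth_into_inv_chart[OF chart]]
      smooth_into_compose[OF fd(1) smooth_id_param] smooth_intros)
    (auto intro!: open_Times open_range[OF chart] open_range[OF id_chart(1)])

lemma inv_chart_carrier: "x \<in> \<phi> ` U \<Longrightarrow> inv_into U \<phi> x \<in> carrier G"
  using chart_carrier[OF chart] chart_inverse(2) by metis

lemma smooth_chart_log: "smooth_on (\<phi> ` U \<times> UNIV) (\<lambda>p. chart_log U \<phi> (fst p) (snd p))"
  and has_derivative_chart_log: "x \<in> \<phi> ` U \<Longrightarrow>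
    ((\<lambda>z. id_coord G (inv (inv_into U \<phi> x) \<otimes> inv_into U \<phi> z)) has_derivative chart_log U \<phi> x) (at x)"
proof -
  note s = smooth_intoD[OF smooth_into_left_difference]
  note q = s(4)[OF id_chart(1)]
  have d: "(x, x) \<in> {p \<in> \<phi> ` U \<times> \<phi> ` U. inv (inv_into U \<phi> (fst p)) \<otimes> inv_into U \<phi> (snd p) \<in> U0}"
    if "x \<in> \<phi> ` U" for x
    using inv_chart_carrier[OF that] that id_chart(2) by auto
  show "smooth_on (\<phi> ` U \<times> UNIV) (\<lambda>p. chart_log U \<phi> (fst p) (snd p))"
    using smooth_on_partial_derivative[OF fd(1) fd(1) s(3)[OF id_chart(1)] q open_range[OF chart] smooth_on_ident d]
    by (simp add: chart_log_def)
  show "((\<lambda>z. id_coord G (inv (inv_into U \<phi> x) \<otimes> inv_into U \<phi> z)) has_derivative chart_log U \<phi> x) (at x)"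
    if "x \<in> \<phi> ` U"
    using frechet_derivative_partial[OF q d[OF that]] frechet_derivative_at
    by (fastforce simp: chart_log_def)
qed

lemma smooth_chart_exp: "smooth_on (\<phi> ` U \<times> UNIV) (\<lambda>p. chart_exp U \<phi> (fst p) (snd p))"
  and has_derivative_chart_exp: "x \<in> \<phi> ` U \<Longrightarrow>
    ((\<lambda>y. \<phi> (inv_into U \<phi> x \<otimes> id_param G y)) has_derivative chart_exp U \<phi> x) (at e0)"
proof -
  note s = smooth_intoD[OF smooth_into_right_increment]
  note q = s(4)[OF chart]
  have d: "(x, e0) \<in> {p \<in> \<phi> ` U \<times> id_range. inv_into U \<phi> (fst p) \<otimes> id_param G (snd p) \<in> U}"
    if "x \<in> \<phi> ` U" for x
    using inv_chart_carrier[OF that] that chart_inverse(2)[OF that] e0_range by auto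
  show "smooth_on (\<phi> ` U \<times> UNIV) (\<lambda>p. chart_exp U \<phi> (fst p) (snd p))"
    using smooth_on_partial_derivative[OF fd(1) fd(1) s(3)[OF chart] q open_range[OF chart] smooth_on_const d]
    by (simp add: chart_exp_def)
  show "((\<lambda>y. \<phi> (inv_into U \<phi> x \<otimes> id_param G y)) has_derivative chart_exp U \<phi> x) (at e0)"
    if "x \<in> \<phi> ` U"
    using frechet_derivative_partial[OF q d[OF that]] frechet_derivative_at
    by (fastforce simp: chart_exp_def)
qed

lemma linear_chart_exp: "x \<in> \<phi> ` U \<Longrightarrow> linear (chart_exp U \<phi> x)"
  using has_derivative_chart_exp has_derivative_linear by blast

lemma linear_chart_log: "x \<in> \<phi> ` U \<Longrightarrow> linear (chart_log U \<phi> x)"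
  using has_derivative_chart_log has_derivative_linear by blast

context
  fixes D :: "'p::real_normed_vector set" and h :: "'p \<Rightarrow> 'g"
  assumes h: "smooth_into (charts G) D h"
begin

lemma chart_has_derivative:
  assumes p: "p \<in> D" "h p \<in> U"
  shows "((\<lambda>q. \<phi> (h q)) has_derivative fderiv (\<lambda>q. \<phi> (h q)) p) (at p)"
  using smooth_on_has_derivative[OF smooth_intoD(4)[OF h chart]] p by blast

lemma log_deriv_eq_chart_log:
  assumes p: "p \<in> D" "h p \<in> U"
  shows "log_deriv h p d = chart_log U \<phi> (\<phi> (h p)) (fderiv (\<lambda>q. \<phi> (h q)) p d)"
    and "((\<lambda>q. id_coord G (inv (h p) \<otimes> h q)) has_derivative log_deriv h p) (at p)"
proof -
  have 1: "((\<lambda>q. id_coord G (inv (inv_into U \<phi> (\<phi> (h p))) \<otimes> inv_into U \<phi> (\<phi> (h q)))) has_derivative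
      (\<lambda>d. chart_log U \<phi> (\<phi> (h p)) (fderiv (\<lambda>q. \<phi> (h q)) p d))) (at p)"
    by (rule has_derivative_compose[OF chart_has_derivative[OF p] has_derivative_chart_log]) (use p in auto)
  have 2: "((\<lambda>q. id_coord G (inv (h p) \<otimes> h q)) has_derivative
      (\<lambda>d. chart_log U \<phi> (\<phi> (h p)) (fderiv (\<lambda>q. \<phi> (h q)) p d))) (at p)"
    by (rule has_derivative_transform_within_open[OF 1 smooth_intoD(3)[OF h chart]])
      (use p in \<open>auto simp: chart_inverse(1)[OF chart]\<close>)
  show "log_deriv h p d = chart_log U \<phi> (\<phi> (h p)) (fderiv (\<lambda>q. \<phi> (h q)) p d)"
    and "((\<lambda>q. id_coord G (inv (h p) \<otimes> h q)) has_derivative log_deriv h p) (at p)"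
    using 2 by (simp_all add: log_deriv_def frechet_derivative_at[OF 2, symmetric])
qed

text \<open>Near \<open>p\<close> the map factors as
  \<open>h q = h p \<otimes> (inv (h p) \<otimes> h q)\<close>, and the second factor stays in the
  domain of the identity chart. Together with \<open>log_deriv_eq_chart_log\<close> this lets
  \<open>chart_log\<close> and \<open>chart_exp\<close> undo each other on the derivatives that
  occur.\<close>

lemma chart_derivative_eq_chart_exp:
  assumes p: "p \<in> D" "h p \<in> U"
  shows "fderiv (\<lambda>q. \<phi> (h q)) p d = chart_exp U \<phi> (\<phi> (h p)) (log_deriv h p d)"
proof -
  have hp: "h p \<in> carrier G" using smooth_into_carrier[OF h p(1)] .
  have "smooth_into (charts G) D (\<lambda>q. inv (h p) \<otimes> h q)"
    by (intro smooth_into_intros h hp inv_closed smooth_intoD(1)[OF h])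
  note o = smooth_intoD(3)[OF this id_chart(1)]
  have e: "id_coord G (inv (h p) \<otimes> h p) = e0" using hp by simp
  have 1: "((\<lambda>q. \<phi> (inv_into U \<phi> (\<phi> (h p)) \<otimes> id_param G (id_coord G (inv (h p) \<otimes> h q)))) has_derivative
      (\<lambda>d. chart_exp U \<phi> (\<phi> (h p)) (log_deriv h p d))) (at p)"
    by (rule has_derivative_compose[OF log_deriv_eq_chart_log(2)[OF p]])
      (use p has_derivative_chart_exp[of "\<phi> (h p)"] e in auto)
  have "((\<lambda>q. \<phi> (h q)) has_derivative (\<lambda>d. chart_exp U \<phi> (\<phi> (h p)) (log_deriv h p d))) (at p)"
  proof (rule has_derivative_transform_within_open[OF 1 o])
    fix q assume "q \<in> {x \<in> D. inv (h p) \<otimes> h x \<in> U0}"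
    then show "\<phi> (inv_into U \<phi> (\<phi> (h p)) \<otimes> id_param G (id_coord G (inv (h p) \<otimes> h q))) = \<phi> (h q)"
      using p hp smooth_into_carrier[OF h] by (simp add: chart_inverse(1)[OF chart] id_param_coord inv_mult_cancel)
  qed (use p hp id_chart(2) in auto)
  then show ?thesis by (simp add: frechet_derivative_at[symmetric])
qed

end

end

text \<open>Left translation by the identity does nothing, and the chart that identifies the Lie
  algebra with the model space is the one used here.\<close>

lemma chart_exp_id [simp]: "chart_exp U0 (id_coord G) e0 w = w"
proof -
  have "((\<lambda>y. id_coord G (\<one> \<otimes> id_param G y)) has_derivative (\<lambda>w. w)) (at e0)"
    by (rule has_derivative_transform_within_open[OF has_derivative_ident open_range[OF id_chart(1)] e0_range])
      (simp add: id_param_carrier id_coord_param)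
  then show ?thesis
    using id_param_e0 by (simp add: chart_exp_def id_param_eq frechet_derivative_at[symmetric])
qed

context
  fixes D :: "'p::real_normed_vector set" and h :: "'p \<Rightarrow> 'g"
  assumes h: "smooth_into (charts G) D h"
begin

lemma has_derivative_log_deriv:
  "p \<in> D \<Longrightarrow> ((\<lambda>q. id_coord G (inv (h p) \<otimes> h q)) has_derivative log_deriv h p) (at p)"
  using smooth_intoD(2)[OF h] log_deriv_eq_chart_log(2)[OF _ h] by blast

lemma linear_log_deriv: "p \<in> D \<Longrightarrow> linear (log_deriv h p)"
  using has_derivative_log_deriv has_derivative_linear by blast

lemma smooth_on_log_deriv: "smooth_on D (\<lambda>p. log_deriv h p d)"
proof (rule smooth_on_locally)
  fix p assume p: "p \<in> D"
  obtain U \<phi> where c: "(U, \<phi>) \<in> charts G" "h p \<in> U" using smooth_intoD(2)[OF h p] by blast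
  let ?N = "{x\<in>D. h x \<in> U}"
  have o: "open ?N" using smooth_intoD(3)[OF h c(1)] .
  have s: "smooth_on ?N (\<lambda>q. \<phi> (h q))" using smooth_intoD(4)[OF h c(1)] .
  have "smooth_on ?N (\<lambda>q. (\<lambda>p. chart_log U \<phi> (fst p) (snd p)) (\<phi> (h q), fderiv (\<lambda>q. \<phi> (h q)) q d))"
    by (rule smooth_on_compose[OF fd(2) o _ _ smooth_chart_log[OF c(1)]])
      (auto intro!: smooth_intros o s smooth_on_deriv[OF s] open_Times open_range[OF c(1)])
  then have "smooth_on ?N (\<lambda>q. log_deriv h q d)"
    by (rule smooth_on_cong[OF o]) (simp add: log_deriv_eq_chart_log(1)[OF c(1) h])
  with o p c show "\<exists>N. open N \<and> p \<in> N \<and> smooth_on N (\<lambda>p. log_deriv h p d)" by blast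
qed

lemma log_deriv_compose:
  assumes "(c has_derivative c') (at x)" "c x \<in> D"
  shows "log_deriv (\<lambda>y. h (c y)) x v = log_deriv h (c x) (c' v)"
  using has_derivative_compose[OF assms(1) has_derivative_log_deriv[OF assms(2)]]
  by (simp add: log_deriv_def frechet_derivative_at[symmetric])

end

end

subsection \<open>The Maurer--Cartan identity\<close>

lemma frechet_derivative_split:
  assumes "smooth_on W F" "(x, z) \<in> W"
  shows "fderiv F (x, z) (a, b) =
    fderiv (\<lambda>x. F (x, z)) x a + fderiv (\<lambda>z. F (x, z)) z b"
proof -
  note F = smooth_on_has_derivative[OF assms]
  interpret linear "fderiv F (x, z)"
    using smooth_on_linear_deriv[OF assms] .
  have "((\<lambda>x. F (x, z)) has_derivative (\<lambda>a. fderiv F (x, z) (a, 0))) (at x)"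
    by (rule has_derivative_compose[where f = "\<lambda>x. (x, z)" and f' = "\<lambda>a. (a, 0)"])
      (auto intro!: derivative_eq_intros F)
  then have "fderiv (\<lambda>x. F (x, z)) x a = fderiv F (x, z) (a, 0)"
    by (simp add: frechet_derivative_at[symmetric])
  moreover have "fderiv (\<lambda>z. F (x, z)) z b = fderiv F (x, z) (0, b)"
    using frechet_derivative_partial[OF assms] by (simp add: frechet_derivative_at[symmetric])
  ultimately show ?thesis using add[of "(a, 0)" "(0, b)"] by simp
qed

section \<open>The adjoint representation\<close>

context lie_group
begin

lemma smooth_into_conjugate:
  "smooth_into (charts G) (id_range \<times> id_range)
    (\<lambda>p. id_param G (fst p) \<otimes> id_param G (snd p) \<otimes> inv (id_param G (fst p)))"
  by (intro smooth_into_intros smooth_into_compose[OF fd(1) smooth_id_param] smooth_intros)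
    (auto intro!: open_Times open_range[OF id_chart(1)])

lemma smooth_Ad: "smooth_on (id_range \<times> UNIV) (\<lambda>p. Ad G (id_param G (fst p)) (snd p))"
proof -
  note s = smooth_intoD[OF smooth_into_conjugate]
  have "(x, e0) \<in> {p \<in> id_range \<times> id_range.
      id_param G (fst p) \<otimes> id_param G (snd p) \<otimes> inv (id_param G (fst p)) \<in> U0}"
    if "x \<in> id_range" for x
    using that e0_range id_param_carrier[OF that] id_chart(2) by auto
  then show ?thesis
    using smooth_on_partial_derivative[OF fd(1) fd(1) s(3)[OF id_chart(1)] s(4)[OF id_chart(1)]
        open_range[OF id_chart(1)] smooth_on_const]
    by (simp add: Ad_def)
qed

lemma has_derivative_Ad:
  assumes "c \<in> carrier G"
  shows "((\<lambda>x. id_coord G (c \<otimes> id_param G x \<otimes> inv c)) has_derivative Ad G c) (at e0)"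
proof -
  have "smooth_into (charts G) id_range (\<lambda>x. c \<otimes> id_param G x \<otimes> inv c)"
    by (intro smooth_into_intros smooth_id_param open_range[OF id_chart(1)] assms inv_closed)
  from smooth_on_has_derivative[OF smooth_intoD(4)[OF this id_chart(1)], of e0]
  show ?thesis using assms id_chart(2) e0_range by (simp add: Ad_def)
qed

lemma linear_Ad: "c \<in> carrier G \<Longrightarrow> linear (Ad G c)"
  using has_derivative_Ad has_derivative_linear by blast

lemma Ad_one [simp]: "Ad G \<one> w = w"
proof -
  have "((\<lambda>x. id_coord G (\<one> \<otimes> id_param G x \<otimes> inv \<one>)) has_derivative (\<lambda>w. w)) (at e0)"
    by (rule has_derivative_transform_within_open[OF has_derivative_ident open_range[OF id_chart(1)] e0_range])
      (simp add: id_param_carrier id_coord_param)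
  then show ?thesis by (simp add: Ad_def frechet_derivative_at[symmetric])
qed

text \<open>\<open>ad\<close> is a derivative of the jointly smooth map \<open>?F\<close>, taken at
  \<open>(e0, \<eta> x)\<close> in the direction \<open>(v x, 0)\<close>; the zero in the second
  slot contributes nothing, so smoothness is that of the tangent map of \<open>?F\<close>.\<close>

lemma smooth_on_ad:
  assumes "open D" "smooth_on D v" "smooth_on D \<eta>"
  shows "smooth_on D (\<lambda>x. ad G (v x) (\<eta> x))"
proof -
  let ?F = "\<lambda>p. Ad G (id_param G (fst p)) (snd p)"
  have o: "open (id_range \<times> (UNIV :: 'e set))" "open ((id_range \<times> (UNIV :: 'e set)) \<times> (UNIV :: ('e \<times> 'e) set))"
    using open_range[OF id_chart(1)] by (auto simp: open_Times)
  have c: "smooth_on D (\<lambda>x. ((e0, \<eta> x), (v x, 0 :: 'e)))"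
    by (intro smooth_intros assms)
  have "smooth_on D (\<lambda>x. (\<lambda>r. fderiv ?F (fst r) (snd r)) ((e0, \<eta> x), (v x, 0)))"
    by (rule smooth_on_compose[OF finite_dim_prod[OF fd(2) fd(2)] assms(1) o(2) _ smooth_on_tangent_map[OF fd(2) o(1) smooth_Ad] c])
      (simp add: e0_range)
  then show ?thesis
  proof (rule smooth_on_cong[OF assms(1)])
    fix x
    have m: "(e0, \<eta> x) \<in> id_range \<times> UNIV" using e0_range by simp
    note P = frechet_derivative_partial[OF smooth_Ad m]
    have zero: "fderiv (\<lambda>z. ?F (e0, z)) (\<eta> x) 0 = 0"
      using linear_0[OF has_derivative_linear[OF P]] frechet_derivative_at[OF P] by simp
    show "(\<lambda>r. fderiv ?F (fst r) (snd r)) ((e0, \<eta> x), (v x, 0)) = ad G (v x) (\<eta> x)"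
      using frechet_derivative_split[OF smooth_Ad m, of "v x" 0] zero
      by (simp add: ad_def)
  qed
qed

text \<open>Each \<open>Ad G (id_param G x)\<close> is homogeneous, and the factor \<open>c\<close>
  passes through the derivative at the identity. Scalar test functions are pulled out of
  \<open>ad\<close> by this in the momentum equation.\<close>

lemma ad_scale: "ad G v (c *\<^sub>R w) = c *\<^sub>R ad G v w"
proof -
  have "((\<lambda>x. Ad G (id_param G x) w) has_derivative (\<lambda>v. ad G v w)) (at e0)" for w
  proof -
    have "((\<lambda>x. (\<lambda>p. Ad G (id_param G (fst p)) (snd p)) (x, w)) has_derivative
        (\<lambda>v. fderiv (\<lambda>p. Ad G (id_param G (fst p)) (snd p)) (e0, w) (v, 0))) (at e0)"
      by (rule has_derivative_compose[where f = "\<lambda>x. (x, w)" and f' = "\<lambda>a. (a, 0)"])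
        (use e0_range in \<open>auto intro!: derivative_eq_intros smooth_on_has_derivative[OF smooth_Ad]\<close>)
    then show ?thesis by (simp add: ad_def frechet_derivative_at[symmetric])
  qed
  note d = this
  have "((\<lambda>x. Ad G (id_param G x) (c *\<^sub>R w)) has_derivative (\<lambda>v. c *\<^sub>R ad G v w)) (at e0)"
    by (rule has_derivative_transform_within_open[OF has_derivative_scaleR_right[OF d, of c w]
          open_range[OF id_chart(1)] e0_range])
      (simp add: linear_scale[OF linear_Ad[OF id_param_carrier]])
  then show ?thesis
    unfolding ad_def by (simp add: frechet_derivative_at[symmetric])
qed

lemma ad_zero [simp]: "ad G v 0 = 0"
  using ad_scale[of v 0 0] by simp

text \<open>The constant cancels in
  \<open>inv (c \<otimes> h p) \<otimes> (c \<otimes> h q)\<close>, which is the left invariance of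
  the Maurer--Cartan form.\<close>

lemma log_deriv_left_translate:
  assumes "smooth_into (charts G) D h" "c \<in> carrier G" "p \<in> D"
  shows "log_deriv (\<lambda>q. c \<otimes> h q) p d = log_deriv h p d"
proof -
  have "fderiv (\<lambda>q. id_coord G (inv (c \<otimes> h p) \<otimes> (c \<otimes> h q))) p =
      fderiv (\<lambda>q. id_coord G (inv (h p) \<otimes> h q)) p"
    by (rule frechet_derivative_cong_open[OF smooth_intoD(1)[OF assms(1)] assms(3)])
      (use assms smooth_into_carrier[OF assms(1)] in \<open>simp add: inv_mult_group m_assoc inv_mult_cancel\<close>)
  then show ?thesis by (simp add: log_deriv_def)
qed

text \<open>Two restrictions determine the derivative of the quotient: with second factor the
  identity it is the identity map, and on the diagonal it is constant. Every direction splits as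
  \<open>(a, b) = (a - b, 0) + (b, b)\<close>.\<close>

lemma has_derivative_right_quotient:
  "((\<lambda>p. id_coord G (id_param G (fst p) \<otimes> inv (id_param G (snd p)))) has_derivative (\<lambda>p. fst p - snd p)) (at (e0, e0))"
proof -
  let ?m = "\<lambda>p. id_coord G (id_param G (fst p) \<otimes> inv (id_param G (snd p)))"
  have "smooth_into (charts G) (id_range \<times> id_range)
      (\<lambda>p. id_param G (fst p) \<otimes> inv (id_param G (snd p)))"
    by (intro smooth_into_intros smooth_into_compose[OF fd(1) smooth_id_param] smooth_intros)
      (auto intro!: open_Times open_range[OF id_chart(1)])
  note m = smooth_intoD(4)[OF this id_chart(1)]
  have e: "(e0, e0) \<in> {p \<in> id_range \<times> id_range. id_param G (fst p) \<otimes> inv (id_param G (snd p)) \<in> U0}"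
    using e0_range id_chart(2) by auto
  note d = smooth_on_has_derivative[OF m e]
  interpret linear "fderiv ?m (e0, e0)"
    using d has_derivative_linear by blast
  have left: "fderiv ?m (e0, e0) (a, 0) = a" for a
  proof -
    have "((\<lambda>x. ?m (x, e0)) has_derivative (\<lambda>a. fderiv ?m (e0, e0) (a, 0))) (at e0)"
      by (rule has_derivative_compose[where f = "\<lambda>x. (x, e0)" and f' = "\<lambda>a. (a, 0)"])
        (auto intro!: derivative_eq_intros d)
    moreover have "((\<lambda>x. ?m (x, e0)) has_derivative (\<lambda>a. a)) (at e0)"
      by (rule has_derivative_transform_within_open[OF has_derivative_ident open_range[OF id_chart(1)] e0_range])
        (simp add: id_param_carrier id_coord_param)
    ultimately show ?thesis by (rule has_derivative_unique[THEN fun_cong])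
  qed
  have diag: "fderiv ?m (e0, e0) (a, a) = 0" for a
  proof -
    have "((\<lambda>x. ?m (x, x)) has_derivative (\<lambda>a. fderiv ?m (e0, e0) (a, a))) (at e0)"
      by (rule has_derivative_compose[where f = "\<lambda>x. (x, x)" and f' = "\<lambda>a. (a, a)"])
        (auto intro!: derivative_eq_intros d)
    moreover have "((\<lambda>x. ?m (x, x)) has_derivative (\<lambda>a. 0)) (at e0)"
      by (rule has_derivative_transform_within_open[OF has_derivative_const open_range[OF id_chart(1)] e0_range])
        (simp add: id_param_carrier)
    ultimately show ?thesis by (rule has_derivative_unique[THEN fun_cong])
  qed
  have "fderiv ?m (e0, e0) p = fst p - snd p" for p
    using add[of "(fst p - snd p, 0)" "(snd p, snd p)"] left diag by simp
  then have "fderiv ?m (e0, e0) = (\<lambda>p. fst p - snd p)" by (rule ext)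
  with d show ?thesis by simp
qed

text \<open>With \<open>?\<alpha> q = inv (f p) \<otimes> f q\<close> and
  \<open>?\<beta> q = inv (b p) \<otimes> b q\<close>, the left difference of the quotient is the
  conjugate by \<open>b p\<close> of \<open>?\<alpha> q \<otimes> inv (?\<beta> q)\<close>. Both
  \<open>?\<alpha>\<close> and \<open>?\<beta>\<close> pass through the identity at
  \<open>p\<close>, so the inner quotient has the derivative of
  \<open>has_derivative_right_quotient\<close> and conjugation contributes
  \<open>Ad\<close>.\<close>

lemma log_deriv_right_quotient:
  fixes D :: "'p::real_normed_vector set"
  assumes f: "smooth_into (charts G) D f" and b: "smooth_into (charts G) D b" and p: "p \<in> D"
  shows "log_deriv (\<lambda>q. f q \<otimes> inv (b q)) p d = Ad G (b p) (log_deriv f p d - log_deriv b p d)"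
proof -
  note [simp] = smooth_into_carrier[OF f] smooth_into_carrier[OF b]
  let ?\<alpha> = "\<lambda>q. inv (f p) \<otimes> f q" and ?\<beta> = "\<lambda>q. inv (b p) \<otimes> b q"
  have D: "open D" using smooth_intoD(1)[OF f] .
  have sm: "smooth_into (charts G) D ?\<alpha>" "smooth_into (charts G) D ?\<beta>"
    "smooth_into (charts G) D (\<lambda>q. ?\<alpha> q \<otimes> inv (?\<beta> q))"
    by (intro smooth_into_intros f b D inv_closed; use p in simp)+
  let ?N = "{q\<in>D. ?\<alpha> q \<in> U0} \<inter> {q\<in>D. ?\<beta> q \<in> U0} \<inter> {q\<in>D. ?\<alpha> q \<otimes> inv (?\<beta> q) \<in> U0}"
  have N: "open ?N" "p \<in> ?N"
    using smooth_intoD(3)[OF sm(1) id_chart(1)] smooth_intoD(3)[OF sm(2) id_chart(1)]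
      smooth_intoD(3)[OF sm(3) id_chart(1)] p id_chart(2) by auto
  have e: "id_coord G (?\<alpha> p) = e0" "id_coord G (?\<beta> p) = e0" using p by simp_all
  have "((\<lambda>q. (\<lambda>r. id_coord G (id_param G (fst r) \<otimes> inv (id_param G (snd r))))
        (id_coord G (?\<alpha> q), id_coord G (?\<beta> q))) has_derivative
      (\<lambda>d. fst (log_deriv f p d, log_deriv b p d) - snd (log_deriv f p d, log_deriv b p d))) (at p)"
    by (rule has_derivative_compose[OF has_derivative_Pair[OF has_derivative_log_deriv[OF f p] has_derivative_log_deriv[OF b p]]])
      (simp only: e has_derivative_right_quotient)
  then have 1: "((\<lambda>q. id_coord G (?\<alpha> q \<otimes> inv (?\<beta> q))) has_derivative (\<lambda>d. log_deriv f p d - log_deriv b p d)) (at p)"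
    unfolding fst_conv snd_conv
    by (rule has_derivative_transform_within_open[OF _ N]) (auto simp: id_param_coord)
  have 2: "((\<lambda>q. id_coord G (b p \<otimes> id_param G (id_coord G (?\<alpha> q \<otimes> inv (?\<beta> q))) \<otimes> inv (b p))) has_derivative
      (\<lambda>d. Ad G (b p) (log_deriv f p d - log_deriv b p d))) (at p)"
    by (rule has_derivative_compose[OF 1]) (use p has_derivative_Ad[of "b p"] in simp)
  have "((\<lambda>q. id_coord G (inv (f p \<otimes> inv (b p)) \<otimes> (f q \<otimes> inv (b q)))) has_derivative
      (\<lambda>d. Ad G (b p) (log_deriv f p d - log_deriv b p d))) (at p)"
    by (rule has_derivative_transform_within_open[OF 2 N])
      (use p in \<open>auto simp: id_param_coord inv_mult_group m_assoc inv_mult_cancel\<close>)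
  then show ?thesis by (simp add: log_deriv_def frechet_derivative_at[symmetric])
qed

text \<open>
  The two mixed partial derivatives at \<open>p\<close> of the family \<open>k(s,t) k(s\<^sub>0,t)\<^sup>-\<^sup>1\<close>, where \<open>k = h(p)\<^sup>-\<^sup>1 h\<close>,
  are the two sides of the identity: the family is constant at \<open>s = s\<^sub>0\<close>, and at \<open>t = t\<^sub>0\<close> its second
  factor is the identity.
\<close>

theorem maurer_cartan:
  fixes D :: "(real \<times> real) set"
  assumes h: "smooth_into (charts G) D h" and p: "p \<in> D"
  shows "fderiv (\<lambda>q. log_deriv h q (0, 1)) p (1, 0) =
    fderiv (\<lambda>q. log_deriv h q (1, 0)) p (0, 1) +
    ad G (log_deriv h p (0, 1)) (log_deriv h p (1, 0))"
proof -
  obtain s0 t0 where p_eq: "p = (s0, t0)" by (cases p)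
  note [simp] = smooth_into_carrier[OF h]
  have D: "open D" using smooth_intoD(1)[OF h] .
  have fin: "finite_dim TYPE(real \<times> real)" by (intro finite_dim_intros)
  \<comment> \<open>The second factor of the quotient samples \<open>h\<close> on the line
    \<open>s = s0\<close>, so points are kept only if their projection to that line stays in
    \<open>D\<close>.\<close>
  define E where "E = D \<inter> (\<lambda>q. (s0, snd q)) -` D"
  have "open ((\<lambda>q::real \<times> real. (s0, snd q)) -` D)"
    by (intro open_vimage D continuous_intros)
  then have E: "open E" "p \<in> E" "E \<subseteq> D" "\<And>q. q \<in> E \<Longrightarrow> (s0, snd q) \<in> D"
    using D p by (auto simp: E_def p_eq)
  \<comment> \<open>Normalising to \<open>k p = \<one>\<close> puts the whole computation at the
    identity, where \<open>Ad\<close> and \<open>chart_exp\<close> are the identity; by left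
    invariance it does not change the logarithmic derivatives.\<close>
  define k where "k = (\<lambda>q. inv (h p) \<otimes> h q)"
  define b where "b = (\<lambda>q::real \<times> real. k (s0, snd q))"
  have k: "smooth_into (charts G) D k"
    unfolding k_def using p by (intro smooth_into_intros h D inv_closed) simp
  have b: "smooth_into (charts G) E b"
    unfolding b_def
    by (rule smooth_into_compose[OF fin k E(1)]) (auto intro!: smooth_intros E(1) dest: E(4))
  have kE: "smooth_into (charts G) E k" using smooth_into_subset[OF k E(1,3)] .
  define R where "R = (\<lambda>q. k q \<otimes> inv (b q))"
  define r where "r = (\<lambda>q. id_coord G (R q))"
  have R: "smooth_into (charts G) E R"
    unfolding R_def by (intro smooth_into_intros kE b)
  define N where "N = {q\<in>E. R q \<in> U0} \<inter> {q\<in>E. b q \<in> U0} \<inter> {q\<in>E. k q \<in> U0}"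
  have kp: "k p = \<one>" "b p = \<one>" "R p = \<one>" "r p = e0"
    using p by (simp_all add: k_def b_def R_def r_def p_eq)
  have N: "open N" "p \<in> N" "N \<subseteq> E"
    using smooth_intoD(3)[OF kE id_chart(1)] smooth_intoD(3)[OF R id_chart(1)]
      smooth_intoD(3)[OF b id_chart(1)] E kp id_chart(2) by (auto simp: N_def)
  have r: "smooth_on N r"
    unfolding r_def by (rule smooth_on_subset[OF smooth_intoD(4)[OF R id_chart(1)]]) (auto simp: N_def)
  have ldk: "log_deriv k q d = log_deriv h q d" if "q \<in> D" for q d
    unfolding k_def using log_deriv_left_translate[OF h _ that] p by simp
  have ldb: "log_deriv b q d = log_deriv h (s0, snd q) (0, snd d)" if "q \<in> E" for q d
  proof -
    have "((\<lambda>q::real \<times> real. (s0, snd q)) has_derivative (\<lambda>d. (0, snd d))) (at q)"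
      by (auto intro!: derivative_eq_intros)
    from log_deriv_compose[OF k this, of d] show ?thesis
      using that ldk[of "(s0, snd q)"] by (simp add: b_def E_def)
  qed
  \<comment> \<open>\<open>b\<close> depends on \<open>t\<close> alone, so only the
    \<open>t\<close>-component of \<open>d\<close> is subtracted, and it is subtracted on the line
    \<open>s = s0\<close>.\<close>
  have Dr: "fderiv r q d =
      chart_exp U0 (id_coord G) (r q) (Ad G (b q) (log_deriv h q d - log_deriv h (s0, snd q) (0, snd d)))"
    if "q \<in> N" for q d
  proof -
    have q: "q \<in> E" "R q \<in> U0" "q \<in> D" using that E by (auto simp: N_def)
    have "fderiv r q d = chart_exp U0 (id_coord G) (r q) (log_deriv R q d)"
      unfolding r_def by (rule chart_derivative_eq_chart_exp[OF id_chart(1) R q(1,2)])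
    also have "log_deriv R q d = Ad G (b q) (log_deriv k q d - log_deriv b q d)"
      unfolding R_def by (rule log_deriv_right_quotient[OF kE b q(1)])
    finally show ?thesis using q by (simp add: ldk ldb)
  qed
  define V where "V = (\<lambda>q. log_deriv h q (0, 1))"
  define H where "H = (\<lambda>q. log_deriv h q (1, 0))"
  have V: "smooth_on D V" and H: "smooth_on D H"
    unfolding V_def H_def by (rule smooth_on_log_deriv[OF h])+
  have slice_s: "((\<lambda>s. f (s, t0)) has_vector_derivative fderiv f p (1, 0)) (at s0)"
    if "smooth_on W f" "p \<in> W" for W and f :: "real \<times> real \<Rightarrow> 'e"
    using smooth_on_chain_vector[OF that(1) _ has_vector_derivative_Pair[OF has_vector_derivative_id has_vector_derivative_const]]
      that(2) by (simp add: p_eq)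
  have slice_t: "((\<lambda>t. f (s0, t)) has_vector_derivative fderiv f p (0, 1)) (at t0)"
    if "smooth_on W f" "p \<in> W" for W and f :: "real \<times> real \<Rightarrow> 'e"
    using smooth_on_chain_vector[OF that(1) _ has_vector_derivative_Pair[OF has_vector_derivative_const has_vector_derivative_id]]
      that(2) by (simp add: p_eq)
  have openslice: "open {s. (s, t0) \<in> N}" "open {t. (s0, t) \<in> N}"
    using open_vimage[OF N(1), of "\<lambda>s. (s, t0)"] open_vimage[OF N(1), of "\<lambda>t. (s0, t)"]
    by (simp_all add: vimage_def continuous_intros)
  let ?J = "\<lambda>p. chart_exp U0 (id_coord G) (fst p) (snd p)"
  let ?A = "\<lambda>p. Ad G (id_param G (fst p)) (snd p)"
  \<comment> \<open>On the line \<open>t = t0\<close> the factor \<open>b\<close> is the identity,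
    so the \<open>t\<close>-derivative of \<open>r\<close> is \<open>chart_exp\<close> at
    \<open>r\<close> applied to \<open>V (s, t0) - V p\<close>. The argument vanishes at
    \<open>s0\<close>; hence the motion of the base point contributes nothing, and at
    \<open>e0\<close> the map \<open>chart_exp\<close> is the identity.\<close>
  have "fderiv (\<lambda>q. fderiv r q (0, 1)) p (1, 0) = fderiv V p (1, 0)"
  proof -
    note J = smooth_chart_exp[OF id_chart(1)]
    have "((\<lambda>s. ?J (r (s, t0), V (s, t0) - V p)) has_vector_derivative
        fderiv ?J (r (s0, t0), V (s0, t0) - V p)
          (fderiv r p (1, 0), fderiv V p (1, 0) - 0)) (at s0)"
      by (rule smooth_on_chain_vector[OF J _ has_vector_derivative_Pair[OF slice_s[OF r N(2)]
              has_vector_derivative_diff[OF slice_s[OF V p] has_vector_derivative_const]]])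
        (use kp(4) e0_range in \<open>simp add: p_eq\<close>)
    also have "(r (s0, t0), V (s0, t0) - V p) = (e0, 0)" using kp(4) by (simp add: p_eq)
    also have "fderiv ?J (e0, 0) (fderiv r p (1, 0), fderiv V p (1, 0) - 0)
        = fderiv V p (1, 0)"
    proof -
      have "fderiv (\<lambda>x. ?J (x, 0)) e0 = (\<lambda>w. 0)"
        by (rule frechet_derivative_at[symmetric], rule has_derivative_transform_within_open[OF has_derivative_const open_range[OF id_chart(1)] e0_range])
          (simp add: linear_0[OF linear_chart_exp[OF id_chart(1)]])
      moreover have "fderiv (\<lambda>w. ?J (e0, w)) 0 = (\<lambda>w. w)"
        by (rule frechet_derivative_at[symmetric]) simp
      ultimately show ?thesis
        using frechet_derivative_split[OF J, of e0 0] e0_range by simp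
    qed
    finally have "((\<lambda>s. fderiv r (s, t0) (0, 1)) has_vector_derivative fderiv V p (1, 0)) (at s0)"
      by (rule has_vector_derivative_transform_within_open[OF _ openslice(1)])
        (use N(2) kp(2) in \<open>auto simp: Dr p_eq V_def b_def\<close>)
    then show ?thesis
      using slice_s[OF smooth_on_deriv[OF r] N(2)] vector_derivative_unique_at by blast
  qed
  \<comment> \<open>On the line \<open>s = s0\<close> the quotient \<open>R\<close> is the identity
    and the \<open>s\<close>-derivative of \<open>r\<close> is \<open>Ad\<close> at \<open>b\<close>
    applied to \<open>H\<close>. Differentiating in \<open>t\<close>, the motion of \<open>b\<close>
    away from the identity with velocity \<open>V p\<close> gives the \<open>ad\<close>
    term.\<close>
  moreover have "fderiv (\<lambda>q. fderiv r q (1, 0)) p (0, 1) =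
      fderiv H p (0, 1) + ad G (V p) (H p)"
  proof -
    note A = smooth_Ad
    let ?y = "\<lambda>t. id_coord G (b (s0, t))"
    have y: "(?y has_vector_derivative V p) (at t0)"
    proof -
      have "((\<lambda>q. id_coord G (inv (h p) \<otimes> h q)) has_derivative log_deriv h p) (at (s0, t0))"
        using has_derivative_log_deriv[OF h p] unfolding p_eq .
      from has_derivative_compose[OF has_derivative_Pair[OF has_derivative_const has_derivative_ident] this]
      have "((\<lambda>t. id_coord G (inv (h p) \<otimes> h (s0, t))) has_derivative (\<lambda>x. log_deriv h p (0, x))) (at t0)" .
      moreover have "log_deriv h p (0, x) = x *\<^sub>R V p" for x
        using linear_scale[OF linear_log_deriv[OF h p], of x "(0, 1)"] by (simp add: V_def)
      ultimately show ?thesis by (simp add: has_vector_derivative_def b_def k_def)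
    qed
    have "((\<lambda>t. ?A (?y t, H (s0, t))) has_vector_derivative
        fderiv ?A (?y t0, H (s0, t0)) (V p, fderiv H p (0, 1))) (at t0)"
      by (rule smooth_on_chain_vector[OF A _ has_vector_derivative_Pair[OF y slice_t[OF H p]]])
        (use kp(2) e0_range in \<open>simp add: p_eq\<close>)
    also have "(?y t0, H (s0, t0)) = (e0, H p)" using kp(2) by (simp add: p_eq)
    also have "fderiv ?A (e0, H p) (V p, fderiv H p (0, 1)) =
        fderiv H p (0, 1) + ad G (V p) (H p)"
    proof -
      have "fderiv (\<lambda>w. ?A (e0, w)) (H p) = (\<lambda>w. w)"
        by (rule frechet_derivative_at[symmetric]) simp
      then show ?thesis
        using frechet_derivative_split[OF A, of e0 "H p"] e0_range by (simp add: ad_def)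
    qed
    finally have "((\<lambda>t. fderiv r (s0, t) (1, 0)) has_vector_derivative
        fderiv H p (0, 1) + ad G (V p) (H p)) (at t0)"
    proof (rule has_vector_derivative_transform_within_open[OF _ openslice(2)])
      fix t assume "t \<in> {t. (s0, t) \<in> N}"
      then have t: "(s0, t) \<in> N" by simp
      then have "R (s0, t) = \<one>" "b (s0, t) \<in> U0" "(s0, t) \<in> D"
        using smooth_into_carrier[OF k, of "(s0, t)"] E by (auto simp: R_def b_def N_def)
      then show "?A (?y t, H (s0, t)) = fderiv r (s0, t) (1, 0)"
        using Dr[OF t, of "(1, 0)"] linear_0[OF linear_log_deriv[OF h, of "(s0, t)"]]
        by (simp add: r_def H_def id_param_coord zero_prod_def)
    qed (use N(2) in \<open>simp add: p_eq\<close>)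
    then show ?thesis
      using slice_t[OF smooth_on_deriv[OF r] N(2)] vector_derivative_unique_at by blast
  qed
  ultimately show ?thesis
    using mixed_partials[OF N(1) r N(2), of "(0, 1)" "(1, 0)"] by (simp add: V_def H_def)
qed

end

subsection \<open>Second-order jets\<close>

text \<open>The bridge between a curve on a closed interval and an extension to an open set: the
  two-sided derivative of the extension restricts to \<open>I\<close>, and nontriviality of the
  filter makes the one-sided derivative unique, so it does not depend on the extension.\<close>

lemma has_vector_derivative_extension:
  assumes "(f has_vector_derivative f') (at t)" "open D" "t \<in> D" "t \<in> I" "at t within I \<noteq> bot"
    and "\<And>\<tau>. \<tau> \<in> I \<Longrightarrow> \<tau> \<in> D \<Longrightarrow> k \<tau> = f \<tau>"
  shows "(k has_vector_derivative f') (at t within I)" "vector_derivative k (at t within I) = f'"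
proof -
  obtain d where d: "d > 0" "ball t d \<subseteq> D" using assms(2,3) openE by blast
  show "(k has_vector_derivative f') (at t within I)"
    by (rule has_vector_derivative_transform_within[OF has_vector_derivative_at_within[OF assms(1)] d(1) assms(4)])
      (use assms(6) d in \<open>auto simp: subset_iff dist_commute\<close>)
  then show "vector_derivative k (at t within I) = f'"
    using vector_derivative_within assms(5) by blast
qed

lemma smooth_on_has_vector_derivative:
  assumes "smooth_on D f" "t \<in> D"
  shows "(f has_vector_derivative fderiv f t 1) (at t)"
  using smooth_on_chain_vector[OF assms(1), of "\<lambda>t. t" t 1 UNIV] assms(2) by simp

definition (in lie_group) log_accel :: "(real \<Rightarrow> 'g) \<Rightarrow> real \<Rightarrow> 'e" where
  "log_accel h t = fderiv (\<lambda>\<tau>. log_deriv h \<tau> 1) t 1"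

text \<open>One predicate serves curves on [0,a], with \<open>h\<close> an extension, and germs,
  with \<open>I = UNIV\<close> and \<open>g = h\<close>. The last clause guarantees that derivatives
  within \<open>I\<close> are unique.\<close>

definition (in lie_group) represents :: "real set \<Rightarrow> (real \<Rightarrow> 'g) \<Rightarrow> (real \<Rightarrow> 'g) \<Rightarrow> real set \<Rightarrow> real \<Rightarrow> bool" where
  "represents I g h D t \<longleftrightarrow> smooth_into (charts G) D h \<and> t \<in> D \<and> t \<in> I \<and>
     (\<forall>\<tau>\<in>I \<inter> D. g \<tau> = h \<tau>) \<and> (\<forall>\<tau>\<in>I. at \<tau> within I \<noteq> bot)"

context lie_group
begin

context
  fixes I g h D t
  assumes rep: "represents I g h D t"
begin

lemma representsD: "smooth_into (charts G) D h" "t \<in> D" "t \<in> I" "g t = h t" "h t \<in> carrier G"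
  using rep smooth_into_carrier by (auto simp: represents_def)

lemma represents_at: "\<tau> \<in> I \<Longrightarrow> \<tau> \<in> D \<Longrightarrow> represents I g h D \<tau>"
  using rep by (auto simp: represents_def)

lemma left_velocity_eq: "left_velocity G I g t = log_deriv h t 1"
proof -
  note h = representsD(1)
  have "log_deriv h t x = x *\<^sub>R log_deriv h t 1" for x
    using linear_scale[OF linear_log_deriv[OF h representsD(2)], of x 1] by simp
  then have "log_deriv h t = (\<lambda>x. x *\<^sub>R log_deriv h t 1)" by (rule ext)
  then have "((\<lambda>\<tau>. id_coord G (inv (h t) \<otimes> h \<tau>)) has_vector_derivative log_deriv h t 1) (at t)"
    using has_derivative_log_deriv[OF h representsD(2)] unfolding has_vector_derivative_def by simp
  note e = has_vector_derivative_extension[OF this smooth_intoD(1)[OF h] representsD(2,3)]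
  show ?thesis
    unfolding left_velocity_def using rep by (auto simp: represents_def intro!: e)
qed

end

lemma velocity_left_velocity_eq:
  assumes "represents I g h D t"
  shows "vector_derivative (left_velocity G I g) (at t within I) = log_accel h t"
proof -
  note h = representsD[OF assms]
  have "((\<lambda>\<tau>. log_deriv h \<tau> 1) has_vector_derivative log_accel h t) (at t)"
    unfolding log_accel_def by (rule smooth_on_has_vector_derivative[OF smooth_on_log_deriv[OF h(1)] h(2)])
  from has_vector_derivative_extension(2)[OF this smooth_intoD(1)[OF h(1)] h(2,3)]
  show ?thesis
    using assms left_velocity_eq[OF represents_at[OF assms]] by (auto simp: represents_def)
qed

lemma jet_coords_eq:
  assumes rep: "represents I g h D t" and c: "(U, \<phi>) \<in> charts G" "h t \<in> U"
  shows "jet_coords \<phi> I g t = (\<phi> (h t), fderiv (\<lambda>\<tau>. \<phi> (h \<tau>)) t 1,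
      fderiv (\<lambda>\<tau>. fderiv (\<lambda>\<tau>. \<phi> (h \<tau>)) \<tau> 1) t 1)"
proof -
  note h = representsD[OF rep]
  let ?N = "{\<tau>\<in>D. h \<tau> \<in> U}"
  have N: "open ?N" "t \<in> ?N" using smooth_intoD(3)[OF h(1) c(1)] h c by auto
  note s = smooth_intoD(4)[OF h(1) c(1)]
  have 1: "vector_derivative (\<phi> \<circ> g) (at \<tau> within I) = fderiv (\<lambda>\<tau>. \<phi> (h \<tau>)) \<tau> 1"
    if "\<tau> \<in> I" "\<tau> \<in> ?N" for \<tau>
    by (rule has_vector_derivative_extension(2)[OF smooth_on_has_vector_derivative[OF s that(2)] N(1) that(2) that(1)])
      (use rep that in \<open>auto simp: represents_def\<close>)
  have "vector_derivative (\<lambda>\<tau>. vector_derivative (\<phi> \<circ> g) (at \<tau> within I)) (at t within I) =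
      fderiv (\<lambda>\<tau>. fderiv (\<lambda>\<tau>. \<phi> (h \<tau>)) \<tau> 1) t 1"
    by (rule has_vector_derivative_extension(2)[OF smooth_on_has_vector_derivative[OF smooth_on_deriv[OF s] N(2)] N h(3)])
      (use rep 1 in \<open>auto simp: represents_def\<close>)
  then show ?thesis using 1[OF h(3) N(2)] h(4) by (simp add: jet_coords_def)
qed

text \<open>The last two formulas are the time derivatives of the first two. In each pair one
  formula passes from chart coordinates to the trivialisation and the other passes back, so the
  chart 2-jet and the trivialised 2-jet determine each other.\<close>

lemma log_accel_chart:
  assumes h: "smooth_into (charts G) D h" "t \<in> D" and c: "(U, \<phi>) \<in> charts G" "h t \<in> U"
  defines "X' \<equiv> \<lambda>\<tau>. fderiv (\<lambda>\<tau>. \<phi> (h \<tau>)) \<tau> 1"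
  defines "X'' \<equiv> fderiv X' t 1"
  shows "log_deriv h t 1 = chart_log U \<phi> (\<phi> (h t)) (X' t)"
    and "X' t = chart_exp U \<phi> (\<phi> (h t)) (log_deriv h t 1)"
    and "log_accel h t = fderiv (\<lambda>p. chart_log U \<phi> (fst p) (snd p)) (\<phi> (h t), X' t) (X' t, X'')"
    and "X'' = fderiv (\<lambda>p. chart_exp U \<phi> (fst p) (snd p)) (\<phi> (h t), log_deriv h t 1) (X' t, log_accel h t)"
proof -
  let ?N = "{\<tau>\<in>D. h \<tau> \<in> U}"
  have N: "open ?N" "t \<in> ?N" using smooth_intoD(3)[OF h(1) c(1)] h c by auto
  note s = smooth_intoD(4)[OF h(1) c(1)]
  have 1: "log_deriv h \<tau> 1 = chart_log U \<phi> (\<phi> (h \<tau>)) (X' \<tau>)"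
    "X' \<tau> = chart_exp U \<phi> (\<phi> (h \<tau>)) (log_deriv h \<tau> 1)" if "\<tau> \<in> ?N" for \<tau>
    using that log_deriv_eq_chart_log(1)[OF c(1) h(1)] chart_derivative_eq_chart_exp[OF c(1) h(1)]
    by (simp_all add: X'_def)
  show "log_deriv h t 1 = chart_log U \<phi> (\<phi> (h t)) (X' t)"
    and "X' t = chart_exp U \<phi> (\<phi> (h t)) (log_deriv h t 1)"
    using 1[OF N(2)] by simp_all
  have dx: "((\<lambda>\<tau>. \<phi> (h \<tau>)) has_vector_derivative X' t) (at t)"
    unfolding X'_def by (rule smooth_on_has_vector_derivative[OF s N(2)])
  have dX': "(X' has_vector_derivative X'') (at t)"
    unfolding X''_def X'_def by (rule smooth_on_has_vector_derivative[OF smooth_on_deriv[OF s] N(2)])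
  have dV: "((\<lambda>\<tau>. log_deriv h \<tau> 1) has_vector_derivative log_accel h t) (at t)"
    unfolding log_accel_def by (rule smooth_on_has_vector_derivative[OF smooth_on_log_deriv[OF h(1)] h(2)])
  have "((\<lambda>\<tau>. (\<lambda>p. chart_log U \<phi> (fst p) (snd p)) (\<phi> (h \<tau>), X' \<tau>)) has_vector_derivative
      fderiv (\<lambda>p. chart_log U \<phi> (fst p) (snd p)) (\<phi> (h t), X' t) (X' t, X'')) (at t)"
    by (rule smooth_on_chain_vector[OF smooth_chart_log[OF c(1)] _ has_vector_derivative_Pair[OF dx dX']])
      (use c in simp)
  then have "((\<lambda>\<tau>. log_deriv h \<tau> 1) has_vector_derivative
      fderiv (\<lambda>p. chart_log U \<phi> (fst p) (snd p)) (\<phi> (h t), X' t) (X' t, X'')) (at t)"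
    by (rule has_vector_derivative_transform_within_open[OF _ N]) (simp add: 1(1))
  with dV show "log_accel h t = fderiv (\<lambda>p. chart_log U \<phi> (fst p) (snd p)) (\<phi> (h t), X' t) (X' t, X'')"
    using vector_derivative_unique_at by blast
  have "((\<lambda>\<tau>. (\<lambda>p. chart_exp U \<phi> (fst p) (snd p)) (\<phi> (h \<tau>), log_deriv h \<tau> 1)) has_vector_derivative
      fderiv (\<lambda>p. chart_exp U \<phi> (fst p) (snd p)) (\<phi> (h t), log_deriv h t 1) (X' t, log_accel h t)) (at t)"
    by (rule smooth_on_chain_vector[OF smooth_chart_exp[OF c(1)] _ has_vector_derivative_Pair[OF dx dV]])
      (use c in simp)
  then have "(X' has_vector_derivative
      fderiv (\<lambda>p. chart_exp U \<phi> (fst p) (snd p)) (\<phi> (h t), log_deriv h t 1) (X' t, log_accel h t)) (at t)"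
    by (rule has_vector_derivative_transform_within_open[OF _ N]) (simp add: 1(2)[symmetric])
  with dX' show "X'' = fderiv (\<lambda>p. chart_exp U \<phi> (fst p) (snd p)) (\<phi> (h t), log_deriv h t 1) (X' t, log_accel h t)"
    using vector_derivative_unique_at by blast
qed

text \<open>Each side is a function of the other by \<open>log_accel_chart\<close>, the base point
  being shared. The right-hand side mentions no chart, so equality of 2-jets may be tested in a
  single one.\<close>

lemma jet_coords_eq_iff:
  assumes rep: "represents I g h D t" "represents J k h' E s"
    and c: "(U, \<phi>) \<in> charts G" "h t \<in> U" "h t = h' s"
  shows "jet_coords \<phi> I g t = jet_coords \<phi> J k s \<longleftrightarrow>
    log_deriv h t 1 = log_deriv h' s 1 \<and> log_accel h t = log_accel h' s"
proof -
  note a = log_accel_chart[OF representsD(1,2)[OF rep(1)] c(1,2)]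
  have "h' s \<in> U" using c by simp
  note b = log_accel_chart[OF representsD(1,2)[OF rep(2)] c(1) this]
  note j = jet_coords_eq[OF rep(1) c(1,2)] jet_coords_eq[OF rep(2) c(1) \<open>h' s \<in> U\<close>]
  show ?thesis
  proof
    assume "jet_coords \<phi> I g t = jet_coords \<phi> J k s"
    then show "log_deriv h t 1 = log_deriv h' s 1 \<and> log_accel h t = log_accel h' s"
      unfolding j a(1) b(1) a(3) b(3) using c(3) by simp
  next
    assume *: "log_deriv h t 1 = log_deriv h' s 1 \<and> log_accel h t = log_accel h' s"
    show "jet_coords \<phi> I g t = jet_coords \<phi> J k s"
      unfolding j a(4) b(4) a(2) b(2) using c(3) * by simp
  qed
qed

lemma germ_represents:
  assumes "germ G c"
  shows "\<exists>D. represents UNIV c c D 0"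
  using assms unfolding germ_def represents_def by fastforce

lemma jet2_mem_iff:
  assumes "represents I g h D t" "represents UNIV c c E 0"
  shows "c \<in> jet2 G I g t \<longleftrightarrow>
    germ G c \<and> c 0 = h t \<and> log_deriv c 0 1 = log_deriv h t 1 \<and> log_accel c 0 = log_accel h t"
proof -
  obtain U \<phi> where "(U, \<phi>) \<in> charts G" "h t \<in> U"
    using representsD(5)[OF assms(1)] carrier_charts by blast
  moreover have "jet_coords \<phi> UNIV c 0 = jet_coords \<phi> I g t \<longleftrightarrow>
      log_deriv c 0 1 = log_deriv h t 1 \<and> log_accel c 0 = log_accel h t"
    if "(U, \<phi>) \<in> charts G" "h t \<in> U" "c 0 = h t" for U \<phi>
    using jet_coords_eq_iff[OF assms(2,1) that(1)] that by simp
  ultimately show ?thesis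
    using representsD(4)[OF assms(1)] unfolding jet2_def by fastforce
qed

lemma jet2_cong:
  assumes "represents I g h D t" "represents J k h' E s" "h t = h' s"
    "log_deriv h t 1 = log_deriv h' s 1" "log_accel h t = log_accel h' s"
  shows "jet2 G I g t = jet2 G J k s"
proof -
  have "c \<in> jet2 G I g t \<longleftrightarrow> c \<in> jet2 G J k s" for c
  proof (cases "germ G c")
    case True
    then obtain F where F: "represents UNIV c c F 0" using germ_represents by blast
    show ?thesis using jet2_mem_iff[OF assms(1) F] jet2_mem_iff[OF assms(2) F] assms(3-5) by simp
  qed (simp add: jet2_def)
  then show ?thesis by blast
qed

text \<open>Jets consist of curves through their base point at time 0, so the representative is
  translated there. The translated curve lies in the jet, which is therefore nonempty and an element
  of \<open>T2 G\<close>.\<close>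

lemma represents_shift:
  assumes rep: "represents I g h D t"
  defines "c \<equiv> \<lambda>\<tau>. h (t + \<tau>)"
  shows "germ G c" "represents UNIV c c ((+) t -` D) 0" "c 0 = h t"
    "log_deriv c 0 1 = log_deriv h t 1" "log_accel c 0 = log_accel h t"
proof -
  note h = representsD[OF rep]
  have o: "open ((+) t -` D)"
    using smooth_intoD(1)[OF h(1)] by (intro open_vimage continuous_intros)
  have s: "smooth_into (charts G) ((+) t -` D) c"
    unfolding c_def by (rule smooth_into_compose[OF finite_dim_real h(1) o]) (auto intro!: smooth_intros o)
  show r: "represents UNIV c c ((+) t -` D) 0" using s h(2) by (simp add: represents_def)
  obtain e where e: "e > 0" "ball 0 e \<subseteq> (+) t -` D" using o h(2) openE[of "(+) t -` D" 0] by auto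
  have "{-e<..<e} \<subseteq> (+) t -` D" using e(2) by (simp add: ball_eq_greaterThanLessThan)
  from smooth_into_subset[OF s open_greaterThanLessThan this]
  show "germ G c" unfolding germ_def by (intro exI[of _ e] conjI e(1))
  show "c 0 = h t" by (simp add: c_def)
  have ld: "log_deriv c \<tau> 1 = log_deriv h (t + \<tau>) 1" if "t + \<tau> \<in> D" for \<tau>
  proof -
    have "((\<lambda>\<tau>. t + \<tau>) has_derivative (\<lambda>x. x)) (at \<tau>)"
      by (auto intro!: derivative_eq_intros)
    from log_deriv_compose[OF h(1) this that] show ?thesis by (simp add: c_def)
  qed
  show "log_deriv c 0 1 = log_deriv h t 1" using ld[of 0] h(2) by simp
  have "((\<lambda>\<tau>. t + \<tau>) has_vector_derivative 1) (at 0)"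
    by (auto intro!: derivative_eq_intros)
  from smooth_on_chain_vector[OF smooth_on_log_deriv[OF h(1), of 1] _ this]
  have "((\<lambda>\<tau>. log_deriv h (t + \<tau>) 1) has_vector_derivative
      log_accel h t) (at 0)"
    using h(2) by (simp add: log_accel_def)
  then have dc: "((\<lambda>\<tau>. log_deriv c \<tau> 1) has_vector_derivative log_accel h t) (at 0)"
    by (rule has_vector_derivative_transform_within_open[OF _ o]) (use h(2) ld in auto)
  have "((\<lambda>\<tau>. log_deriv c \<tau> 1) has_vector_derivative log_accel c 0) (at 0)"
    unfolding log_accel_def
    by (rule smooth_on_has_vector_derivative[OF smooth_on_log_deriv[OF s]]) (use h(2) in simp)
  then show "log_accel c 0 = log_accel h t" by (rule vector_derivative_unique_at[OF _ dc])
qed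

text \<open>The curve picked by \<open>SOME\<close> is unknown, but membership in the jet already
  fixes its value, left velocity and acceleration at 0.\<close>

lemma left_triv_jet2:
  assumes "represents I g h D t"
  shows "left_triv G (jet2 G I g t) = (h t, log_deriv h t 1, log_accel h t)"
proof -
  let ?j = "jet2 G I g t"
  note s = represents_shift[OF assms]
  have "(\<lambda>\<tau>. h (t + \<tau>)) \<in> ?j" using jet2_mem_iff[OF assms s(2)] s by simp
  then have j: "(SOME c. c \<in> ?j) \<in> ?j" by (rule someI[of "\<lambda>c. c \<in> ?j"])
  obtain c where c: "c = (SOME c. c \<in> ?j)" by simp
  from j have "germ G c" unfolding c jet2_def by blast
  then obtain E where E: "represents UNIV c c E 0" using germ_represents by blast
  show ?thesis
    using jet2_mem_iff[OF assms E] j velocity_left_velocity_eq[OF E] left_velocity_eq[OF E]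
    unfolding left_triv_def Let_def c[symmetric] by simp
qed

lemma T2_inj: "inj_on (left_triv G) (T2 G)"
proof (rule inj_onI)
  fix j k assume *: "j \<in> T2 G" "k \<in> T2 G" "left_triv G j = left_triv G k"
  then obtain c d where j: "germ G c" "germ G d" "j = jet2 G UNIV c 0" "k = jet2 G UNIV d 0"
    by (auto simp: T2_def)
  obtain D E where r: "represents UNIV c c D 0" "represents UNIV d d E 0"
    using j(1,2) germ_represents by blast
  show "j = k"
    unfolding j by (rule jet2_cong[OF r]) (use *(3) left_triv_jet2[OF r(1)] left_triv_jet2[OF r(2)] j in auto)
qed

section \<open>The reduced Lagrangian\<close>

lemma lagrangian_reduced:
  assumes "left_invariant G L" and rep: "represents I g h D t"
  shows "L (jet2 G I g t) = reduced_lagrangian G L (log_deriv h t 1, log_accel h t)"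
proof -
  note s = represents_shift[OF rep]
  have "jet2 G I g t = jet2 G UNIV (\<lambda>\<tau>. h (t + \<tau>)) 0"
    by (rule jet2_cong[OF rep s(2)]) (use s in auto)
  then have "jet2 G I g t \<in> T2 G" using s(1) by (auto simp: T2_def)
  then have "L (jet2 G I g t) = trivialised_lagrangian G L (left_triv G (jet2 G I g t))"
    by (simp add: trivialised_lagrangian_def T2_inj)
  also have "\<dots> = trivialised_lagrangian G L (\<one>, log_deriv h t 1, log_accel h t)"
    using assms(1) representsD(5)[OF rep] one_closed unfolding left_triv_jet2[OF rep] left_invariant_def by blast
  finally show ?thesis by (simp add: reduced_lagrangian_def)
qed

text \<open>Smoothness of \<open>L\<close> is given in chart coordinates \<open>(x, v, w)\<close>,
  so a jet at the identity with trivialisation \<open>(\<xi>, u)\<close> has to be found in these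
  coordinates. Here \<open>x = e0\<close> and \<open>v = \<xi>\<close>, and the second-order
  coordinate \<open>w\<close> is the derivative of \<open>chart_exp\<close> at
  \<open>(e0, \<xi>)\<close> in the direction \<open>(\<xi>, u)\<close>, as the last formula of
  \<open>log_accel_chart\<close> demands. All of this is smooth in
  \<open>(\<xi>, u)\<close>.\<close>

lemma smooth_reduced_lagrangian:
  assumes L: "smooth_lagrangian G L" "left_invariant G L"
  shows "smooth_on UNIV (reduced_lagrangian G L)"
proof -
  let ?J = "\<lambda>p. chart_exp U0 (id_coord G) (fst p) (snd p)"
  let ?w = "\<lambda>p. fderiv ?J (e0, fst p) (fst p, snd p)"
  let ?c = "\<lambda>x v w t. id_param G (x + t *\<^sub>R v + (t\<^sup>2 / 2) *\<^sub>R w)"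
  note J = smooth_chart_exp[OF id_chart(1)]
  have o: "open (id_range \<times> (UNIV :: 'e set))" "open ((id_range \<times> (UNIV :: 'e set)) \<times> (UNIV :: ('e \<times> 'e) set))"
    "open (id_range \<times> (UNIV :: 'e set) \<times> (UNIV :: 'e set))"
    using open_range[OF id_chart(1)] by (auto simp: open_Times)
  have c: "smooth_on UNIV (\<lambda>p::'e \<times> 'e. ((e0, fst p), (fst p, snd p)))"
    by (intro smooth_intros open_UNIV)
  have "smooth_on UNIV (\<lambda>p::'e \<times> 'e. (\<lambda>r. fderiv ?J (fst r) (snd r)) ((e0, fst p), (fst p, snd p)))"
    by (rule smooth_on_compose[OF finite_dim_prod[OF fd(2) fd(2)] open_UNIV o(2) _ smooth_on_tangent_map[OF fd(2) o(1) J] c])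
      (use e0_range in simp)
  then have w: "smooth_on UNIV (\<lambda>p::'e \<times> 'e. (e0, fst p, ?w p))"
    by (intro smooth_intros open_UNIV) simp
  have "smooth_on (id_range \<times> UNIV \<times> UNIV) (\<lambda>(x, v, w). L (jet2 G UNIV (?c x v w) 0))"
    using L(1) id_chart(1) unfolding smooth_lagrangian_def id_param_eq by blast
  from smooth_on_compose[OF fd(3) open_UNIV o(3) _ this w]
  have "smooth_on UNIV (\<lambda>p. L (jet2 G UNIV (?c e0 (fst p) (?w p)) 0))"
    using e0_range by simp
  then show ?thesis
  proof (rule smooth_on_cong[OF open_UNIV])
    fix p :: "'e \<times> 'e"
    obtain \<xi> u where p: "p = (\<xi>, u)" by (cases p)
    define w where "w = ?w p"
    let ?x = "\<lambda>t. e0 + t *\<^sub>R \<xi> + (t\<^sup>2 / 2) *\<^sub>R w"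
    let ?h = "\<lambda>t. id_param G (?x t)"
    let ?D = "?x -` id_range"
    have D: "open ?D" by (intro open_vimage open_range[OF id_chart(1)] continuous_intros) simp
    have D0: "0 \<in> ?D" using e0_range by simp
    have "smooth_on ?D ?x"
      by (intro smooth_intros smooth_on_linear_compose[OF bounded_linear_divide] D)
    from smooth_into_compose[OF fd(1) smooth_id_param D this]
    have s: "smooth_into (charts G) ?D ?h" by simp
    have rep: "represents UNIV ?h ?h ?D 0" using s D0 by (simp add: represents_def)
    have coord: "id_coord G (?h t) = ?x t" if "t \<in> ?D" for t using that id_coord_param by simp
    have d1: "fderiv (\<lambda>\<tau>. id_coord G (?h \<tau>)) t 1 = \<xi> + t *\<^sub>R w" if "t \<in> ?D" for t
    proof -
      have "(?x has_derivative (\<lambda>h. h *\<^sub>R \<xi> + (t * h) *\<^sub>R w)) (at t)"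
        by (auto intro!: derivative_eq_intros simp: power2_eq_square)
      then have "((\<lambda>\<tau>. id_coord G (?h \<tau>)) has_derivative (\<lambda>h. h *\<^sub>R \<xi> + (t * h) *\<^sub>R w)) (at t)"
        by (rule has_derivative_transform_within_open[OF _ D that]) (simp add: coord)
      then show ?thesis by (simp add: frechet_derivative_at[symmetric])
    qed
    have d2: "fderiv (\<lambda>\<tau>. fderiv (\<lambda>\<tau>. id_coord G (?h \<tau>)) \<tau> 1) 0 1 = w"
    proof -
      have "((\<lambda>t. \<xi> + t *\<^sub>R w) has_derivative (\<lambda>h. h *\<^sub>R w)) (at 0)"
        by (auto intro!: derivative_eq_intros)
      then have "((\<lambda>\<tau>. fderiv (\<lambda>\<tau>. id_coord G (?h \<tau>)) \<tau> 1) has_derivative (\<lambda>h. h *\<^sub>R w)) (at 0)"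
        by (rule has_derivative_transform_within_open[OF _ D D0]) (simp add: d1)
      then show ?thesis by (simp add: frechet_derivative_at[symmetric])
    qed
    have h0: "?h 0 = \<one>" "?h 0 \<in> U0" using id_chart(2) by simp_all
    note ch = log_accel_chart[OF s D0 id_chart(1) h0(2)]
    have V: "log_deriv ?h 0 1 = \<xi>" using ch(2) d1[OF D0] h0 by simp
    \<comment> \<open>Since \<open>chart_exp\<close> at \<open>e0\<close> is the identity, the
      second slot of the direction enters additively. Comparing the value of \<open>w\<close> by
      definition with its value along the curve therefore forces the acceleration to be
      \<open>u\<close>.\<close>
    have split: "fderiv ?J (e0, \<xi>) (\<xi>, b) = fderiv (\<lambda>x. ?J (x, \<xi>)) e0 \<xi> + b" for b
    proof -
      have "fderiv (\<lambda>w. ?J (e0, w)) \<xi> = (\<lambda>w. w)"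
        by (rule frechet_derivative_at[symmetric]) simp
      then show ?thesis using frechet_derivative_split[OF J, of e0 \<xi> \<xi> b] e0_range by simp
    qed
    have "w = fderiv ?J (e0, \<xi>) (\<xi>, log_accel ?h 0)"
      using ch(4) d1[OF D0] d2 h0 V by simp
    then have "log_accel ?h 0 = u" by (simp add: w_def p split)
    then show "L (jet2 G UNIV (?c e0 (fst p) (?w p)) 0) = reduced_lagrangian G L p"
      using lagrangian_reduced[OF L(2) rep] V by (simp add: p w_def)
  qed
qed

end

section \<open>Smooth functions on sets that need not be open\<close>

abbreviation smooth_curve :: "real \<Rightarrow> (real \<Rightarrow> 'b::real_normed_vector) \<Rightarrow> bool" where
  "smooth_curve a \<equiv> smooth_fun_on {0..a}"

lemma smooth_fun_on_joint:
  assumes "smooth_fun_on S f" "smooth_fun_on S g"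
  obtains D f' g' where "open D" "S \<subseteq> D" "smooth_on D f'" "smooth_on D g'"
    "\<And>x. x \<in> S \<Longrightarrow> f x = f' x" "\<And>x. x \<in> S \<Longrightarrow> g x = g' x"
proof -
  obtain D f' where f: "open D" "S \<subseteq> D" "smooth_on D f'" "\<forall>x\<in>S. f x = f' x"
    using assms(1) unfolding smooth_fun_on_def by blast
  obtain E g' where g: "open E" "S \<subseteq> E" "smooth_on E g'" "\<forall>x\<in>S. g x = g' x"
    using assms(2) unfolding smooth_fun_on_def by blast
  show thesis
    by (rule that[of "D \<inter> E" f' g']) (use f g in \<open>auto intro: smooth_on_subset\<close>)
qed

lemma smooth_fun_onI:
  "open D \<Longrightarrow> S \<subseteq> D \<Longrightarrow> smooth_on D h \<Longrightarrow> (\<And>x. x \<in> S \<Longrightarrow> f x = h x) \<Longrightarrow> smooth_fun_on S f"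
  unfolding smooth_fun_on_def by blast

lemma smooth_fun_on_smooth: "smooth_on UNIV f \<Longrightarrow> smooth_fun_on S f"
  by (rule smooth_fun_onI[of UNIV]) auto

lemma smooth_fun_on_continuous: "smooth_fun_on S f \<Longrightarrow> continuous_on S f"
  unfolding smooth_fun_on_def using smooth_on_continuous continuous_on_subset continuous_on_cong by metis

lemma smooth_fun_on_bilinear:
  assumes "bounded_bilinear p" "smooth_fun_on S f" "smooth_fun_on S g"
  shows "smooth_fun_on S (\<lambda>x. p (f x) (g x))"
proof -
  obtain D f' g' where "open D" "S \<subseteq> D" "smooth_on D f'" "smooth_on D g'"
    "\<And>x. x \<in> S \<Longrightarrow> f x = f' x" "\<And>x. x \<in> S \<Longrightarrow> g x = g' x"
    using smooth_fun_on_joint[OF assms(2,3)] by metis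
  then show ?thesis
    by (intro smooth_fun_onI[of D S "\<lambda>x. p (f' x) (g' x)"]) (auto intro: smooth_on_bilinear[OF assms(1)])
qed

lemma smooth_fun_on_Pair:
  assumes "smooth_fun_on S f" "smooth_fun_on S g"
  shows "smooth_fun_on S (\<lambda>x. (f x, g x))"
proof -
  obtain D f' g' where "open D" "S \<subseteq> D" "smooth_on D f'" "smooth_on D g'"
    "\<And>x. x \<in> S \<Longrightarrow> f x = f' x" "\<And>x. x \<in> S \<Longrightarrow> g x = g' x"
    using smooth_fun_on_joint[OF assms] by metis
  then show ?thesis
    by (intro smooth_fun_onI[of D S "\<lambda>x. (f' x, g' x)"]) (auto intro: smooth_on_Pair)
qed

lemma smooth_fun_on_add:
  assumes "smooth_fun_on S f" "smooth_fun_on S g"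
  shows "smooth_fun_on S (\<lambda>x. f x + g x)"
proof -
  obtain D f' g' where "open D" "S \<subseteq> D" "smooth_on D f'" "smooth_on D g'"
    "\<And>x. x \<in> S \<Longrightarrow> f x = f' x" "\<And>x. x \<in> S \<Longrightarrow> g x = g' x"
    using smooth_fun_on_joint[OF assms] by metis
  then show ?thesis
    by (intro smooth_fun_onI[of D S "\<lambda>x. f' x + g' x"]) (auto intro: smooth_on_add)
qed

lemma smooth_fun_on_linear:
  assumes "bounded_linear p" "smooth_fun_on S f"
  shows "smooth_fun_on S (\<lambda>x. p (f x))"
  using assms(2) smooth_on_linear_compose[OF assms(1)] unfolding smooth_fun_on_def by metis

text \<open>Away from \<open>S\<close> the extension of the inner function may leave the domain of
  the outer extension, so the open neighbourhood is cut down to a preimage.\<close>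

lemma smooth_fun_on_compose:
  fixes f :: "'b::real_inner \<Rightarrow> 'c::real_normed_vector"
  assumes fin: "finite_dim TYPE('b)" and f: "smooth_fun_on T f" and c: "smooth_fun_on S c"
    and sub: "\<And>x. x \<in> S \<Longrightarrow> c x \<in> T"
  shows "smooth_fun_on S (\<lambda>x. f (c x))"
proof -
  obtain E f' where E: "open E" "T \<subseteq> E" "smooth_on E f'" "\<forall>x\<in>T. f x = f' x"
    using f unfolding smooth_fun_on_def by blast
  obtain D c' where D: "open D" "S \<subseteq> D" "smooth_on D c'" "\<forall>x\<in>S. c x = c' x"
    using c unfolding smooth_fun_on_def by blast
  have o: "open (D \<inter> c' -` E)"
    using continuous_open_preimage[OF smooth_on_continuous[OF D(3)] D(1) E(1)] .
  have "smooth_on (D \<inter> c' -` E) (\<lambda>x. f' (c' x))"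
    by (rule smooth_on_compose[OF fin o E(1) _ E(3)]) (auto intro: smooth_on_subset[OF D(3)])
  then show ?thesis
    by (rule smooth_fun_onI[OF o, rotated]) (use D subsetD[OF E(2)] E(4) sub in auto)
qed

lemmas smooth_fun_on_const = smooth_fun_on_smooth[OF smooth_on_const]
lemmas smooth_fun_on_ident = smooth_fun_on_smooth[OF smooth_on_ident]

lemma smooth_fun_on_minus: "smooth_fun_on S f \<Longrightarrow> smooth_fun_on S (\<lambda>x. - f x)"
  by (rule smooth_fun_on_linear[OF bounded_linear_minus[OF bounded_linear_ident]])

lemma smooth_fun_on_diff: "smooth_fun_on S f \<Longrightarrow> smooth_fun_on S g \<Longrightarrow> smooth_fun_on S (\<lambda>x. f x - g x)"
  using smooth_fun_on_add[of S f "\<lambda>x. - g x"] smooth_fun_on_minus by auto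

lemma smooth_fun_on_sum:
  "(\<And>i. i \<in> I \<Longrightarrow> smooth_fun_on S (f i)) \<Longrightarrow> smooth_fun_on S (\<lambda>x. \<Sum>i\<in>I. f i x)"
  by (induction I rule: infinite_finite_induct) (auto intro: smooth_fun_on_const smooth_fun_on_add)

lemmas smooth_fun_intros = smooth_fun_on_const smooth_fun_on_ident smooth_fun_on_add smooth_fun_on_diff
  smooth_fun_on_minus smooth_fun_on_Pair
  smooth_fun_on_linear[OF bounded_linear_fst] smooth_fun_on_linear[OF bounded_linear_snd]
  smooth_fun_on_bilinear[OF bounded_bilinear_scaleR] smooth_fun_on_bilinear[OF bounded_bilinear_mult]
  smooth_fun_on_bilinear[OF bounded_bilinear_inner] smooth_fun_on_bilinear[OF bounded_bilinear_blinfun_apply]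

lemma smooth_fun_on_deriv_apply:
  fixes l :: "'b::real_inner \<Rightarrow> 'c::real_normed_vector"
  assumes "finite_dim TYPE('b)" "smooth_on UNIV l" "smooth_fun_on S p" "smooth_fun_on S d"
  shows "smooth_fun_on S (\<lambda>x. fderiv l (p x) (d x))"
proof -
  have "smooth_fun_on UNIV (\<lambda>r. fderiv l (fst r) (snd r))"
    using smooth_on_tangent_map[OF assms(1) open_UNIV assms(2)] by (intro smooth_fun_on_smooth) simp
  from smooth_fun_on_compose[OF finite_dim_prod[OF assms(1,1)] this smooth_fun_on_Pair[OF assms(3,4)]]
  show ?thesis by simp
qed

subsection \<open>Curves and families on a compact interval\<close>

abbreviation velocity :: "real \<Rightarrow> (real \<Rightarrow> 'b::real_normed_vector) \<Rightarrow> real \<Rightarrow> 'b" where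
  "velocity a c t \<equiv> vector_derivative c (at t within {0..a})"

lemma at_within_Icc_neq_bot: "a > 0 \<Longrightarrow> t \<in> {0..a} \<Longrightarrow> at t within {0..a::real} \<noteq> bot"
  using islimpt_Icc[of 0 a t] by (auto simp: trivial_limit_within)

lemma velocity_cong:
  assumes "t \<in> {0..a}" "\<And>\<tau>. \<tau> \<in> {0..a} \<Longrightarrow> c \<tau> = d \<tau>"
  shows "velocity a c t = velocity a d t"
proof -
  have "(c has_vector_derivative v) (at t within {0..a}) \<longleftrightarrow> (d has_vector_derivative v) (at t within {0..a})" for v
    using has_vector_derivative_transform[OF assms(1)] assms(2) by metis
  then show ?thesis by (simp add: vector_derivative_def)
qed

lemma velocityI:
  "a > 0 \<Longrightarrow> t \<in> {0..a} \<Longrightarrow> (c has_vector_derivative c') (at t within {0..a}) \<Longrightarrow> velocity a c t = c'"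
  using vector_derivative_within at_within_Icc_neq_bot by blast

lemma smooth_curve_velocity:
  assumes "a > 0" "smooth_curve a c"
  shows "smooth_curve a (velocity a c)"
    and "t \<in> {0..a} \<Longrightarrow> (c has_vector_derivative velocity a c t) (at t within {0..a})"
proof -
  obtain D h where D: "open D" "{0..a} \<subseteq> D" "smooth_on D h" "\<forall>x\<in>{0..a}. c x = h x"
    using assms(2) unfolding smooth_fun_on_def by blast
  have e: "(c has_vector_derivative fderiv h t 1) (at t within {0..a})"
    "velocity a c t = fderiv h t 1" if t: "t \<in> {0..a}" for t
  proof -
    have t': "t \<in> D" using D(2) t by blast
    note * = has_vector_derivative_extension[OF smooth_on_has_vector_derivative[OF D(3) t'] D(1) t' t at_within_Icc_neq_bot[OF assms(1) t]]
    show "(c has_vector_derivative fderiv h t 1) (at t within {0..a})"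
      by (rule *(1)) (use D in blast)
    show "velocity a c t = fderiv h t 1"
      by (rule *(2)) (use D in blast)
  qed
  show "smooth_curve a (velocity a c)"
    by (rule smooth_fun_onI[OF D(1,2) smooth_on_deriv[OF D(3), of 1]]) (use e in blast)
  show "t \<in> {0..a} \<Longrightarrow> (c has_vector_derivative velocity a c t) (at t within {0..a})"
    using e by simp
qed

abbreviation strip :: "real \<Rightarrow> real \<Rightarrow> (real \<times> real) set" where
  "strip e a \<equiv> {-e<..<e} \<times> {0..a}"

lemma finite_dim_plane: "finite_dim TYPE(real \<times> real)"
  by (intro finite_dim_intros)

lemma plane_slice_derivatives:
  assumes "smooth_on D F" "(s, t) \<in> D"
  shows "((\<lambda>s. F (s, t)) has_vector_derivative fderiv F (s, t) (1, 0)) (at s)"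
    and "((\<lambda>t. F (s, t)) has_vector_derivative fderiv F (s, t) (0, 1)) (at t)"
  using smooth_on_chain_vector[OF assms(1) _ has_vector_derivative_Pair[OF has_vector_derivative_id has_vector_derivative_const]]
    smooth_on_chain_vector[OF assms(1) _ has_vector_derivative_Pair[OF has_vector_derivative_const has_vector_derivative_id]]
    assms(2) by simp_all

lemma family_variation:
  fixes \<Gamma> :: "real \<Rightarrow> real \<Rightarrow> 'b::real_normed_vector"
  assumes "e > 0" "smooth_fun_on (strip e a) (\<lambda>(s, t). \<Gamma> s t)"
  obtains w where "smooth_curve a w"
    "\<And>t. t \<in> {0..a} \<Longrightarrow> ((\<lambda>s. \<Gamma> s t) has_vector_derivative w t) (at 0)"
proof -
  obtain D H where D: "open D" "strip e a \<subseteq> D" "smooth_on D H" "\<forall>x\<in>strip e a. (case x of (s, t) \<Rightarrow> \<Gamma> s t) = H x"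
    using assms(2) unfolding smooth_fun_on_def by blast
  let ?w = "\<lambda>t. fderiv H (0, t) (1, 0)"
  show thesis
  proof (rule that)
    have "smooth_fun_on D (\<lambda>p. fderiv H p (1, 0))"
      by (rule smooth_fun_onI[OF D(1) subset_refl smooth_on_deriv[OF D(3)]]) simp
    then show "smooth_curve a ?w"
      by (rule smooth_fun_on_compose[OF finite_dim_plane])
        (use D(2) assms(1) in \<open>auto intro!: smooth_fun_intros\<close>)
    show "((\<lambda>s. \<Gamma> s t) has_vector_derivative ?w t) (at 0)" if "t \<in> {0..a}" for t
      by (rule has_vector_derivative_transform_within_open[OF plane_slice_derivatives(1)[OF D(3)] open_greaterThanLessThan[of "-e" e]])
        (use D(2,4) assms(1) that in auto)
  qed
qed

text \<open>Variation and time derivative commute because the mixed partial derivatives of the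
  smooth extension do. The field \<open>w\<close> is given only pointwise on [0,a] and is first
  identified with the \<open>s\<close>-derivative of the extension.\<close>

lemma family_velocity:
  fixes \<Gamma> :: "real \<Rightarrow> real \<Rightarrow> 'b::real_inner"
  assumes "e > 0" "a > 0" "smooth_fun_on (strip e a) (\<lambda>(s, t). \<Gamma> s t)"
    and w: "\<And>t. t \<in> {0..a} \<Longrightarrow> ((\<lambda>s. \<Gamma> s t) has_vector_derivative w t) (at 0)"
  shows "smooth_fun_on (strip e a) (\<lambda>(s, t). velocity a (\<Gamma> s) t)"
    and "t \<in> {0..a} \<Longrightarrow> ((\<lambda>s. velocity a (\<Gamma> s) t) has_vector_derivative velocity a w t) (at 0)"
proof -
  obtain D H where D: "open D" "strip e a \<subseteq> D" "smooth_on D H" "\<forall>x\<in>strip e a. (case x of (s, t) \<Rightarrow> \<Gamma> s t) = H x"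
    using assms(3) unfolding smooth_fun_on_def by blast
  have inD: "(s, t) \<in> D" and eq: "\<Gamma> s t = H (s, t)" if "s \<in> {-e<..<e}" "t \<in> {0..a}" for s t
    using D(2,4) that by auto
  let ?Ht = "\<lambda>p. fderiv H p (0, 1)" and ?Hs = "\<lambda>p. fderiv H p (1, 0)"
  have sl: "open {t. (s, t) \<in> D}" for s
    using open_vimage[OF D(1), of "\<lambda>t. (s, t)"] by (simp add: vimage_def continuous_intros)
  have vel: "velocity a (\<Gamma> s) t = ?Ht (s, t)" if "s \<in> {-e<..<e}" "t \<in> {0..a}" for s t
    by (rule has_vector_derivative_extension(2)[OF plane_slice_derivatives(2)[OF D(3) inD[OF that]] sl _ that(2)])
      (use inD eq that at_within_Icc_neq_bot[OF assms(2)] in auto)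
  show "smooth_fun_on (strip e a) (\<lambda>(s, t). velocity a (\<Gamma> s) t)"
    by (rule smooth_fun_onI[OF D(1,2) smooth_on_deriv[OF D(3), of "(0, 1)"]]) (use vel in auto)
  have w_eq: "w t = ?Hs (0, t)" if "t \<in> {0..a}" for t
  proof -
    have "((\<lambda>s. \<Gamma> s t) has_vector_derivative ?Hs (0, t)) (at 0)"
      by (rule has_vector_derivative_transform_within_open[OF plane_slice_derivatives(1)[OF D(3)] open_greaterThanLessThan[of "-e" e]])
        (use inD eq assms(1) that in auto)
    then show ?thesis using w[OF that] vector_derivative_unique_at by blast
  qed
  assume t: "t \<in> {0..a}"
  have 0: "(0, t) \<in> D" using inD t assms(1) by auto
  have "velocity a w t = fderiv ?Hs (0, t) (0, 1)"
    by (rule has_vector_derivative_extension(2)[OF plane_slice_derivatives(2)[OF smooth_on_deriv[OF D(3)] 0] sl _ t])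
      (use 0 t w_eq at_within_Icc_neq_bot[OF assms(2)] in auto)
  also have "\<dots> = fderiv ?Ht (0, t) (1, 0)"
    by (rule mixed_partials[OF D(1,3) 0])
  finally have eq_w: "velocity a w t = fderiv ?Ht (0, t) (1, 0)" .
  show "((\<lambda>s. velocity a (\<Gamma> s) t) has_vector_derivative velocity a w t) (at 0)"
    unfolding eq_w
    by (rule has_vector_derivative_transform_within_open[OF plane_slice_derivatives(1)[OF smooth_on_deriv[OF D(3)] 0]
          open_greaterThanLessThan[of "-e" e]])
      (use vel assms(1) t in auto)
qed

text \<open>Differentiation under the integral needs an \<open>s\<close>-derivative that is
  continuous on the whole strip; the extension supplies it, and uniqueness identifies it at
  \<open>s = 0\<close> with the prescribed \<open>F'\<close>.\<close>

lemma leibniz_strip: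
  assumes "e > 0" "smooth_fun_on (strip e a) (\<lambda>(s, t). F s t)"
    and F': "\<And>t. t \<in> {0..a} \<Longrightarrow> ((\<lambda>s. F s t) has_real_derivative F' t) (at 0)"
  shows "((\<lambda>s. integral {0..a} (F s)) has_real_derivative integral {0..a} F') (at 0)"
proof -
  obtain D H where D: "open D" "strip e a \<subseteq> D" "smooth_on D H" "\<forall>x\<in>strip e a. (case x of (s, t) \<Rightarrow> F s t) = H x"
    using assms(2) unfolding smooth_fun_on_def by blast
  have inD: "(s, t) \<in> D" and eq: "F s t = H (s, t)" if "s \<in> {-e<..<e}" "t \<in> {0..a}" for s t
    using D(2,4) that by auto
  let ?Hs = "\<lambda>s t. fderiv H (s, t) (1, 0)"
  have d: "((\<lambda>s. F s t) has_real_derivative ?Hs s t) (at s)" if "s \<in> {-e<..<e}" "t \<in> {0..a}" for s t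
    unfolding has_real_derivative_iff_has_vector_derivative
    by (rule has_vector_derivative_transform_within_open[OF plane_slice_derivatives(1)[OF D(3)] open_greaterThanLessThan[of "-e" e]])
      (use inD eq that in auto)
  have "((\<lambda>s. integral (cbox 0 a) (F s)) has_field_derivative integral (cbox 0 a) (?Hs 0)) (at 0 within {-e<..<e})"
  proof (rule leibniz_rule_field_derivative[where f = F and fx = ?Hs])
    show "((\<lambda>s. F s t) has_real_derivative ?Hs s t) (at s within {-e<..<e})"
      if "s \<in> {-e<..<e}" "t \<in> cbox 0 a" for s t
      using d[of s t] that by (simp add: has_field_derivative_at_within)
    show "F s integrable_on cbox 0 a" if "s \<in> {-e<..<e}" for s
    proof (rule integrable_continuous)
      have "continuous_on {0..a} (\<lambda>t. H (s, t))"
        by (rule continuous_on_compose2[OF smooth_on_continuous[OF D(3)]]) (use inD that in \<open>auto intro!: continuous_intros\<close>)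
      then show "continuous_on (cbox 0 a) (F s)"
        using eq[OF that] continuous_on_cong[OF refl, of "{0..a}" "F s" "\<lambda>t. H (s, t)"] by simp
    qed
    show "continuous_on ({-e<..<e} \<times> cbox 0 a) (\<lambda>(s, t). ?Hs s t)"
      using continuous_on_subset[OF smooth_on_continuous[OF smooth_on_deriv[OF D(3), of "(1, 0)"]] D(2)]
      by (simp add: case_prod_beta)
  qed (use assms(1) in auto)
  then have "((\<lambda>s. integral {0..a} (F s)) has_real_derivative integral {0..a} (?Hs 0)) (at 0)"
    using assms(1) by (simp add: at_within_open[of 0 "{-e<..<e}"])
  moreover have "integral {0..a} (?Hs 0) = integral {0..a} F'"
    using d[of 0] F' assms(1) by (intro integral_cong) (auto intro: DERIV_unique)
  ultimately show ?thesis by simp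
qed

text \<open>A continuous nonnegative integrand with vanishing integral is zero, so \<open>h\<close>
  vanishes wherever \<open>p\<close> is positive. At the end points, where \<open>p\<close> is zero,
  continuity of \<open>h\<close> finishes.\<close>

lemma weighted_square_integral_zero:
  fixes h :: "real \<Rightarrow> real"
  assumes "a > 0" "continuous_on {0..a} h" "continuous_on {0..a} p"
    and p: "\<And>t. t \<in> {0<..<a} \<Longrightarrow> p t > 0" "p 0 = 0" "p a = 0"
    and zero: "integral {0..a} (\<lambda>t. p t * h t * h t) = 0" and t: "t \<in> {0..a}"
  shows "h t = 0"
proof -
  let ?f = "\<lambda>t. p t * h t * h t"
  have c: "continuous_on {0..a} ?f" using assms(2,3) by (intro continuous_intros)
  have nonneg: "p t \<ge> 0" if "t \<in> {0..a}" for t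
    using p that by (cases "t = 0 \<or> t = a") (auto simp: less_le)
  have "(?f has_integral 0) (cbox 0 a)"
    using integrable_integral[OF integrable_continuous_real[OF c]] zero by simp
  then have f0: "?f t = 0" if "t \<in> {0..a}" for t
    using has_integral_0_cbox_imp_0[of 0 a ?f t] c nonneg assms(1) that by (simp add: mult.assoc)
  have "h t = 0" if "t \<in> {0<..<a}" for t
    using f0[of t] p(1)[OF that] that by simp
  then show ?thesis
    using continuous_constant_on_closure[of "{0<..<a}" h 0 t] assms(1,2) t by simp
qed

subsection \<open>Families of curves in the group\<close>

context lie_group
begin

lemma smooth_fun_on_ad:
  assumes "smooth_fun_on S v" "smooth_fun_on S \<eta>"
  shows "smooth_fun_on S (\<lambda>x. ad G (v x) (\<eta> x))"
proof -
  obtain D f' g' where "open D" "S \<subseteq> D" "smooth_on D f'" "smooth_on D g'"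
    "\<And>x. x \<in> S \<Longrightarrow> v x = f' x" "\<And>x. x \<in> S \<Longrightarrow> \<eta> x = g' x"
    using smooth_fun_on_joint[OF assms] by metis
  then show ?thesis
    by (intro smooth_fun_onI[of D S "\<lambda>x. ad G (f' x) (g' x)"]) (auto intro: smooth_on_ad)
qed

definition covariant_velocity :: "real \<Rightarrow> (real \<Rightarrow> 'e) \<Rightarrow> (real \<Rightarrow> 'e) \<Rightarrow> real \<Rightarrow> 'e" where
  "covariant_velocity a v \<eta> t = velocity a \<eta> t + ad G (v t) (\<eta> t)"

lemma smooth_covariant_velocity:
  "a > 0 \<Longrightarrow> smooth_curve a v \<Longrightarrow> smooth_curve a \<eta> \<Longrightarrow> smooth_curve a (covariant_velocity a v \<eta>)"
  unfolding covariant_velocity_def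
  by (intro smooth_fun_on_add smooth_fun_on_ad smooth_curve_velocity(1))

lemma left_velocity_cong:
  assumes "t \<in> {0..a}" "\<And>\<tau>. \<tau> \<in> {0..a} \<Longrightarrow> c \<tau> = d \<tau>"
  shows "left_velocity G {0..a} c t = left_velocity G {0..a} d t"
  unfolding left_velocity_def using assms by (intro velocity_cong) auto

lemma smooth_curve_represented:
  assumes "a > 0" "smooth_map_on (charts G) {0..a} g"
  obtains h D where "\<And>t. t \<in> {0..a} \<Longrightarrow> represents {0..a} g h D t"
  using assms at_within_Icc_neq_bot unfolding smooth_map_on_def represents_def by blast

lemma smooth_left_velocity:
  assumes "a > 0" "smooth_map_on (charts G) {0..a} g"
  shows "smooth_curve a (left_velocity G {0..a} g)"
proof -
  obtain h D where r: "\<And>t. t \<in> {0..a} \<Longrightarrow> represents {0..a} g h D t"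
    using smooth_curve_represented[OF assms] by metis
  have "smooth_into (charts G) D h" "{0..a} \<subseteq> D"
    using representsD(1)[OF r[of 0]] representsD(2)[OF r] assms(1) by auto
  then show ?thesis
    using left_velocity_eq[OF r] smooth_on_log_deriv smooth_intoD(1)
    by (intro smooth_fun_onI[of D _ "\<lambda>t. log_deriv h t 1"]) auto
qed

text \<open>\<open>\<eta>\<close> is the left-trivialised variation field of the family. It is
  expressed through \<open>\<Gamma>\<close> itself rather than an extension, so it is unique on
  [0,a], while its smoothness has to be recorded separately.\<close>

definition generates :: "real \<Rightarrow> (real \<Rightarrow> 'g) \<Rightarrow> (real \<Rightarrow> real \<Rightarrow> 'g) \<Rightarrow> (real \<Rightarrow> 'e) \<Rightarrow> bool" where
  "generates a g \<Gamma> \<eta> \<longleftrightarrow> smooth_curve a \<eta> \<and>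
     (\<forall>t\<in>{0..a}. ((\<lambda>s. id_coord G (inv (g t) \<otimes> \<Gamma> s t)) has_vector_derivative \<eta> t) (at 0))"

lemma generates_unique:
  "generates a g \<Gamma> \<eta> \<Longrightarrow> generates a g \<Gamma> \<eta>' \<Longrightarrow> t \<in> {0..a} \<Longrightarrow> \<eta> t = \<eta>' t"
  unfolding generates_def using vector_derivative_unique_at by blast

context
  fixes a e g \<Gamma> D h
  assumes a: "a > 0" and e: "e > 0" and D: "strip e a \<subseteq> D" and h: "smooth_into (charts G) D h"
    and \<Gamma>: "\<And>s t. s \<in> {-e<..<e} \<Longrightarrow> t \<in> {0..a} \<Longrightarrow> \<Gamma> s t = h (s, t)"
    and \<Gamma>0: "\<And>t. t \<in> {0..a} \<Longrightarrow> \<Gamma> 0 t = g t"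
begin

private lemma inD: "s \<in> {-e<..<e} \<Longrightarrow> t \<in> {0..a} \<Longrightarrow> (s, t) \<in> D"
  using D by auto

private lemma slice_open: "open {t. (s, t) \<in> D}"
  using open_vimage[OF smooth_intoD(1)[OF h], of "\<lambda>t. (s, t)"] by (simp add: vimage_def continuous_intros)

lemma family_slice:
  assumes s: "s \<in> {-e<..<e}" and t: "t \<in> {0..a}"
  shows "represents {0..a} (\<Gamma> s) (\<lambda>t. h (s, t)) {t. (s, t) \<in> D} t"
    and "left_velocity G {0..a} (\<Gamma> s) t = log_deriv h (s, t) (0, 1)"
proof -
  have sm: "smooth_on {t. (s, t) \<in> D} (\<lambda>t. (s, t))"
    by (intro smooth_intros slice_open)
  have "smooth_into (charts G) {t. (s, t) \<in> D} (\<lambda>t. h (s, t))"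
    by (rule smooth_into_compose[OF finite_dim_plane h slice_open sm]) simp
  then show r: "represents {0..a} (\<Gamma> s) (\<lambda>t. h (s, t)) {t. (s, t) \<in> D} t"
    using inD[OF s] t \<Gamma>[OF s] at_within_Icc_neq_bot[OF a] by (auto simp: represents_def)
  have "((\<lambda>t. (s, t)) has_derivative (\<lambda>x. (0, x))) (at t)"
    by (intro has_derivative_Pair has_derivative_const has_derivative_ident)
  from log_deriv_compose[OF h this inD[OF s t]] left_velocity_eq[OF r]
  show "left_velocity G {0..a} (\<Gamma> s) t = log_deriv h (s, t) (0, 1)" by simp
qed

lemma family_left_velocity_smooth:
  "smooth_fun_on (strip e a) (\<lambda>(s, t). left_velocity G {0..a} (\<Gamma> s) t)"
  by (rule smooth_fun_onI[OF smooth_intoD(1)[OF h] D smooth_on_log_deriv[OF h, of "(0, 1)"]])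
    (use family_slice(2) in auto)

lemma family_lagrangian:
  assumes "left_invariant G L" "s \<in> {-e<..<e}" "t \<in> {0..a}"
  shows "L (jet2 G {0..a} (\<Gamma> s) t) = reduced_lagrangian G L
    (left_velocity G {0..a} (\<Gamma> s) t, velocity a (left_velocity G {0..a} (\<Gamma> s)) t)"
proof -
  note r = family_slice(1)[OF assms(2,3)]
  show ?thesis
    using lagrangian_reduced[OF assms(1) r] left_velocity_eq[OF r] velocity_left_velocity_eq[OF r]
    by simp
qed

lemma family_generator: "generates a g \<Gamma> (\<lambda>t. log_deriv h (0, t) (1, 0))"
  unfolding generates_def
proof (intro conjI ballI)
  have "smooth_fun_on D (\<lambda>p. log_deriv h p (1, 0))"
    by (rule smooth_fun_onI[OF smooth_intoD(1)[OF h] subset_refl smooth_on_log_deriv[OF h]]) simp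
  then show "smooth_curve a (\<lambda>t. log_deriv h (0, t) (1, 0))"
    by (rule smooth_fun_on_compose[OF finite_dim_plane]) (use inD e in \<open>auto intro!: smooth_fun_intros\<close>)
  fix t assume t: "t \<in> {0..a}"
  have 0: "(0, t) \<in> D" using inD[OF _ t] e by simp
  have "((\<lambda>s. (s, t)) has_derivative (\<lambda>x. (x, 0))) (at 0)"
    by (intro has_derivative_Pair has_derivative_const has_derivative_ident)
  from has_derivative_compose[OF this has_derivative_log_deriv[OF h 0]]
  have d: "((\<lambda>s. id_coord G (inv (h (0, t)) \<otimes> h (s, t))) has_derivative (\<lambda>x. log_deriv h (0, t) (x, 0))) (at 0)" .
  have "log_deriv h (0, t) (x, 0) = x *\<^sub>R log_deriv h (0, t) (1, 0)" for x
    using linear_scale[OF linear_log_deriv[OF h 0], of x "(1, 0)"] by simp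
  then have l: "(\<lambda>x. log_deriv h (0, t) (x, 0)) = (\<lambda>x. x *\<^sub>R log_deriv h (0, t) (1, 0))" by (rule ext)
  have "((\<lambda>s. id_coord G (inv (h (0, t)) \<otimes> h (s, t))) has_vector_derivative log_deriv h (0, t) (1, 0)) (at 0)"
    unfolding has_vector_derivative_def using d unfolding l .
  then show "((\<lambda>s. id_coord G (inv (g t) \<otimes> \<Gamma> s t)) has_vector_derivative log_deriv h (0, t) (1, 0)) (at 0)"
    by (rule has_vector_derivative_transform_within_open[OF _ open_greaterThanLessThan[of "-e" e]])
      (use \<Gamma> \<Gamma>0[OF t, symmetric] t e in auto)
qed

context
  fixes \<eta> assumes \<eta>: "generates a g \<Gamma> \<eta>"
begin

private lemma generator_eq: "t \<in> {0..a} \<Longrightarrow> \<eta> t = log_deriv h (0, t) (1, 0)"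
  using generates_unique[OF \<eta> family_generator] .

text \<open>This is the Maurer--Cartan identity for the extension \<open>h\<close> at
  \<open>(0, t)\<close>; its terms are then read back as derivatives within [0,a], which covers the
  end points as well.\<close>

lemma family_left_velocity_derivative:
  assumes t: "t \<in> {0..a}"
  shows "((\<lambda>s. left_velocity G {0..a} (\<Gamma> s) t) has_vector_derivative
    covariant_velocity a (left_velocity G {0..a} g) \<eta> t) (at 0)"
proof -
  have 0: "(0, t) \<in> D" using inD[OF _ t] e by simp
  let ?V = "\<lambda>q. log_deriv h q (0, 1)" and ?H = "\<lambda>q. log_deriv h q (1, 0)"
  have "left_velocity G {0..a} g t = ?V (0, t)"
    using left_velocity_cong[OF t, of g "\<Gamma> 0"] \<Gamma>0 family_slice(2)[OF _ t, of 0] e by simp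
  moreover have "velocity a \<eta> t = fderiv ?H (0, t) (0, 1)"
    by (rule has_vector_derivative_extension(2)[OF plane_slice_derivatives(2)[OF smooth_on_log_deriv[OF h] 0] slice_open _ t])
      (use 0 generator_eq at_within_Icc_neq_bot[OF a t] in auto)
  ultimately have "covariant_velocity a (left_velocity G {0..a} g) \<eta> t = fderiv ?V (0, t) (1, 0)"
    using maurer_cartan[OF h 0] generator_eq[OF t] by (simp add: covariant_velocity_def)
  moreover have "((\<lambda>s. left_velocity G {0..a} (\<Gamma> s) t) has_vector_derivative fderiv ?V (0, t) (1, 0)) (at 0)"
    by (rule has_vector_derivative_transform_within_open[OF plane_slice_derivatives(1)[OF smooth_on_log_deriv[OF h] 0]
          open_greaterThanLessThan[of "-e" e]])
      (use family_slice(2) t e in auto)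
  ultimately show ?thesis by simp
qed

context
  fixes t U \<phi>
  assumes t: "t \<in> {0..a}" and c: "(U, \<phi>) \<in> charts G" "h (0, t) \<in> U"
begin

private lemma chart_nhd: "open {s. (s, t) \<in> D \<and> h (s, t) \<in> U}" "0 \<in> {s. (s, t) \<in> D \<and> h (s, t) \<in> U}"
proof -
  show "0 \<in> {s. (s, t) \<in> D \<and> h (s, t) \<in> U}" using inD[OF _ t] e c by simp
  show "open {s. (s, t) \<in> D \<and> h (s, t) \<in> U}"
    using open_vimage[OF smooth_intoD(3)[OF h c(1)], of "\<lambda>s. (s, t)"] by (simp add: vimage_def continuous_intros)
qed

text \<open>The second claim holds because both trivialisations are linear and
  \<open>chart_log\<close> recovers \<open>\<eta> t\<close> from the coordinate derivative.\<close>

private lemma chart_value_derivative: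
  "((\<lambda>s. \<phi> (h (s, t))) has_vector_derivative chart_exp U \<phi> (\<phi> (h (0, t))) (\<eta> t)) (at 0)"
  "chart_exp U \<phi> (\<phi> (h (0, t))) (\<eta> t) = 0 \<longleftrightarrow> \<eta> t = 0"
proof -
  have 0: "(0, t) \<in> D" using inD[OF _ t] e by simp
  note l = log_deriv_eq_chart_log(1)[OF c(1) h 0 c(2)] chart_derivative_eq_chart_exp[OF c(1) h 0 c(2)]
  have p: "(0, t) \<in> {q \<in> D. h q \<in> U}" using 0 c(2) by simp
  show "((\<lambda>s. \<phi> (h (s, t))) has_vector_derivative chart_exp U \<phi> (\<phi> (h (0, t))) (\<eta> t)) (at 0)"
    using plane_slice_derivatives(1)[OF smooth_intoD(4)[OF h c(1)] p] l(2)[of "(1, 0)"] generator_eq[OF t] by simp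
  have "chart_log U \<phi> (\<phi> (h (0, t))) 0 = 0" "chart_exp U \<phi> (\<phi> (h (0, t))) 0 = 0"
    using linear_0 linear_chart_log[OF c(1)] linear_chart_exp[OF c(1)] c(2) by blast+
  then show "chart_exp U \<phi> (\<phi> (h (0, t))) (\<eta> t) = 0 \<longleftrightarrow> \<eta> t = 0"
    using l[of "(1, 0)"] generator_eq[OF t] by auto
qed

lemma fixes_value_chart:
  "((\<lambda>s. \<phi> (\<Gamma> s t)) has_vector_derivative 0) (at 0) \<longleftrightarrow> \<eta> t = 0"
proof -
  have "((\<lambda>s. \<phi> (\<Gamma> s t)) has_vector_derivative chart_exp U \<phi> (\<phi> (h (0, t))) (\<eta> t)) (at 0)"
    by (rule has_vector_derivative_transform_within_open[OF chart_value_derivative(1) open_greaterThanLessThan[of "-e" e]])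
      (use \<Gamma> t e in auto)
  then show ?thesis using chart_value_derivative(2) vector_derivative_unique_at by metis
qed

text \<open>When \<open>\<eta> t = 0\<close>, the base point has zero \<open>s\<close>-derivative in
  the chart and the \<open>ad\<close> term drops out, so the left velocity varies by
  \<open>\<eta>'\<close> alone. Chart velocity and left velocity are exchanged by
  \<open>chart_log\<close> and \<open>chart_exp\<close>; with a stationary base point the chain rule
  sends a zero variation of either one to a zero variation of the other.\<close>

lemma fixes_velocity_chart:
  assumes "\<eta> t = 0"
  shows "((\<lambda>s. vector_derivative (\<phi> \<circ> \<Gamma> s) (at t within {0..a})) has_vector_derivative 0) (at 0)
    \<longleftrightarrow> velocity a \<eta> t = 0"
proof -
  let ?X = "\<lambda>s. fderiv (\<lambda>q. \<phi> (h q)) (s, t) (0, 1)"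
  let ?V = "\<lambda>s. left_velocity G {0..a} (\<Gamma> s) t"
  let ?N = "{s. (s, t) \<in> D \<and> h (s, t) \<in> U} \<inter> {-e<..<e}"
  have N: "open ?N" "0 \<in> ?N" using chart_nhd e by auto
  have X: "vector_derivative (\<phi> \<circ> \<Gamma> s) (at t within {0..a}) = ?X s"
    "?V s = chart_log U \<phi> (\<phi> (h (s, t))) (?X s)" "?X s = chart_exp U \<phi> (\<phi> (h (s, t))) (?V s)"
    if "s \<in> ?N" for s
  proof -
    have s: "s \<in> {-e<..<e}" "h (s, t) \<in> U" using that by auto
    note r = family_slice(1)[OF s(1) t]
    have p: "(s, t) \<in> {q \<in> D. h q \<in> U}" using s inD[OF s(1) t] by simp
    have "fst (snd (jet_coords \<phi> {0..a} (\<Gamma> s) t)) = fderiv (\<lambda>t. \<phi> (h (s, t))) t 1"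
      using jet_coords_eq[OF r c(1) s(2)] by simp
    also have "\<dots> = ?X s"
    proof -
      have "((\<lambda>t. (s, t)) has_derivative (\<lambda>x. (0, x))) (at t)"
        by (intro has_derivative_Pair has_derivative_const has_derivative_ident)
      from has_derivative_compose[OF this smooth_on_has_derivative[OF smooth_intoD(4)[OF h c(1)] p]]
      show ?thesis by (simp add: frechet_derivative_at[symmetric])
    qed
    finally show "vector_derivative (\<phi> \<circ> \<Gamma> s) (at t within {0..a}) = ?X s" by (simp add: jet_coords_def)
    show "?V s = chart_log U \<phi> (\<phi> (h (s, t))) (?X s)" "?X s = chart_exp U \<phi> (\<phi> (h (s, t))) (?V s)"
      using log_deriv_eq_chart_log(1)[OF c(1) h] chart_derivative_eq_chart_exp[OF c(1) h] p family_slice(2)[OF s(1) t]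
      by simp_all
  qed
  have d\<phi>: "((\<lambda>s. \<phi> (h (s, t))) has_vector_derivative 0) (at 0)"
    using chart_value_derivative assms by simp
  have dV: "(?V has_vector_derivative velocity a \<eta> t) (at 0)"
    using family_left_velocity_derivative[OF t] assms by (simp add: covariant_velocity_def)
  have zero: "fderiv F p (0, 0) = 0" if "smooth_on (\<phi> ` U \<times> UNIV) F" "p \<in> \<phi> ` U \<times> UNIV"
    for F :: "'e \<times> 'e \<Rightarrow> 'e" and p
    using linear_0[OF smooth_on_linear_deriv[OF that]] by (simp add: zero_prod_def)
  have m: "(\<phi> (h (0, t)), w) \<in> \<phi> ` U \<times> UNIV" for w :: 'e using c(2) by simp
  show ?thesis
  proof
    assume "((\<lambda>s. vector_derivative (\<phi> \<circ> \<Gamma> s) (at t within {0..a})) has_vector_derivative 0) (at 0)"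
    then have "(?X has_vector_derivative 0) (at 0)"
      by (rule has_vector_derivative_transform_within_open[OF _ N]) (simp only: X(1))
    from smooth_on_chain_vector[OF smooth_chart_log[OF c(1)] m has_vector_derivative_Pair[OF d\<phi> this]]
    have "((\<lambda>s. chart_log U \<phi> (\<phi> (h (s, t))) (?X s)) has_vector_derivative 0) (at 0)"
      using zero[OF smooth_chart_log[OF c(1)] m] by simp
    then have "(?V has_vector_derivative 0) (at 0)"
      by (rule has_vector_derivative_transform_within_open[OF _ N]) (simp only: X(2)[symmetric])
    then show "velocity a \<eta> t = 0" using dV vector_derivative_unique_at by blast
  next
    assume "velocity a \<eta> t = 0"
    with dV have "(?V has_vector_derivative 0) (at 0)" by simp
    from smooth_on_chain_vector[OF smooth_chart_exp[OF c(1)] m has_vector_derivative_Pair[OF d\<phi> this]]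
    have "((\<lambda>s. chart_exp U \<phi> (\<phi> (h (s, t))) (?V s)) has_vector_derivative 0) (at 0)"
      using zero[OF smooth_chart_exp[OF c(1)] m] by simp
    then show "((\<lambda>s. vector_derivative (\<phi> \<circ> \<Gamma> s) (at t within {0..a})) has_vector_derivative 0) (at 0)"
      by (rule has_vector_derivative_transform_within_open[OF _ N]) (simp only: X(1) X(3)[symmetric])
  qed
qed

end

lemma fixes_value_iff:
  assumes t: "t \<in> {0..a}"
  shows "fixes_value G \<Gamma> t \<longleftrightarrow> \<eta> t = 0"
proof -
  have "\<Gamma> 0 t = h (0, t)" "h (0, t) \<in> carrier G"
    using \<Gamma>[OF _ t] inD[OF _ t] e smooth_into_carrier[OF h] by auto
  then show ?thesis
    using fixes_value_chart[OF t] carrier_charts[of "h (0, t)"] unfolding fixes_value_def by fastforce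
qed

lemma fixes_velocity_iff:
  assumes t: "t \<in> {0..a}" and "\<eta> t = 0"
  shows "fixes_velocity G a \<Gamma> t \<longleftrightarrow> velocity a \<eta> t = 0"
proof -
  have "\<Gamma> 0 t = h (0, t)" "h (0, t) \<in> carrier G"
    using \<Gamma>[OF _ t] inD[OF _ t] e smooth_into_carrier[OF h] by auto
  then show ?thesis
    using fixes_velocity_chart[OF t _ _ assms(2)] carrier_charts[of "h (0, t)"] unfolding fixes_velocity_def by fastforce
qed

end

end

lemma group_family_extension:
  assumes "\<Gamma> \<in> group_families G a g"
  obtains e D h where "e > 0" "strip e a \<subseteq> D" "smooth_into (charts G) D h"
    "\<And>s t. s \<in> {-e<..<e} \<Longrightarrow> t \<in> {0..a} \<Longrightarrow> \<Gamma> s t = h (s, t)"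
    "\<And>t. t \<in> {0..a} \<Longrightarrow> \<Gamma> 0 t = g t"
  using assms unfolding group_families_def smooth_map_on_def by fastforce

lemma group_family_exists:
  assumes "a > 0" "smooth_map_on (charts G) {0..a} g" "smooth_curve a \<eta>"
  obtains \<Gamma> where "\<Gamma> \<in> group_families G a g" "generates a g \<Gamma> \<eta>"
proof -
  let ?\<Gamma> = "\<lambda>s t. g t \<otimes> id_param G (e0 + s *\<^sub>R \<eta> t)"
  obtain D1 k where k: "{0..a} \<subseteq> D1" "smooth_into (charts G) D1 k" "\<And>t. t \<in> {0..a} \<Longrightarrow> g t = k t"
    using assms(2) unfolding smooth_map_on_def by blast
  obtain D2 f where f: "open D2" "{0..a} \<subseteq> D2" "smooth_on D2 f" "\<And>t. t \<in> {0..a} \<Longrightarrow> \<eta> t = f t"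
    using assms(3) unfolding smooth_fun_on_def by blast
  let ?c = "\<lambda>p::real \<times> real. e0 + fst p *\<^sub>R f (snd p)"
  let ?P = "(UNIV :: real set) \<times> (D1 \<inter> D2)"
  have P: "open ?P" using f(1) smooth_intoD(1)[OF k(2)] by (simp add: open_Times open_Int)
  have snd: "smooth_on E (\<lambda>p::real \<times> real. snd p)" if "open E" for E
    using that by (intro smooth_intros)
  have c: "smooth_on ?P ?c"
    by (intro smooth_intros P smooth_on_compose[OF finite_dim_real P f(1) _ f(3) snd[OF P]]) auto
  let ?D = "?P \<inter> ?c -` id_range"
  have D: "open ?D"
    using continuous_open_preimage[OF smooth_on_continuous[OF c] P open_range[OF id_chart(1)]] .
  have sm: "smooth_into (charts G) ?D (\<lambda>p. k (snd p) \<otimes> id_param G (?c p))"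
    by (intro smooth_into_mult smooth_into_compose[OF finite_dim_real k(2) D snd[OF D]]
        smooth_into_compose[OF fd(1) smooth_id_param D smooth_on_subset[OF c]]) auto
  have "{0} \<times> {0..a} \<subseteq> ?D" using k(1) f(2) e0_range by auto
  \<comment> \<open>Compactness of [0,a] yields one range of \<open>s\<close> for which
    \<open>e0 + s *\<^sub>R \<eta> t\<close> stays in the chart range for every
    \<open>t\<close>.\<close>
  from Elementary_Topology.tube_lemma[OF compact_Icc D this]
  obtain X where X: "0 \<in> X" "open X" "X \<times> {0..a} \<subseteq> ?D" by blast
  obtain e where e: "e > 0" "ball 0 e \<subseteq> X" using X openE by blast
  have strip: "strip e a \<subseteq> ?D"
    using e(2) X(3) unfolding ball_eq_greaterThanLessThan by auto
  have g: "g t \<in> carrier G" if "t \<in> {0..a}" for t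
    using that k smooth_into_carrier[OF k(2)] by auto
  have "?\<Gamma> \<in> group_families G a g"
  proof -
    have "smooth_map_on (charts G) (strip e a) (\<lambda>(s, t). ?\<Gamma> s t)"
      unfolding smooth_map_on_def
      by (intro exI[of _ ?D] exI[of _ "\<lambda>p. k (snd p) \<otimes> id_param G (?c p)"] conjI strip sm)
        (use k(3) f(4) in auto)
    then show ?thesis using e(1) g by (auto simp: group_families_def)
  qed
  moreover have "generates a g ?\<Gamma> \<eta>"
    unfolding generates_def
  proof (intro conjI ballI assms(3))
    fix t assume t: "t \<in> {0..a}"
    have "((\<lambda>s. e0 + s *\<^sub>R \<eta> t) has_vector_derivative \<eta> t) (at 0)"
      by (auto intro!: derivative_eq_intros)
    then show "((\<lambda>s. id_coord G (inv (g t) \<otimes> ?\<Gamma> s t)) has_vector_derivative \<eta> t) (at 0)"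
    proof (rule has_vector_derivative_transform_within_open[OF _ open_greaterThanLessThan[of "-e" e]])
      fix s assume "s \<in> {-e<..<e}"
      then have "(s, t) \<in> ?D" using strip t by blast
      then have m: "e0 + s *\<^sub>R \<eta> t \<in> id_range" using f(4)[OF t] by simp
      show "e0 + s *\<^sub>R \<eta> t = id_coord G (inv (g t) \<otimes> ?\<Gamma> s t)"
        using g[OF t] id_param_carrier[OF m] id_coord_param[OF m] by (simp add: inv_mult_cancel)
    qed (use e(1) in simp)
  qed
  ultimately show thesis by (rule that)
qed

end

subsection \<open>Hamilton's principle and the Euler--Poincare condition\<close>

lemma smooth_fun_on_subset: "smooth_fun_on S f \<Longrightarrow> T \<subseteq> S \<Longrightarrow> smooth_fun_on T f"
  unfolding smooth_fun_on_def by blast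

definition first_variation :: "('e::real_inner \<times> 'e \<Rightarrow> real) \<Rightarrow> real \<Rightarrow> (real \<Rightarrow> 'e) \<Rightarrow> (real \<Rightarrow> 'e) \<Rightarrow> real" where
  "first_variation l a v w = integral {0..a}
     (\<lambda>t. fderiv l (v t, velocity a v t) (w t, velocity a w t))"

text \<open>No constraint is put on the variation \<open>w\<close>, so the formula serves both the
  vector-valued families of the reduced principle and the left velocities of families in the
  group.\<close>

lemma first_variation_derivative:
  fixes l :: "'e::real_inner \<times> 'e \<Rightarrow> real"
  assumes fin: "finite_dim TYPE('e)" and l: "smooth_on UNIV l" and "a > 0" "e > 0"
    and sm: "smooth_fun_on (strip e a) (\<lambda>(s, t). \<Gamma> s t)"
    and w: "\<And>t. t \<in> {0..a} \<Longrightarrow> ((\<lambda>s. \<Gamma> s t) has_vector_derivative w t) (at 0)"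
    and v: "\<And>t. t \<in> {0..a} \<Longrightarrow> \<Gamma> 0 t = v t"
  shows "((\<lambda>s. integral {0..a} (\<lambda>t. l (\<Gamma> s t, velocity a (\<Gamma> s) t))) has_real_derivative first_variation l a v w) (at 0)"
  unfolding first_variation_def
proof (rule leibniz_strip[OF \<open>e > 0\<close>])
  note vel = family_velocity[OF \<open>e > 0\<close> \<open>a > 0\<close> sm w]
  have "smooth_fun_on UNIV l" using l by (rule smooth_fun_on_smooth)
  from smooth_fun_on_compose[OF finite_dim_prod[OF fin fin] this smooth_fun_on_Pair[OF sm vel(1)]]
  show "smooth_fun_on (strip e a) (\<lambda>(s, t). l (\<Gamma> s t, velocity a (\<Gamma> s) t))"
    by (simp add: case_prod_beta')
  fix t assume t: "t \<in> {0..a}"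
  have "velocity a (\<Gamma> 0) t = velocity a v t" by (rule velocity_cong[OF t v])
  with smooth_on_chain_vector[OF l UNIV_I has_vector_derivative_Pair[OF w[OF t] vel(2)[OF _ t]]] v[OF t]
  show "((\<lambda>s. l (\<Gamma> s t, velocity a (\<Gamma> s) t)) has_real_derivative
      fderiv l (v t, velocity a v t) (w t, velocity a w t)) (at 0)"
    by (simp add: has_real_derivative_iff_has_vector_derivative)
qed

lemma affine_family:
  fixes c w :: "real \<Rightarrow> 'b::real_normed_vector"
  assumes "smooth_curve a c" "smooth_curve a w"
  shows "(\<lambda>s t. c t + s *\<^sub>R w t) \<in> vector_families a c"
    and "((\<lambda>s. c t + s *\<^sub>R w t) has_vector_derivative w t) (at 0)"
proof -
  have "smooth_fun_on (strip 1 a) (\<lambda>p. c (snd p) + fst p *\<^sub>R w (snd p))"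
    by (intro smooth_fun_intros smooth_fun_on_compose[OF finite_dim_real assms(1)]
        smooth_fun_on_compose[OF finite_dim_real assms(2)]) auto
  then show "(\<lambda>s t. c t + s *\<^sub>R w t) \<in> vector_families a c"
    unfolding vector_families_def by (auto simp: case_prod_beta' intro!: exI[of _ 1])
  show "((\<lambda>s. c t + s *\<^sub>R w t) has_vector_derivative w t) (at 0)"
    by (auto intro!: derivative_eq_intros)
qed

lemma first_variation_cong:
  assumes "\<And>t. t \<in> {0..a} \<Longrightarrow> v t = v' t" "\<And>t. t \<in> {0..a} \<Longrightarrow> w t = w' t"
  shows "first_variation l a v w = first_variation l a v' w'"
  unfolding first_variation_def
proof (rule integral_cong)
  fix t assume t: "t \<in> {0..a}"
  then show "fderiv l (v t, velocity a v t) (w t, velocity a w t) =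
      fderiv l (v' t, velocity a v' t) (w' t, velocity a w' t)"
    using velocity_cong[OF t, of v v'] velocity_cong[OF t, of w w'] assms by simp
qed

text \<open>The weak form of the second-order Euler--Poincare equation for \<open>v\<close>.\<close>

definition (in lie_group) euler_poincare :: "('e \<times> 'e \<Rightarrow> real) \<Rightarrow> real \<Rightarrow> (real \<Rightarrow> 'e) \<Rightarrow> bool" where
  "euler_poincare l a v \<longleftrightarrow> (\<forall>\<eta>. smooth_curve a \<eta> \<and> \<eta> 0 = 0 \<and> \<eta> a = 0 \<and>
     velocity a \<eta> 0 = 0 \<and> velocity a \<eta> a = 0 \<longrightarrow> first_variation l a v (covariant_velocity a v \<eta>) = 0)"

context lie_group
begin

text \<open>The derivative of the action sees a family only through its first-order field. Every
  admissible field is realised by the affine family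
  \<open>v t + s *\<^sub>R covariant_velocity a v \<eta> t\<close>, whose members need not be left
  velocities of group curves near \<open>g\<close>.\<close>

lemma reduced_hamilton_principle_iff:
  assumes "a > 0" "smooth_on UNIV l" "smooth_curve a v"
  shows "reduced_hamilton_principle G l a v \<longleftrightarrow> euler_poincare l a v"
proof
  assume R: "reduced_hamilton_principle G l a v"
  show "euler_poincare l a v"
    unfolding euler_poincare_def
  proof (intro allI impI)
    fix \<eta> :: "real \<Rightarrow> 'e"
    assume \<eta>: "smooth_curve a \<eta> \<and> \<eta> 0 = 0 \<and> \<eta> a = 0 \<and> velocity a \<eta> 0 = 0 \<and> velocity a \<eta> a = 0"
    let ?w = "covariant_velocity a v \<eta>" and ?\<Gamma> = "\<lambda>s t. v t + s *\<^sub>R covariant_velocity a v \<eta> t"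
    note fam = affine_family[OF assms(3) smooth_covariant_velocity[OF assms(1,3) conjunct1[OF \<eta>]]]
    have "?\<Gamma> \<in> reduced_variations G a v"
      unfolding reduced_variations_def
      by (rule CollectI, rule conjI, rule fam(1), rule exI[of _ \<eta>], rule exI[of _ "velocity a \<eta>"])
        (use \<eta> fam(2) smooth_curve_velocity(2)[OF assms(1) conjunct1[OF \<eta>]] in \<open>auto simp: covariant_velocity_def\<close>)
    then have "((\<lambda>s. reduced_action l a (?\<Gamma> s)) has_real_derivative 0) (at 0)"
      using bspec[OF R[unfolded reduced_hamilton_principle_def critical_def], of ?\<Gamma>] by simp
    moreover obtain e where e: "e > 0" "smooth_fun_on (strip e a) (\<lambda>(s, t). ?\<Gamma> s t)"
      using fam(1) \<eta> unfolding vector_families_def by blast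
    have "((\<lambda>s. reduced_action l a (?\<Gamma> s)) has_real_derivative first_variation l a v ?w) (at 0)"
      unfolding reduced_action_def
      by (rule first_variation_derivative[OF fd(1) assms(2,1) e]) (use fam \<eta> in auto)
    ultimately show "first_variation l a v ?w = 0" using DERIV_unique by blast
  qed
next
  assume E: "euler_poincare l a v"
  show "reduced_hamilton_principle G l a v"
    unfolding reduced_hamilton_principle_def critical_def
  proof
    fix \<Gamma> assume \<Gamma>: "\<Gamma> \<in> reduced_variations G a v"
    then obtain \<eta> \<eta>' where \<eta>: "smooth_curve a \<eta>"
      "\<forall>t\<in>{0..a}. (\<eta> has_vector_derivative \<eta>' t) (at t within {0..a})"
      "\<eta> 0 = 0" "\<eta> a = 0" "\<eta>' 0 = 0" "\<eta>' a = 0"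
      "\<forall>t\<in>{0..a}. ((\<lambda>s. \<Gamma> s t) has_vector_derivative (\<eta>' t + ad G (v t) (\<eta> t))) (at 0)"
      unfolding reduced_variations_def by blast
    have \<eta>': "velocity a \<eta> t = \<eta>' t" if "t \<in> {0..a}" for t
      using velocityI[OF assms(1) that] \<eta>(2) that by blast
    obtain e where e: "e > 0" "smooth_fun_on (strip e a) (\<lambda>(s, t). \<Gamma> s t)" "\<forall>t\<in>{0..a}. \<Gamma> 0 t = v t"
      using \<Gamma> unfolding reduced_variations_def vector_families_def by blast
    have "((\<lambda>s. reduced_action l a (\<Gamma> s)) has_real_derivative first_variation l a v (covariant_velocity a v \<eta>)) (at 0)"
      unfolding reduced_action_def
      by (rule first_variation_derivative[OF fd(1) assms(2,1) e(1,2)])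
        (use \<eta>(7) \<eta>' e(3) in \<open>auto simp: covariant_velocity_def\<close>)
    then show "((\<lambda>s. reduced_action l a (\<Gamma> s)) has_real_derivative 0) (at 0)"
      using E \<eta> \<eta>' assms(1) unfolding euler_poincare_def by simp
  qed
qed

text \<open>For small \<open>s\<close> left invariance turns the action into the integral of the
  reduced Lagrangian along the left velocity of \<open>\<Gamma> s\<close>, whose variation is known
  from the Maurer--Cartan identity.\<close>

lemma action_derivative:
  assumes "a > 0" and L: "smooth_lagrangian G L" "left_invariant G L"
    and \<Gamma>: "\<Gamma> \<in> group_families G a g" and \<eta>: "generates a g \<Gamma> \<eta>"
  defines "v \<equiv> left_velocity G {0..a} g"
  shows "((\<lambda>s. action G L a (\<Gamma> s)) has_real_derivative
    first_variation (reduced_lagrangian G L) a v (covariant_velocity a v \<eta>)) (at 0)"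
proof -
  obtain e D h where x: "e > 0" "strip e a \<subseteq> D" "smooth_into (charts G) D h"
    "\<And>s t. s \<in> {-e<..<e} \<Longrightarrow> t \<in> {0..a} \<Longrightarrow> \<Gamma> s t = h (s, t)"
    "\<And>t. t \<in> {0..a} \<Longrightarrow> \<Gamma> 0 t = g t"
    using group_family_extension[OF \<Gamma>] by metis
  let ?V = "\<lambda>s. left_velocity G {0..a} (\<Gamma> s)"
  have "((\<lambda>s. integral {0..a} (\<lambda>t. reduced_lagrangian G L (?V s t, velocity a (?V s) t)))
      has_real_derivative first_variation (reduced_lagrangian G L) a v (covariant_velocity a v \<eta>)) (at 0)"
    unfolding v_def
    by (rule first_variation_derivative[OF fd(1) smooth_reduced_lagrangian[OF L] assms(1) x(1)
          family_left_velocity_smooth[OF assms(1) x] family_left_velocity_derivative[OF assms(1) x \<eta>]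
          left_velocity_cong])
      (use x(5) in auto)
  then show ?thesis
    unfolding has_real_derivative_iff_has_vector_derivative
  proof (rule has_vector_derivative_transform_within_open[OF _ open_greaterThanLessThan[of "-e" e]])
    fix s assume "s \<in> {-e<..<e}"
    then show "integral {0..a} (\<lambda>t. reduced_lagrangian G L (?V s t, velocity a (?V s) t)) = action G L a (\<Gamma> s)"
      unfolding action_def
      using family_lagrangian[OF assms(1) x L(2)] by (intro integral_cong) simp
  qed (use x(1) in simp)
qed

lemma group_family_boundary:
  assumes "a > 0" "\<Gamma> \<in> group_families G a g" "generates a g \<Gamma> \<eta>" "t \<in> {0..a}"
  shows "fixes_value G \<Gamma> t \<longleftrightarrow> \<eta> t = 0"
    and "\<eta> t = 0 \<Longrightarrow> fixes_velocity G a \<Gamma> t \<longleftrightarrow> velocity a \<eta> t = 0"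
proof -
  obtain e D h where x: "e > 0" "strip e a \<subseteq> D" "smooth_into (charts G) D h"
    "\<And>s t. s \<in> {-e<..<e} \<Longrightarrow> t \<in> {0..a} \<Longrightarrow> \<Gamma> s t = h (s, t)"
    "\<And>t. t \<in> {0..a} \<Longrightarrow> \<Gamma> 0 t = g t"
    using group_family_extension[OF assms(2)] by metis
  show "fixes_value G \<Gamma> t \<longleftrightarrow> \<eta> t = 0"
    by (rule fixes_value_iff[OF assms(1) x assms(3,4)])
  show "\<eta> t = 0 \<Longrightarrow> fixes_velocity G a \<Gamma> t \<longleftrightarrow> velocity a \<eta> t = 0"
    by (rule fixes_velocity_iff[OF assms(1) x assms(3,4)])
qed

lemma group_family_generates:
  assumes "a > 0" "\<Gamma> \<in> group_families G a g"
  obtains \<eta> where "generates a g \<Gamma> \<eta>"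
proof -
  obtain e D h where x: "e > 0" "strip e a \<subseteq> D" "smooth_into (charts G) D h"
    "\<And>s t. s \<in> {-e<..<e} \<Longrightarrow> t \<in> {0..a} \<Longrightarrow> \<Gamma> s t = h (s, t)"
    "\<And>t. t \<in> {0..a} \<Longrightarrow> \<Gamma> 0 t = g t"
    using group_family_extension[OF assms(2)] by metis
  show thesis by (rule that[OF family_generator[OF assms(1) x]])
qed

text \<open>The boundary conditions are translated in order: a fixed end value gives
  \<open>\<eta> = 0\<close> there, and only then is a fixed end velocity equivalent to a vanishing
  derivative of \<open>\<eta>\<close>.\<close>

lemma hamilton_principle_iff:
  assumes "a > 0" and L: "smooth_lagrangian G L" "left_invariant G L"
    and g: "smooth_map_on (charts G) {0..a} g"
  shows "hamilton_principle G L a g \<longleftrightarrow> euler_poincare (reduced_lagrangian G L) a (left_velocity G {0..a} g)"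
proof
  let ?v = "left_velocity G {0..a} g"
  have ends: "0 \<in> {0..a}" "a \<in> {0..a}" using assms(1) by auto
  {
    assume H: "hamilton_principle G L a g"
    show "euler_poincare (reduced_lagrangian G L) a ?v"
      unfolding euler_poincare_def
    proof (intro allI impI)
      fix \<eta> :: "real \<Rightarrow> 'e"
      assume \<eta>: "smooth_curve a \<eta> \<and> \<eta> 0 = 0 \<and> \<eta> a = 0 \<and> velocity a \<eta> 0 = 0 \<and> velocity a \<eta> a = 0"
      obtain \<Gamma> where \<Gamma>: "\<Gamma> \<in> group_families G a g" "generates a g \<Gamma> \<eta>"
        using group_family_exists[OF assms(1) g] \<eta> by metis
      note b = group_family_boundary[OF assms(1) \<Gamma>]
      have "\<Gamma> \<in> hamilton_variations G a g"
        using \<Gamma> \<eta> b[OF ends(1)] b[OF ends(2)] unfolding hamilton_variations_def by simp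
      then have "((\<lambda>s. action G L a (\<Gamma> s)) has_real_derivative 0) (at 0)"
        using H unfolding hamilton_principle_def critical_def by blast
      then show "first_variation (reduced_lagrangian G L) a ?v (covariant_velocity a ?v \<eta>) = 0"
        using action_derivative[OF assms(1) L \<Gamma>] DERIV_unique by blast
    qed
  next
    assume E: "euler_poincare (reduced_lagrangian G L) a ?v"
    show "hamilton_principle G L a g"
      unfolding hamilton_principle_def critical_def
    proof
      fix \<Gamma> assume "\<Gamma> \<in> hamilton_variations G a g"
      then have \<Gamma>: "\<Gamma> \<in> group_families G a g" "fixes_value G \<Gamma> 0" "fixes_value G \<Gamma> a"
        "fixes_velocity G a \<Gamma> 0" "fixes_velocity G a \<Gamma> a"
        unfolding hamilton_variations_def by auto
      obtain \<eta> where \<eta>: "generates a g \<Gamma> \<eta>"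
        using group_family_generates[OF assms(1) \<Gamma>(1)] by metis
      note b = group_family_boundary[OF assms(1) \<Gamma>(1) \<eta>]
      have "first_variation (reduced_lagrangian G L) a ?v (covariant_velocity a ?v \<eta>) = 0"
        using E \<eta> \<Gamma> b[OF ends(1)] b[OF ends(2)] unfolding euler_poincare_def generates_def by blast
      then show "((\<lambda>s. action G L a (\<Gamma> s)) has_real_derivative 0) (at 0)"
        using action_derivative[OF assms(1) L \<Gamma>(1) \<eta>] by simp
    qed
  }
qed

end

subsection \<open>The Hamilton--Pontryagin principle\<close>

lemma has_vector_derivative_blinfun_apply:
  assumes "(m has_vector_derivative m') (at t within S)" "(w has_vector_derivative w') (at t within S)"
  shows "((\<lambda>t. blinfun_apply (m t) (w t)) has_vector_derivative
    blinfun_apply (m t) w' + blinfun_apply m' (w t)) (at t within S)"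
  by (rule bounded_bilinear.has_vector_derivative[OF bounded_bilinear_blinfun_apply assms])

lemma integral_by_parts_blinfun:
  fixes m :: "real \<Rightarrow> 'e::real_normed_vector \<Rightarrow>\<^sub>L real"
  assumes "a > 0" "smooth_curve a m" "smooth_curve a w" "w 0 = 0" "w a = 0"
  shows "integral {0..a} (\<lambda>t. blinfun_apply (m t) (velocity a w t) + blinfun_apply (velocity a m t) (w t)) = 0"
proof -
  have "((\<lambda>t. blinfun_apply (m t) (velocity a w t) + blinfun_apply (velocity a m t) (w t)) has_integral
      blinfun_apply (m a) (w a) - blinfun_apply (m 0) (w 0)) {0..a}"
    by (rule fundamental_theorem_of_calculus)
      (use assms(1) in \<open>auto intro!: has_vector_derivative_blinfun_apply
          smooth_curve_velocity(2)[OF assms(1,2)] smooth_curve_velocity(2)[OF assms(1,3)]\<close>)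
  then show ?thesis using assms(4,5) by (simp add: integral_unique)
qed

lemma integral_add_smooth:
  fixes f g :: "real \<Rightarrow> real"
  assumes "smooth_curve a f" "smooth_curve a g"
  shows "integral {0..a} (\<lambda>t. f t + g t) = integral {0..a} f + integral {0..a} g"
  using assms by (intro integral_add integrable_continuous_real smooth_fun_on_continuous)

text \<open>Pointwise linear functionals are assembled into a curve in the dual as a finite
  combination of the functionals \<open>blinfun_inner_left b\<close>. Smoothness of the curve
  thereby reduces to that of its values on fixed vectors.\<close>

lemma functional_represented:
  fixes F :: "real \<Rightarrow> 'e::real_inner \<Rightarrow> real"
  assumes fin: "finite_dim TYPE('e)"
    and lin: "\<And>t. t \<in> S \<Longrightarrow> linear (F t)" and sm: "\<And>w. smooth_fun_on S (\<lambda>t. F t w)"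
  obtains m where "smooth_fun_on S m" "\<And>t w. t \<in> S \<Longrightarrow> blinfun_apply (m t) w = F t w"
proof -
  obtain B :: "'e set" where B: "\<And>x. (\<Sum>b\<in>B. (x \<bullet> b) *\<^sub>R b) = x"
    using finite_dimE[OF fin] by metis
  let ?m = "\<lambda>t. \<Sum>b\<in>B. F t b *\<^sub>R blinfun_inner_left b"
  show thesis
  proof (rule that)
    show "smooth_fun_on S ?m" by (intro smooth_fun_on_sum smooth_fun_intros sm)
    fix t w assume t: "t \<in> S"
    interpret linear "F t" using lin[OF t] .
    have "blinfun_apply (?m t) w = (\<Sum>b\<in>B. (w \<bullet> b) * F t b)"
      by (simp add: blinfun.sum_left blinfun.scaleR_left mult.commute)
    also have "\<dots> = F t (\<Sum>b\<in>B. (w \<bullet> b) *\<^sub>R b)" by (simp add: sum scale)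
    finally show "blinfun_apply (?m t) w = F t w" by (simp only: B)
  qed
qed

text \<open>
  The weight \<open>t\<^sup>2(a - t)\<^sup>2\<close> replaces bump functions in the fundamental lemma of the calculus of
  variations: it vanishes to second order at both ends, and smooth functions are tested against
  their own multiples by it.
\<close>

definition weight :: "real \<Rightarrow> real \<Rightarrow> real" where
  "weight a t = (t * (a - t)) * (t * (a - t))"

lemma smooth_weight: "smooth_fun_on S (weight a)"
  unfolding weight_def by (intro smooth_fun_intros)

lemma weight_boundary [simp]: "weight a 0 = 0" "weight a a = 0"
  by (simp_all add: weight_def)

lemma weight_integral_zero:
  assumes "a > 0" "smooth_curve a h" "integral {0..a} (\<lambda>t. weight a t * h t * h t) = 0" "t \<in> {0..a}"
  shows "h t = 0"
  by (rule weighted_square_integral_zero[OF assms(1) smooth_fun_on_continuous[OF assms(2)]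
        smooth_fun_on_continuous[OF smooth_weight] _ _ _ assms(3,4)])
    (auto simp: weight_def zero_less_mult_iff)

lemma velocity_weighted_boundary:
  fixes f :: "real \<Rightarrow> 'b::real_normed_vector"
  assumes "a > 0" "smooth_curve a f" "t \<in> {0, a}"
  shows "velocity a (\<lambda>t. weight a t *\<^sub>R f t) t = 0"
proof -
  have t: "t \<in> {0..a}" using assms by auto
  have "(weight a has_vector_derivative 0) (at t within {0..a})"
    unfolding weight_def has_real_derivative_iff_has_vector_derivative[symmetric]
    by (use assms(3) in \<open>auto intro!: derivative_eq_intros\<close>)
  from bounded_bilinear.has_vector_derivative[OF bounded_bilinear_scaleR this smooth_curve_velocity(2)[OF assms(1,2) t]]
  show ?thesis using assms(3) by (intro velocityI[OF assms(1) t]) auto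
qed

section \<open>Momenta and the momentum equation\<close>

context lie_group
begin

text \<open>The Ostrogradsky momenta of the second-order Lagrangian along \<open>v\<close>:
  \<open>n\<close> is conjugate to the acceleration slot, \<open>m\<close> to the velocity
  slot.\<close>

definition momenta :: "('e \<times> 'e \<Rightarrow> real) \<Rightarrow> real \<Rightarrow> (real \<Rightarrow> 'e) \<Rightarrow> (real \<Rightarrow> 'e \<Rightarrow>\<^sub>L real) \<Rightarrow> (real \<Rightarrow> 'e \<Rightarrow>\<^sub>L real) \<Rightarrow> bool" where
  "momenta l a v m n \<longleftrightarrow> (\<forall>t\<in>{0..a}. \<forall>w.
     blinfun_apply (n t) w = fderiv l (v t, velocity a v t) (0, w) \<and>
     blinfun_apply (m t) w = fderiv l (v t, velocity a v t) (w, 0) - blinfun_apply (velocity a n t) w)"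

lemma linear_derivative: "smooth_on UNIV l \<Longrightarrow> linear (fderiv l p)" for l :: "'e \<times> 'e \<Rightarrow> real"
  by (rule smooth_on_linear_deriv) auto

lemma derivative_split: "smooth_on UNIV l \<Longrightarrow> fderiv l p (x, y) =
    fderiv l p (x, 0) + fderiv l p (0, y)" for l :: "'e \<times> 'e \<Rightarrow> real"
  using linear_add[OF linear_derivative, of l p "(x, 0)" "(0, y)"] by simp

lemma momenta_exist:
  assumes "a > 0" "smooth_on UNIV l" "smooth_curve a v"
  obtains m n where "smooth_curve a m" "smooth_curve a n" "momenta l a v m n"
proof -
  let ?p = "\<lambda>t. (v t, velocity a v t)"
  note lin = linear_derivative[OF assms(2)]
  have p: "smooth_curve a ?p"
    by (intro smooth_fun_intros assms(3) smooth_curve_velocity(1)[OF assms(1)])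
  note D = smooth_fun_on_deriv_apply[OF fd(2) assms(2) p]
  obtain n where n: "smooth_curve a n"
    "\<And>t w. t \<in> {0..a} \<Longrightarrow> blinfun_apply (n t) w = fderiv l (?p t) (0, w)"
  proof (rule functional_represented[OF fd(1)])
    show "linear (\<lambda>w. fderiv l (?p t) (0, w))" for t
      by (rule linear_compose[OF _ lin, of "\<lambda>w. (0, w)", unfolded comp_def]) (auto intro!: linearI)
    show "smooth_curve a (\<lambda>t. fderiv l (?p t) (0, w))" for w
      by (intro D smooth_fun_intros)
  qed blast
  note n' = smooth_curve_velocity(1)[OF assms(1) n(1)]
  obtain m where m: "smooth_curve a m"
    "\<And>t w. t \<in> {0..a} \<Longrightarrow> blinfun_apply (m t) w = fderiv l (?p t) (w, 0) - blinfun_apply (velocity a n t) w"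
  proof (rule functional_represented[OF fd(1)])
    have "linear (\<lambda>w. fderiv l (?p t) (w, 0))" for t
      by (rule linear_compose[OF _ lin, of "\<lambda>w. (w, 0)", unfolded comp_def]) (auto intro!: linearI)
    then show "linear (\<lambda>w. fderiv l (?p t) (w, 0) - blinfun_apply (velocity a n t) w)" for t
      by (intro linear_compose_sub bounded_linear.linear[OF blinfun.bounded_linear_right])
    show "smooth_curve a (\<lambda>t. fderiv l (?p t) (w, 0) - blinfun_apply (velocity a n t) w)" for w
      by (intro D smooth_fun_intros n')
  qed blast
  show thesis by (rule that[OF m(1) n(1)]) (simp add: momenta_def m(2) n(2))
qed

text \<open>The acceleration term is integrated by parts against \<open>n\<close>; its boundary
  terms vanish with \<open>w\<close>. For \<open>w = covariant_velocity a v \<eta>\<close> this is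
  where the vanishing of both \<open>\<eta>\<close> and its derivative at the ends is used.\<close>

lemma first_variation_momenta:
  assumes "a > 0" "smooth_on UNIV l" and m: "smooth_curve a m" and n: "smooth_curve a n"
    and mom: "momenta l a v m n"
    and w: "smooth_curve a w" "w 0 = 0" "w a = 0"
  shows "first_variation l a v w = integral {0..a} (\<lambda>t. blinfun_apply (m t) (w t))"
proof -
  have "first_variation l a v w = integral {0..a} (\<lambda>t. blinfun_apply (m t) (w t) +
      (blinfun_apply (n t) (velocity a w t) + blinfun_apply (velocity a n t) (w t)))"
    unfolding first_variation_def
  proof (rule integral_cong)
    fix t assume t: "t \<in> {0..a}"
    show "fderiv l (v t, velocity a v t) (w t, velocity a w t) = blinfun_apply (m t) (w t) +
      (blinfun_apply (n t) (velocity a w t) + blinfun_apply (velocity a n t) (w t))"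
      using mom t derivative_split[OF assms(2), of "(v t, velocity a v t)" "w t" "velocity a w t"]
      unfolding momenta_def by simp
  qed
  also have "\<dots> = integral {0..a} (\<lambda>t. blinfun_apply (m t) (w t)) +
      integral {0..a} (\<lambda>t. blinfun_apply (n t) (velocity a w t) + blinfun_apply (velocity a n t) (w t))"
    by (intro integral_add_smooth smooth_fun_intros m n w smooth_curve_velocity(1)[OF assms(1)])
  finally show ?thesis using integral_by_parts_blinfun[OF assms(1) n w] by simp
qed

lemma covariant_velocity_boundary:
  "\<eta> t = 0 \<Longrightarrow> velocity a \<eta> t = 0 \<Longrightarrow> covariant_velocity a v \<eta> t = 0"
  by (simp add: covariant_velocity_def)

text \<open>This reconciles the boundary conditions: the hypothesis tests only fields whose
  derivative also vanishes at the ends, the conclusion lets that derivative be free. After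
  integration by parts the integral is that of \<open>f t (\<eta> t)\<close>, which needs just
  \<open>\<eta> = 0\<close> at the ends; restricted test fields already force \<open>f = 0\<close>,
  the pointwise equation saying that the derivative of \<open>m\<close> is \<open>m\<close> composed
  with \<open>ad G (v t)\<close>.\<close>

lemma momentum_equation:
  fixes m :: "real \<Rightarrow> 'e \<Rightarrow>\<^sub>L real"
  assumes "a > 0" and m: "smooth_curve a m" and v: "smooth_curve a v"
    and vanish: "\<And>\<eta>. smooth_curve a \<eta> \<Longrightarrow> \<eta> 0 = 0 \<Longrightarrow> \<eta> a = 0 \<Longrightarrow> velocity a \<eta> 0 = 0 \<Longrightarrow> velocity a \<eta> a = 0 \<Longrightarrow>
      integral {0..a} (\<lambda>t. blinfun_apply (m t) (covariant_velocity a v \<eta> t)) = 0"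
    and \<eta>: "smooth_curve a \<eta>" "\<eta> 0 = 0" "\<eta> a = 0"
  shows "integral {0..a} (\<lambda>t. blinfun_apply (m t) (covariant_velocity a v \<eta> t)) = 0"
proof -
  define f where "f = (\<lambda>t w. blinfun_apply (m t) (ad G (v t) w) - blinfun_apply (velocity a m t) w)"
  note m' = smooth_curve_velocity(1)[OF assms(1) m]
  have f: "integral {0..a} (\<lambda>t. blinfun_apply (m t) (covariant_velocity a v \<eta> t)) = integral {0..a} (\<lambda>t. f t (\<eta> t))"
    if \<eta>: "smooth_curve a \<eta>" "\<eta> 0 = 0" "\<eta> a = 0" for \<eta>
  proof -
    have "integral {0..a} (\<lambda>t. blinfun_apply (m t) (covariant_velocity a v \<eta> t)) =
      integral {0..a} (\<lambda>t. f t (\<eta> t) + (blinfun_apply (m t) (velocity a \<eta> t) + blinfun_apply (velocity a m t) (\<eta> t)))"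
      by (rule integral_cong) (simp add: f_def covariant_velocity_def blinfun.add_right)
    also have "\<dots> = integral {0..a} (\<lambda>t. f t (\<eta> t)) +
        integral {0..a} (\<lambda>t. blinfun_apply (m t) (velocity a \<eta> t) + blinfun_apply (velocity a m t) (\<eta> t))"
    proof (rule integral_add_smooth)
      show "smooth_curve a (\<lambda>t. f t (\<eta> t))"
        unfolding f_def by (intro smooth_fun_intros m m' \<eta>(1) smooth_fun_on_ad v)
      show "smooth_curve a (\<lambda>t. blinfun_apply (m t) (velocity a \<eta> t) + blinfun_apply (velocity a m t) (\<eta> t))"
        by (intro smooth_fun_intros m m' \<eta>(1) smooth_curve_velocity(1)[OF assms(1)])
    qed
    finally show ?thesis using integral_by_parts_blinfun[OF assms(1) m \<eta>] by simp
  qed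
  have zero: "f t w = 0" if t: "t \<in> {0..a}" for t w
  proof (rule weight_integral_zero[OF assms(1) _ _ t])
    show s: "smooth_curve a (\<lambda>t. f t w)"
      unfolding f_def by (intro smooth_fun_intros m m' smooth_fun_on_ad v)
    \<comment> \<open>For a fixed direction \<open>w\<close>, homogeneity of \<open>f t\<close>
      turns the pairing with this field into the weight times the square of \<open>f t w\<close>;
      the weight supplies the boundary conditions.\<close>
    let ?\<eta> = "\<lambda>t. weight a t *\<^sub>R (f t w *\<^sub>R w)"
    have sw: "smooth_curve a (\<lambda>t. f t w *\<^sub>R w)" by (intro smooth_fun_intros s)
    have \<eta>: "smooth_curve a ?\<eta>" by (intro smooth_fun_intros s smooth_weight)
    have "integral {0..a} (\<lambda>t. f t (?\<eta> t)) = 0"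
      using vanish[OF \<eta>] f[OF \<eta>] velocity_weighted_boundary[OF assms(1) sw] by simp
    moreover have "f t (?\<eta> t) = weight a t * f t w * f t w" for t
    proof -
      have "f t (c *\<^sub>R w) = c * f t w" for c
        by (simp add: f_def ad_scale blinfun.scaleR_right right_diff_distrib)
      then show ?thesis by (simp add: scaleR_scaleR mult.assoc)
    qed
    ultimately show "integral {0..a} (\<lambda>t. weight a t * f t w * f t w) = 0" by simp
  qed
  show ?thesis unfolding f[OF \<eta>] using zero integral_cong[of "{0..a}" "\<lambda>t. f t (\<eta> t)" "\<lambda>t. 0"] by simp
qed

section \<open>Critical points of the Hamilton--Pontryagin action in terms of variation
  fields\<close>

definition hp_first_variation ::
    "('e \<times> 'e \<Rightarrow> real) \<Rightarrow> real \<Rightarrow> (real \<Rightarrow> 'e) \<Rightarrow>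
     (real \<Rightarrow> 'e) \<Rightarrow> (real \<Rightarrow> 'e) \<Rightarrow> (real \<Rightarrow> 'e \<Rightarrow>\<^sub>L real) \<Rightarrow> (real \<Rightarrow> 'e \<Rightarrow>\<^sub>L real) \<Rightarrow>
     (real \<Rightarrow> 'e) \<Rightarrow> (real \<Rightarrow> 'e) \<Rightarrow> (real \<Rightarrow> 'e) \<Rightarrow> (real \<Rightarrow> 'e \<Rightarrow>\<^sub>L real) \<Rightarrow> (real \<Rightarrow> 'e \<Rightarrow>\<^sub>L real) \<Rightarrow> real" where
  "hp_first_variation l a v \<xi> u m n \<eta> d\<xi> du dm dn = integral {0..a} (\<lambda>t.
     fderiv l (\<xi> t, u t) (d\<xi> t, du t)
     + blinfun_apply (dm t) (v t - \<xi> t) + blinfun_apply (m t) (covariant_velocity a v \<eta> t - d\<xi> t)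
     + blinfun_apply (dn t) (velocity a \<xi> t - u t) + blinfun_apply (n t) (velocity a d\<xi> t - du t))"

text \<open>Boundary conditions are put on \<open>\<eta>\<close> and \<open>d\<xi>\<close>
  separately. The derivative of \<open>\<eta>\<close> is free at the ends, unlike in
  \<open>euler_poincare\<close>.\<close>

definition hp_critical ::
    "('e \<times> 'e \<Rightarrow> real) \<Rightarrow> real \<Rightarrow> (real \<Rightarrow> 'e) \<Rightarrow>
     (real \<Rightarrow> 'e) \<Rightarrow> (real \<Rightarrow> 'e) \<Rightarrow> (real \<Rightarrow> 'e \<Rightarrow>\<^sub>L real) \<Rightarrow> (real \<Rightarrow> 'e \<Rightarrow>\<^sub>L real) \<Rightarrow> bool" where
  "hp_critical l a v \<xi> u m n \<longleftrightarrow> (\<forall>\<eta> d\<xi> du dm dn.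
     smooth_curve a \<eta> \<and> smooth_curve a d\<xi> \<and> smooth_curve a du \<and>
     smooth_curve a dm \<and> smooth_curve a dn \<and>
     \<eta> 0 = 0 \<and> \<eta> a = 0 \<and> d\<xi> 0 = 0 \<and> d\<xi> a = 0 \<longrightarrow>
     hp_first_variation l a v \<xi> u m n \<eta> d\<xi> du dm dn = 0)"

lemma velocity_zero: "a > 0 \<Longrightarrow> t \<in> {0..a} \<Longrightarrow> velocity a (\<lambda>t. 0) t = (0 :: 'b::real_normed_vector)"
  by (rule velocityI) simp_all

lemma covariant_velocity_zero: "a > 0 \<Longrightarrow> t \<in> {0..a} \<Longrightarrow> covariant_velocity a v (\<lambda>t. 0) t = 0"
  by (simp add: covariant_velocity_def velocity_zero)

lemma derivative_zero: "smooth_on UNIV l \<Longrightarrow> fderiv l p (0, 0) = 0" for l :: "'e \<times> 'e \<Rightarrow> real"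
  using linear_0[OF linear_derivative] by (simp add: zero_prod_def)

lemma derivative_scale: "smooth_on UNIV l \<Longrightarrow> fderiv l p (c *\<^sub>R x, 0) = c * fderiv l p (x, 0)"
  "smooth_on UNIV l \<Longrightarrow> fderiv l p (0, c *\<^sub>R x) = c * fderiv l p (0, x)"
  for l :: "'e \<times> 'e \<Rightarrow> real"
  using linear_scale[OF linear_derivative, of l p c "(x, 0)"] linear_scale[OF linear_derivative, of l p c "(0, x)"]
  by simp_all

text \<open>With both constraints satisfied, the variations of the multipliers drop out. The
  \<open>du\<close> terms cancel by the choice of \<open>n\<close>, and the \<open>d\<xi>\<close>
  terms by the choice of \<open>m\<close> up to a total derivative. What remains pairs
  \<open>m\<close> with \<open>covariant_velocity a v \<eta>\<close>, for which
  \<open>momentum_equation\<close> removes the condition on the derivative of \<open>\<eta>\<close>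
  at the ends.\<close>

lemma hp_critical_momenta:
  assumes "a > 0" and l: "smooth_on UNIV l" and v: "smooth_curve a v"
    and m: "smooth_curve a m" and n: "smooth_curve a n" and mom: "momenta l a v m n"
    and E: "euler_poincare l a v"
  shows "hp_critical l a v v (velocity a v) m n"
  unfolding hp_critical_def
proof (intro allI impI, elim conjE)
  fix \<eta> x y :: "real \<Rightarrow> 'e" and p q :: "real \<Rightarrow> 'e \<Rightarrow>\<^sub>L real"
  assume s: "smooth_curve a \<eta>" "smooth_curve a x" "smooth_curve a y"
    "smooth_curve a p" "smooth_curve a q" "\<eta> 0 = 0" "\<eta> a = 0" "x 0 = 0" "x a = 0"
  have "hp_first_variation l a v v (velocity a v) m n \<eta> x y p q =
    integral {0..a} (\<lambda>t. blinfun_apply (m t) (covariant_velocity a v \<eta> t) +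
      (blinfun_apply (n t) (velocity a x t) + blinfun_apply (velocity a n t) (x t)))"
    unfolding hp_first_variation_def
  proof (rule integral_cong)
    fix t assume t: "t \<in> {0..a}"
    show "fderiv l (v t, velocity a v t) (x t, y t)
     + blinfun_apply (p t) (v t - v t) + blinfun_apply (m t) (covariant_velocity a v \<eta> t - x t)
     + blinfun_apply (q t) (velocity a v t - velocity a v t) + blinfun_apply (n t) (velocity a x t - y t) =
     blinfun_apply (m t) (covariant_velocity a v \<eta> t) +
      (blinfun_apply (n t) (velocity a x t) + blinfun_apply (velocity a n t) (x t))"
      using mom t derivative_split[OF l, of "(v t, velocity a v t)" "x t" "y t"]
      unfolding momenta_def by (simp add: blinfun.diff_right)
  qed
  also have "\<dots> = integral {0..a} (\<lambda>t. blinfun_apply (m t) (covariant_velocity a v \<eta> t)) +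
      integral {0..a} (\<lambda>t. blinfun_apply (n t) (velocity a x t) + blinfun_apply (velocity a n t) (x t))"
    by (intro integral_add_smooth smooth_fun_intros m n s smooth_curve_velocity(1)[OF assms(1)]
        smooth_covariant_velocity[OF assms(1) v])
  also have "integral {0..a} (\<lambda>t. blinfun_apply (m t) (covariant_velocity a v \<eta> t)) = 0"
  proof (rule momentum_equation[OF assms(1) m v _ s(1,6,7)])
    fix \<eta> :: "real \<Rightarrow> 'e"
    assume \<eta>: "smooth_curve a \<eta>" "\<eta> 0 = 0" "\<eta> a = 0" "velocity a \<eta> 0 = 0" "velocity a \<eta> a = 0"
    have "first_variation l a v (covariant_velocity a v \<eta>) = 0"
      using E \<eta> unfolding euler_poincare_def by blast
    then show "integral {0..a} (\<lambda>t. blinfun_apply (m t) (covariant_velocity a v \<eta> t)) = 0"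
      using first_variation_momenta[OF assms(1) l m n mom smooth_covariant_velocity[OF assms(1) v \<eta>(1)]]
        covariant_velocity_boundary \<eta> by simp
  qed
  finally show "hp_first_variation l a v v (velocity a v) m n \<eta> x y p q = 0"
    using integral_by_parts_blinfun[OF assms(1) n s(2,8,9)] by simp
qed

text \<open>The five variation fields are independent, so all but one are set to zero in turn. Each
  test field is a weighted multiple of the very quantity that is to vanish.\<close>

lemma hp_critical_euler_poincare:
  assumes "a > 0" and l: "smooth_on UNIV l" and v: "smooth_curve a v"
    and \<xi>: "smooth_curve a \<xi>" and u: "smooth_curve a u"
    and m: "smooth_curve a m" and n: "smooth_curve a n"
    and crit: "hp_critical l a v \<xi> u m n"
  shows "euler_poincare l a v"
proof -
  let ?Z = "\<lambda>t::real. 0 :: 'e" and ?O = "\<lambda>t::real. 0 :: 'e \<Rightarrow>\<^sub>L real"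
  have c: "hp_first_variation l a v \<xi> u m n \<eta> x y p q = 0"
    if "smooth_curve a \<eta>" "smooth_curve a x" "smooth_curve a y"
      "smooth_curve a p" "smooth_curve a q" "\<eta> 0 = 0" "\<eta> a = 0" "x 0 = 0" "x a = 0" for \<eta> x y p q
    using crit that unfolding hp_critical_def by blast
  note Z = smooth_fun_on_const
  note vel = smooth_curve_velocity(1)[OF assms(1)]
  note simps = covariant_velocity_zero[OF assms(1)] velocity_zero[OF assms(1)] derivative_zero[OF l] derivative_scale[OF l]
    blinfun.scaleR_left blinfun.scaleR_right blinfun.diff_right blinfun.zero_right blinfun.zero_left
  have D: "smooth_curve a (\<lambda>t. fderiv l (\<xi> t, u t) w)" for w
    by (intro smooth_fun_on_deriv_apply[OF fd(2) l] smooth_fun_intros \<xi> u)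
  \<comment> \<open>Only \<open>\<mu>\<close> is varied, along the covector dual to
    \<open>b\<close>; choosing \<open>b\<close> as the defect itself afterwards makes its norm
    zero.\<close>
  have \<xi>v: "\<xi> t = v t" if t: "t \<in> {0..a}" for t
  proof -
    have "b \<bullet> (v t - \<xi> t) = 0" for b
    proof (rule weight_integral_zero[OF assms(1) _ _ t])
      show s: "smooth_curve a (\<lambda>t. b \<bullet> (v t - \<xi> t))" by (intro smooth_fun_intros v \<xi>)
      let ?p = "\<lambda>t. (weight a t * (b \<bullet> (v t - \<xi> t))) *\<^sub>R blinfun_inner_left b"
      have "smooth_curve a ?p" by (intro smooth_fun_intros s smooth_weight)
      then have "hp_first_variation l a v \<xi> u m n ?Z ?Z ?Z ?p ?O = 0" by (intro c Z) simp_all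
      moreover have "hp_first_variation l a v \<xi> u m n ?Z ?Z ?Z ?p ?O =
          integral {0..a} (\<lambda>t. weight a t * (b \<bullet> (v t - \<xi> t)) * (b \<bullet> (v t - \<xi> t)))"
        unfolding hp_first_variation_def by (rule integral_cong, simp add: simps inner_commute, simp add: inner_diff_right algebra_simps)
      ultimately show "integral {0..a} (\<lambda>t. weight a t * (b \<bullet> (v t - \<xi> t)) * (b \<bullet> (v t - \<xi> t))) = 0" by simp
    qed
    from this[of "v t - \<xi> t"] show ?thesis by simp
  qed
  \<comment> \<open>The same argument with \<open>\<nu>\<close> varied alone gives the second
    constraint.\<close>
  have u\<xi>: "u t = velocity a \<xi> t" if t: "t \<in> {0..a}" for t
  proof -
    have "b \<bullet> (velocity a \<xi> t - u t) = 0" for b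
    proof (rule weight_integral_zero[OF assms(1) _ _ t])
      show s: "smooth_curve a (\<lambda>t. b \<bullet> (velocity a \<xi> t - u t))" by (intro smooth_fun_intros vel u \<xi>)
      let ?q = "\<lambda>t. (weight a t * (b \<bullet> (velocity a \<xi> t - u t))) *\<^sub>R blinfun_inner_left b"
      have "smooth_curve a ?q" by (intro smooth_fun_intros s smooth_weight)
      then have "hp_first_variation l a v \<xi> u m n ?Z ?Z ?Z ?O ?q = 0" by (intro c Z) simp_all
      moreover have "hp_first_variation l a v \<xi> u m n ?Z ?Z ?Z ?O ?q =
          integral {0..a} (\<lambda>t. weight a t * (b \<bullet> (velocity a \<xi> t - u t)) * (b \<bullet> (velocity a \<xi> t - u t)))"
        unfolding hp_first_variation_def by (rule integral_cong, simp add: simps inner_commute, simp add: inner_diff_right algebra_simps)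
      ultimately show "integral {0..a} (\<lambda>t. weight a t * (b \<bullet> (velocity a \<xi> t - u t)) * (b \<bullet> (velocity a \<xi> t - u t))) = 0" by simp
    qed
    from this[of "velocity a \<xi> t - u t"] show ?thesis by simp
  qed
  \<comment> \<open>Only \<open>u\<close> is varied, which identifies \<open>n\<close> with the
    derivative of \<open>l\<close> in its second slot.\<close>
  have nu: "fderiv l (\<xi> t, u t) (0, w) - blinfun_apply (n t) w = 0" if t: "t \<in> {0..a}" for t w
  proof (rule weight_integral_zero[OF assms(1) _ _ t])
    let ?h = "\<lambda>t. fderiv l (\<xi> t, u t) (0, w) - blinfun_apply (n t) w"
    show s: "smooth_curve a ?h" by (intro smooth_fun_intros D n)
    let ?y = "\<lambda>t. (weight a t * ?h t) *\<^sub>R w"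
    have "smooth_curve a ?y" by (intro smooth_fun_intros D n smooth_weight)
    then have "hp_first_variation l a v \<xi> u m n ?Z ?Z ?y ?O ?O = 0" by (intro c Z) simp_all
    moreover have e: "fderiv l (\<xi> t, u t) (0, c *\<^sub>R w) - blinfun_apply (n t) (c *\<^sub>R w) = c * ?h t" for t c
      by (simp add: simps algebra_simps)
    have "hp_first_variation l a v \<xi> u m n ?Z ?Z ?y ?O ?O = integral {0..a} (\<lambda>t. weight a t * ?h t * ?h t)"
      unfolding hp_first_variation_def
    proof (rule integral_cong)
      fix t assume "t \<in> {0..a}"
      then show "fderiv l (\<xi> t, u t) (0, ?y t) + blinfun_apply 0 (v t - \<xi> t) +
          blinfun_apply (m t) (covariant_velocity a v ?Z t - 0) + blinfun_apply 0 (velocity a \<xi> t - u t) +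
          blinfun_apply (n t) (velocity a ?Z t - ?y t) = weight a t * ?h t * ?h t"
        using e[of t "weight a t * ?h t"]
        by (simp only: covariant_velocity_zero[OF assms(1)] velocity_zero[OF assms(1)] blinfun.zero_left
            blinfun.zero_right diff_0 blinfun.minus_right diff_0_right)
    qed
    ultimately show "integral {0..a} (\<lambda>t. weight a t * ?h t * ?h t) = 0" by simp
  qed
  \<comment> \<open>Only \<open>\<xi>\<close> is varied. Its velocity also occurs, paired with
    \<open>n\<close>, and is traded for the derivative of \<open>n\<close>; the weight makes the
    boundary terms vanish.\<close>
  have mu: "fderiv l (\<xi> t, u t) (w, 0) - blinfun_apply (velocity a n t) w - blinfun_apply (m t) w = 0"
    if t: "t \<in> {0..a}" for t w
  proof (rule weight_integral_zero[OF assms(1) _ _ t])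
    let ?h = "\<lambda>t. fderiv l (\<xi> t, u t) (w, 0) - blinfun_apply (velocity a n t) w - blinfun_apply (m t) w"
    show s: "smooth_curve a ?h" by (intro smooth_fun_intros D n m vel)
    let ?x = "\<lambda>t. (weight a t * ?h t) *\<^sub>R w"
    have x: "smooth_curve a ?x" by (intro smooth_fun_intros D n m vel smooth_weight)
    then have "hp_first_variation l a v \<xi> u m n ?Z ?x ?Z ?O ?O = 0" by (intro c Z) simp_all
    moreover have e: "fderiv l (\<xi> t, u t) (c *\<^sub>R w, 0) - blinfun_apply (velocity a n t) (c *\<^sub>R w)
        - blinfun_apply (m t) (c *\<^sub>R w) = c * ?h t" for t c
      by (simp add: simps algebra_simps)
    have "hp_first_variation l a v \<xi> u m n ?Z ?x ?Z ?O ?O =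
        integral {0..a} (\<lambda>t. weight a t * ?h t * ?h t +
          (blinfun_apply (n t) (velocity a ?x t) + blinfun_apply (velocity a n t) (?x t)))"
      unfolding hp_first_variation_def
    proof (rule integral_cong)
      fix t assume "t \<in> {0..a}"
      then show "fderiv l (\<xi> t, u t) (?x t, 0) + blinfun_apply 0 (v t - \<xi> t) +
          blinfun_apply (m t) (covariant_velocity a v ?Z t - ?x t) + blinfun_apply 0 (velocity a \<xi> t - u t) +
          blinfun_apply (n t) (velocity a ?x t - 0) =
          weight a t * ?h t * ?h t + (blinfun_apply (n t) (velocity a ?x t) + blinfun_apply (velocity a n t) (?x t))"
        using e[of t "weight a t * ?h t"]
        by (simp only: covariant_velocity_zero[OF assms(1)] velocity_zero[OF assms(1)] blinfun.zero_left
            blinfun.zero_right diff_0 blinfun.minus_right diff_0_right)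
    qed
    moreover have "\<dots> = integral {0..a} (\<lambda>t. weight a t * ?h t * ?h t) +
        integral {0..a} (\<lambda>t. blinfun_apply (n t) (velocity a ?x t) + blinfun_apply (velocity a n t) (?x t))"
      by (intro integral_add_smooth smooth_fun_intros D n m vel smooth_weight)
    ultimately show "integral {0..a} (\<lambda>t. weight a t * ?h t * ?h t) = 0"
      using integral_by_parts_blinfun[OF assms(1) n x] by simp
  qed
  have mom: "momenta l a v m n"
    unfolding momenta_def
  proof (intro ballI allI)
    fix t w assume t: "t \<in> {0..a}"
    \<comment> \<open>The velocities agree even at the end points because \<open>\<xi>\<close> and
      \<open>v\<close> agree on all of [0,a].\<close>
    have "(\<xi> t, u t) = (v t, velocity a v t)"
      using \<xi>v[OF t] u\<xi>[OF t] velocity_cong[OF t, of \<xi> v] \<xi>v by simp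
    then show "blinfun_apply (n t) w = fderiv l (v t, velocity a v t) (0, w) \<and>
     blinfun_apply (m t) w = fderiv l (v t, velocity a v t) (w, 0) - blinfun_apply (velocity a n t) w"
      using nu[OF t, of w] mu[OF t, of w] by simp
  qed
  show ?thesis
    unfolding euler_poincare_def
  proof (intro allI impI, elim conjE)
    fix \<eta> :: "real \<Rightarrow> 'e"
    assume \<eta>: "smooth_curve a \<eta>" "\<eta> 0 = 0" "\<eta> a = 0" "velocity a \<eta> 0 = 0" "velocity a \<eta> a = 0"
    \<comment> \<open>The remaining freedom is to vary \<open>g\<close> alone, which leaves
      \<open>m\<close> paired with the covariant velocity.\<close>
    have "hp_first_variation l a v \<xi> u m n \<eta> ?Z ?Z ?O ?O = 0" by (intro c Z \<eta>) simp_all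
    moreover have "hp_first_variation l a v \<xi> u m n \<eta> ?Z ?Z ?O ?O =
        integral {0..a} (\<lambda>t. blinfun_apply (m t) (covariant_velocity a v \<eta> t))"
      unfolding hp_first_variation_def by (rule integral_cong) (simp add: simps)
    ultimately show "first_variation l a v (covariant_velocity a v \<eta>) = 0"
      using first_variation_momenta[OF assms(1) l m n mom smooth_covariant_velocity[OF assms(1) v \<eta>(1)]]
        covariant_velocity_boundary \<eta> by simp
  qed
qed

end

section \<open>From families in the Pontryagin bundle to their variation fields\<close>

context lie_group
begin

lemma hp_action_derivative:
  assumes "a > 0" and l: "smooth_on UNIV l"
    and \<Gamma>: "(\<lambda>s. fst \<circ> \<Gamma> s) \<in> group_families G a g" and \<eta>: "generates a g (\<lambda>s. fst \<circ> \<Gamma> s) \<eta>"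
    and Q: "(\<lambda>s. snd \<circ> \<Gamma> s) \<in> vector_families a (\<lambda>t. (\<xi> t, u t, m t, n t))"
    and d: "\<And>t. t \<in> {0..a} \<Longrightarrow> ((\<lambda>s. snd (\<Gamma> s t)) has_vector_derivative (x t, y t, p t, q t)) (at 0)"
  shows "((\<lambda>s. hp_action G l a (\<Gamma> s)) has_real_derivative
    hp_first_variation l a (left_velocity G {0..a} g) \<xi> u m n \<eta> x y p q) (at 0)"
proof -
  obtain e1 D h where h: "e1 > 0" "strip e1 a \<subseteq> D" "smooth_into (charts G) D h"
    "\<And>s t. s \<in> {-e1<..<e1} \<Longrightarrow> t \<in> {0..a} \<Longrightarrow> (fst \<circ> \<Gamma> s) t = h (s, t)"
    "\<And>t. t \<in> {0..a} \<Longrightarrow> (fst \<circ> \<Gamma> 0) t = g t"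
    using group_family_extension[OF \<Gamma>] by metis
  obtain e2 where e2: "e2 > 0" "smooth_fun_on (strip e2 a) (\<lambda>(s, t). (snd \<circ> \<Gamma> s) t)"
    using Q unfolding vector_families_def by blast
  have Q0: "snd (\<Gamma> 0 t) = (\<xi> t, u t, m t, n t)" if "t \<in> {0..a}" for t
    using Q that unfolding vector_families_def by simp
  \<comment> \<open>The group component and the vector components are smooth on strips of unrelated
    widths.\<close>
  define e where "e = min e1 e2"
  have e: "e > 0" "strip e a \<subseteq> strip e1 a" "strip e a \<subseteq> strip e2 a" using h(1) e2(1) by (auto simp: e_def)
  define V where "V = (\<lambda>s. left_velocity G {0..a} (fst \<circ> \<Gamma> s))"
  define X where "X = (\<lambda>s t. fst (snd (\<Gamma> s t)))"
  define Y where "Y = (\<lambda>s t. fst (snd (snd (\<Gamma> s t))))"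
  define M where "M = (\<lambda>s t. fst (snd (snd (snd (\<Gamma> s t)))))"
  define N where "N = (\<lambda>s t. snd (snd (snd (snd (\<Gamma> s t)))))"
  have Qs: "smooth_fun_on (strip e a) (\<lambda>p. snd (\<Gamma> (fst p) (snd p)))"
    using smooth_fun_on_subset[OF e2(2) e(3)] by (simp add: case_prod_beta')
  have sX: "smooth_fun_on (strip e a) (\<lambda>p. X (fst p) (snd p))"
    and sY: "smooth_fun_on (strip e a) (\<lambda>p. Y (fst p) (snd p))"
    and sM: "smooth_fun_on (strip e a) (\<lambda>p. M (fst p) (snd p))"
    and sN: "smooth_fun_on (strip e a) (\<lambda>p. N (fst p) (snd p))"
    unfolding X_def Y_def M_def N_def by (intro smooth_fun_intros Qs)+
  have sV: "smooth_fun_on (strip e a) (\<lambda>p. V (fst p) (snd p))"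
    using smooth_fun_on_subset[OF family_left_velocity_smooth[OF assms(1) h] e(2)]
    by (simp add: V_def case_prod_beta' comp_def)
  have dX: "((\<lambda>s. X s t) has_vector_derivative x t) (at 0)"
    and dY: "((\<lambda>s. Y s t) has_vector_derivative y t) (at 0)"
    and dM: "((\<lambda>s. M s t) has_vector_derivative p t) (at 0)"
    and dN: "((\<lambda>s. N s t) has_vector_derivative q t) (at 0)" if t: "t \<in> {0..a}" for t
    using bounded_linear.has_vector_derivative[OF bounded_linear_fst d[OF t]]
      bounded_linear.has_vector_derivative[OF bounded_linear_fst
        bounded_linear.has_vector_derivative[OF bounded_linear_snd d[OF t]]]
      bounded_linear.has_vector_derivative[OF bounded_linear_fst
        bounded_linear.has_vector_derivative[OF bounded_linear_snd
          bounded_linear.has_vector_derivative[OF bounded_linear_snd d[OF t]]]]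
      bounded_linear.has_vector_derivative[OF bounded_linear_snd
        bounded_linear.has_vector_derivative[OF bounded_linear_snd
          bounded_linear.has_vector_derivative[OF bounded_linear_snd d[OF t]]]]
    by (simp_all add: X_def Y_def M_def N_def)
  have "smooth_fun_on (strip e a) (\<lambda>(s, t). X s t)" using sX by (simp add: case_prod_beta')
  note vel = family_velocity[OF e(1) assms(1) this dX]
  have sXt: "smooth_fun_on (strip e a) (\<lambda>p. velocity a (X (fst p)) (snd p))"
    using vel(1) by (simp add: case_prod_beta')
  have dV: "((\<lambda>s. V s t) has_vector_derivative covariant_velocity a (left_velocity G {0..a} g) \<eta> t) (at 0)"
    if "t \<in> {0..a}" for t
    unfolding V_def by (rule family_left_velocity_derivative[OF assms(1) h \<eta> that])
  have at0: "X 0 t = \<xi> t" "Y 0 t = u t" "M 0 t = m t" "N 0 t = n t" if "t \<in> {0..a}" for t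
    using Q0[OF that] by (simp_all add: X_def Y_def M_def N_def)
  have V0: "V 0 t = left_velocity G {0..a} g t" if "t \<in> {0..a}" for t
    unfolding V_def by (rule left_velocity_cong[OF that h(5)])
  let ?F = "\<lambda>s t. l (X s t, Y s t) + blinfun_apply (M s t) (V s t - X s t) + blinfun_apply (N s t) (velocity a (X s) t - Y s t)"
  have hp: "hp_action G l a (\<Gamma> s) = integral {0..a} (?F s)" for s
    unfolding hp_action_def by (rule integral_cong) (simp add: X_def Y_def M_def N_def V_def case_prod_beta)
  show ?thesis
    unfolding hp hp_first_variation_def
  proof (rule leibniz_strip[OF e(1)])
    have "smooth_fun_on UNIV l" using l by (rule smooth_fun_on_smooth)
    from smooth_fun_on_compose[OF fd(2) this smooth_fun_on_Pair[OF sX sY]]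
    have "smooth_fun_on (strip e a) (\<lambda>p. l (X (fst p) (snd p), Y (fst p) (snd p)))" by simp
    then have "smooth_fun_on (strip e a) (\<lambda>p. ?F (fst p) (snd p))"
      by (intro smooth_fun_intros sX sY sM sN sV sXt)
    then show "smooth_fun_on (strip e a) (\<lambda>(s, t). ?F s t)" by (simp add: case_prod_beta')
    fix t assume t: "t \<in> {0..a}"
    have X0: "velocity a (X 0) t = velocity a \<xi> t" by (rule velocity_cong[OF t at0(1)])
    note dl = smooth_on_chain_vector[OF l UNIV_I has_vector_derivative_Pair[OF dX[OF t] dY[OF t]]]
    note dv = has_vector_derivative_blinfun_apply[OF dM[OF t] has_vector_derivative_diff[OF dV[OF t] dX[OF t]]]
    note dx = has_vector_derivative_blinfun_apply[OF dN[OF t] has_vector_derivative_diff[OF vel(2)[OF _ t] dY[OF t]]]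
    from has_vector_derivative_add[OF has_vector_derivative_add[OF dl dv] dx]
    show "((\<lambda>s. ?F s t) has_real_derivative
       fderiv l (\<xi> t, u t) (x t, y t)
       + blinfun_apply (p t) (left_velocity G {0..a} g t - \<xi> t)
       + blinfun_apply (m t) (covariant_velocity a (left_velocity G {0..a} g) \<eta> t - x t)
       + blinfun_apply (q t) (velocity a \<xi> t - u t) + blinfun_apply (n t) (velocity a x t - y t)) (at 0)"
      unfolding has_real_derivative_iff_has_vector_derivative at0[OF t] V0[OF t] X0
      by (simp add: algebra_simps)
  qed
qed

text \<open>The bundle is trivialised, so a prescribed variation field is realised componentwise: a
  family generated by \<open>\<eta>\<close> in the group, paired with an affine family in the vector
  components. Conversely, a given family enters only through its first-order fields, and its
  boundary conditions are those of \<open>\<eta>\<close> and of the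
  \<open>\<xi>\<close>-component.\<close>

lemma critical_hp_action_iff:
  assumes "a > 0" and l: "smooth_on UNIV l" and \<gamma>: "pontryagin_curve G a \<gamma>"
    and q: "\<And>t. snd (\<gamma> t) = (\<xi> t, u t, m t, n t)"
  shows "critical (hp_action G l a) (hp_variations G a \<gamma>) \<longleftrightarrow>
    hp_critical l a (left_velocity G {0..a} (fst \<circ> \<gamma>)) \<xi> u m n"
proof
  let ?g = "fst \<circ> \<gamma>" and ?q = "\<lambda>t. (\<xi> t, u t, m t, n t)"
  have g: "smooth_map_on (charts G) {0..a} ?g" using \<gamma> unfolding pontryagin_curve_def by blast
  have q': "snd \<circ> \<gamma> = ?q" using q by auto
  have sq: "smooth_curve a ?q" using \<gamma> q' unfolding pontryagin_curve_def by simp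
  have ends: "0 \<in> {0..a}" "a \<in> {0..a}" using assms(1) by auto
  {
    assume C: "critical (hp_action G l a) (hp_variations G a \<gamma>)"
    show "hp_critical l a (left_velocity G {0..a} ?g) \<xi> u m n"
      unfolding hp_critical_def
    proof (intro allI impI, elim conjE)
      fix \<eta> x y :: "real \<Rightarrow> 'e" and p r :: "real \<Rightarrow> 'e \<Rightarrow>\<^sub>L real"
      assume s: "smooth_curve a \<eta>" "smooth_curve a x" "smooth_curve a y"
        "smooth_curve a p" "smooth_curve a r" "\<eta> 0 = 0" "\<eta> a = 0" "x 0 = 0" "x a = 0"
      obtain \<Gamma>1 where \<Gamma>1: "\<Gamma>1 \<in> group_families G a ?g" "generates a ?g \<Gamma>1 \<eta>"
        using group_family_exists[OF assms(1) g s(1)] by metis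
      let ?w = "\<lambda>t. (x t, y t, p t, r t)"
      have sw: "smooth_curve a ?w" by (intro smooth_fun_intros s)
      note fam = affine_family[OF sq sw]
      define \<Gamma> where "\<Gamma> = (\<lambda>s t. (\<Gamma>1 s t, ?q t + s *\<^sub>R ?w t))"
      have \<Gamma>: "(\<lambda>s. fst \<circ> \<Gamma> s) = \<Gamma>1" "(\<lambda>s. snd \<circ> \<Gamma> s) = (\<lambda>s t. ?q t + s *\<^sub>R ?w t)"
        by (simp_all add: \<Gamma>_def comp_def)
      have d: "((\<lambda>s. snd (\<Gamma> s t)) has_vector_derivative ?w t) (at 0)" for t
        using fam(2)[of t] by (simp add: \<Gamma>_def)
      have dx: "((\<lambda>s. fst (snd (\<Gamma> s t))) has_vector_derivative x t) (at 0)" for t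
        using bounded_linear.has_vector_derivative[OF bounded_linear_fst d] by simp
      have "fixes_value G \<Gamma>1 0" "fixes_value G \<Gamma>1 a"
        using group_family_boundary(1)[OF assms(1) \<Gamma>1 ends(1)] group_family_boundary(1)[OF assms(1) \<Gamma>1 ends(2)] s
        by simp_all
      then have "\<forall>t\<in>{0, a}. fixes_value G (\<lambda>s. fst \<circ> \<Gamma> s) t \<and> ((\<lambda>s. fst (snd (\<Gamma> s t))) has_vector_derivative 0) (at 0)"
        unfolding \<Gamma>(1) using dx[of 0] dx[of a] s by simp
      then have "\<Gamma> \<in> hp_variations G a \<gamma>"
        unfolding hp_variations_def \<Gamma> q' using \<Gamma>1(1) fam(1) by (simp add: \<Gamma>)
      then have "((\<lambda>s. hp_action G l a (\<Gamma> s)) has_real_derivative 0) (at 0)"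
        using C unfolding critical_def by blast
      moreover have "((\<lambda>s. hp_action G l a (\<Gamma> s)) has_real_derivative
          hp_first_variation l a (left_velocity G {0..a} ?g) \<xi> u m n \<eta> x y p r) (at 0)"
        by (rule hp_action_derivative[OF assms(1) l _ _ _ d]) (use \<Gamma> \<Gamma>1 fam(1) in simp_all)
      ultimately show "hp_first_variation l a (left_velocity G {0..a} ?g) \<xi> u m n \<eta> x y p r = 0"
        using DERIV_unique by blast
    qed
  next
    assume H: "hp_critical l a (left_velocity G {0..a} ?g) \<xi> u m n"
    show "critical (hp_action G l a) (hp_variations G a \<gamma>)"
      unfolding critical_def
    proof
      fix \<Gamma> assume "\<Gamma> \<in> hp_variations G a \<gamma>"
      then have \<Gamma>: "(\<lambda>s. fst \<circ> \<Gamma> s) \<in> group_families G a ?g" "(\<lambda>s. snd \<circ> \<Gamma> s) \<in> vector_families a ?q"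
        "fixes_value G (\<lambda>s. fst \<circ> \<Gamma> s) 0" "fixes_value G (\<lambda>s. fst \<circ> \<Gamma> s) a"
        "((\<lambda>s. fst (snd (\<Gamma> s 0))) has_vector_derivative 0) (at 0)"
        "((\<lambda>s. fst (snd (\<Gamma> s a))) has_vector_derivative 0) (at 0)"
        unfolding hp_variations_def q' by auto
      obtain \<eta> where \<eta>: "generates a ?g (\<lambda>s. fst \<circ> \<Gamma> s) \<eta>"
        using group_family_generates[OF assms(1) \<Gamma>(1)] by metis
      obtain e where e: "e > 0" "smooth_fun_on (strip e a) (\<lambda>(s, t). (snd \<circ> \<Gamma> s) t)"
        using \<Gamma>(2) unfolding vector_families_def by blast
      obtain w where w: "smooth_curve a w"
        "\<And>t. t \<in> {0..a} \<Longrightarrow> ((\<lambda>s. (snd \<circ> \<Gamma> s) t) has_vector_derivative w t) (at 0)"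
        using family_variation[OF e] by metis
      define x where "x = (\<lambda>t. fst (w t))"
      define y where "y = (\<lambda>t. fst (snd (w t)))"
      define p where "p = (\<lambda>t. fst (snd (snd (w t))))"
      define r where "r = (\<lambda>t. snd (snd (snd (w t))))"
      have d: "((\<lambda>s. snd (\<Gamma> s t)) has_vector_derivative (x t, y t, p t, r t)) (at 0)" if "t \<in> {0..a}" for t
        using w(2)[OF that] by (simp add: x_def y_def p_def r_def)
      have s: "smooth_curve a x" "smooth_curve a y" "smooth_curve a p" "smooth_curve a r"
        unfolding x_def y_def p_def r_def by (intro smooth_fun_intros w(1))+
      have "((\<lambda>s. fst (snd (\<Gamma> s t))) has_vector_derivative x t) (at 0)" if "t \<in> {0..a}" for t
        using bounded_linear.has_vector_derivative[OF bounded_linear_fst d[OF that]] by simp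
      then have "x 0 = 0" "x a = 0" using \<Gamma>(5,6) ends vector_derivative_unique_at by blast+
      moreover have "\<eta> 0 = 0" "\<eta> a = 0"
        using group_family_boundary(1)[OF assms(1) \<Gamma>(1) \<eta>] \<Gamma>(3,4) ends by blast+
      moreover have "smooth_curve a \<eta>" using \<eta> unfolding generates_def by blast
      ultimately have "hp_first_variation l a (left_velocity G {0..a} ?g) \<xi> u m n \<eta> x y p r = 0"
        using H s unfolding hp_critical_def by blast
      then show "((\<lambda>s. hp_action G l a (\<Gamma> s)) has_real_derivative 0) (at 0)"
        using hp_action_derivative[OF assms(1) l \<Gamma>(1) \<eta> \<Gamma>(2) d] by simp
    qed
  }
qed

lemma euler_poincare_cong:
  assumes "\<And>t. t \<in> {0..a} \<Longrightarrow> v t = v' t"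
  shows "euler_poincare l a v \<longleftrightarrow> euler_poincare l a v'"
proof -
  have "first_variation l a v (covariant_velocity a v \<eta>) = first_variation l a v' (covariant_velocity a v' \<eta>)" for \<eta>
    by (rule first_variation_cong) (simp_all add: covariant_velocity_def assms)
  then show ?thesis by (simp add: euler_poincare_def)
qed

text \<open>The base curve of \<open>\<gamma>\<close> agrees with \<open>g\<close> only on [0,a], so
  the condition has to be transported between their left velocities. For existence the left
  velocity, its derivative and the momenta are placed over \<open>g\<close>.\<close>

lemma reduced_hohp_principle_iff:
  assumes "a > 0" and l: "smooth_on UNIV l" and g: "smooth_map_on (charts G) {0..a} g"
  shows "reduced_hohp_principle G l a g \<longleftrightarrow> euler_poincare l a (left_velocity G {0..a} g)"
proof
  assume "reduced_hohp_principle G l a g"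
  then obtain \<gamma> where \<gamma>: "pontryagin_curve G a \<gamma>" "\<And>t. t \<in> {0..a} \<Longrightarrow> fst (\<gamma> t) = g t"
    "critical (hp_action G l a) (hp_variations G a \<gamma>)"
    unfolding reduced_hohp_principle_def by blast
  define \<xi> where "\<xi> = (\<lambda>t. fst (snd (\<gamma> t)))"
  define u where "u = (\<lambda>t. fst (snd (snd (\<gamma> t))))"
  define m where "m = (\<lambda>t. fst (snd (snd (snd (\<gamma> t)))))"
  define n where "n = (\<lambda>t. snd (snd (snd (snd (\<gamma> t)))))"
  have q: "snd (\<gamma> t) = (\<xi> t, u t, m t, n t)" for t by (simp add: \<xi>_def u_def m_def n_def)
  have sq: "smooth_curve a (\<lambda>t. snd (\<gamma> t))" and g': "smooth_map_on (charts G) {0..a} (fst \<circ> \<gamma>)"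
    using \<gamma>(1) by (simp_all add: pontryagin_curve_def comp_def)
  have s: "smooth_curve a \<xi>" "smooth_curve a u" "smooth_curve a m" "smooth_curve a n"
    unfolding \<xi>_def u_def m_def n_def by (intro smooth_fun_intros sq)+
  have "euler_poincare l a (left_velocity G {0..a} (fst \<circ> \<gamma>))"
    by (rule hp_critical_euler_poincare[OF assms(1) l smooth_left_velocity[OF assms(1) g'] s
          iffD1[OF critical_hp_action_iff[OF assms(1) l \<gamma>(1) q] \<gamma>(3)]])
  moreover have "left_velocity G {0..a} (fst \<circ> \<gamma>) t = left_velocity G {0..a} g t" if "t \<in> {0..a}" for t
    by (rule left_velocity_cong[OF that]) (simp add: \<gamma>(2))
  ultimately show "euler_poincare l a (left_velocity G {0..a} g)"
    using euler_poincare_cong[of a "left_velocity G {0..a} (fst \<circ> \<gamma>)" "left_velocity G {0..a} g" l] by simp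
next
  let ?v = "left_velocity G {0..a} g"
  assume E: "euler_poincare l a ?v"
  note v = smooth_left_velocity[OF assms(1) g]
  obtain m n where mn: "smooth_curve a m" "smooth_curve a n" "momenta l a ?v m n"
    using momenta_exist[OF assms(1) l v] by metis
  let ?\<gamma> = "\<lambda>t. (g t, ?v t, velocity a ?v t, m t, n t)"
  have "smooth_curve a (\<lambda>t. (?v t, velocity a ?v t, m t, n t))"
    by (intro smooth_fun_intros v mn smooth_curve_velocity(1)[OF assms(1)])
  then have \<gamma>: "pontryagin_curve G a ?\<gamma>" using g by (simp add: pontryagin_curve_def comp_def)
  have "critical (hp_action G l a) (hp_variations G a ?\<gamma>)"
    using critical_hp_action_iff[OF assms(1) l \<gamma>, of ?v "velocity a ?v" m n]
      hp_critical_momenta[OF assms(1) l v mn E] by (simp add: comp_def)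
  then show "reduced_hohp_principle G l a g"
    unfolding reduced_hohp_principle_def using \<gamma> by (intro exI[of _ ?\<gamma>]) simp
qed

end

theorem theorem2p1:
  fixes G :: "('g, 'e::real_inner) lie_data"
    and L :: "(real \<Rightarrow> 'g) set \<Rightarrow> real"
    and l :: "'e \<times> 'e \<Rightarrow> real"
    and g :: "real \<Rightarrow> 'g"
    and a :: real
  assumes "lie_group G"
    and "a > 0"
    and "smooth_lagrangian G L"
    and "left_invariant G L"
    and "l = reduced_lagrangian G L"
    and "smooth_map_on (charts G) {0..a} g"
  shows "(hamilton_principle G L a g
            \<longleftrightarrow> reduced_hamilton_principle G l a (left_velocity G {0..a} g))
       \<and> (reduced_hamilton_principle G l a (left_velocity G {0..a} g)
            \<longleftrightarrow> reduced_hohp_principle G l a g)"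
proof -
  interpret lie_group G by (rule assms(1))
  have l: "smooth_on UNIV l"
    unfolding assms(5) by (rule smooth_reduced_lagrangian[OF assms(3,4)])
  show ?thesis
    using hamilton_principle_iff[OF assms(2-4,6)] reduced_hohp_principle_iff[OF assms(2) l assms(6)]
      reduced_hamilton_principle_iff[OF assms(2) l smooth_left_velocity[OF assms(2,6)]]
    by (simp add: assms(5))
qed

end
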